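(* For every parity complex $C$, the $\omega$-category $\mathcal{O}C$ is freely generated by its atoms.
   Context: **Parity complexes.** A parity structure is a graded set $C=(C_n)_{n\ge 0}$ together with, for each $n\ge0$ and $x\in C_{n+1}$, a disjoint pair of finite subsets $x^-,x^+\subseteq C_n$. For $n>0$ and $S\subseteq C_n$ put $S^-=\bigcup_{x\in S}x^-$, $S^+=\bigcup_{x\in S}x^+$, $S^\mp=S^-\setminus S^+$, $S^\pm=S^+\setminus S^-$. A subset $S\subseteq C_n$ is well-formed if (i) $n=0$ and $S$ is a singleton, or (ii) $n>0$ and for all $x\ne y$ in $S$, $x^-\cap y^-=x^+\cap y^+=\emptyset$. For $x\in C_n$ define $\mu(x)_n=\pi(x)_n=\{x\}$, $\mu(x)_{k-1}=\mu(x)_k^\mp$, $\pi(x)_{k-1}=\pi(x)_k^\pm$ for $1\le k\le n$. A parity complex is a parity structure $C$ which is - globular: for all $n\ge2$, $x\in C_n$: $(x^-)^\mp=(x^+)^\mp$ and $(x^-)^\pm=(x^+)^\pm$; - unital: for all $n\ge 0$, $x\in C_n$, $0\le k\le n$, the subsets $\mu(x)_k,\pi(x)_k$ are well-formed; - strongly loop-free: there is a partial order $\blacktriangleleft$ on $\coprod_n C_n$ such that $x\blacktriangleleft y$ whenever $x\in y^-$ or $y\in x^+$. **The complex $\mathbb{Z}C$.** For a parity complex $C$, $\mathbb{Z}C$ is the chain complex with $(\mathbb{Z}C)_n=\mathbb{Z}C_n$ the free abelian group on $C_n$, $\partial x=\sum_{y\in x^+}y-\sum_{y\in x^-}y$ for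 $x\in C_{n+1}$, with positive cone $(\mathbb{Z}C)_n^*=\mathbb{N}C_n$ in each degree and with augmentation $\varepsilon\colon\mathbb{Z}C_0\to\mathbb{Z}$ sending each $x\in C_0$ to $1$. (This is an augmented directed complex.) A finite subset of $C_n$ is identified with the sum of its elements. **The $\omega$-category $\mathcal{O}C$.** $\mathcal{O}C=\nu(\mathbb{Z}C)$ is the strict $\omega$-category in which, with $K=\mathbb{Z}C$, an $n$-cell is a table $$x=\begin{pmatrix} x_0^- & \cdots & x_n^- \\ x_0^+ & \cdots & x_n^+ \end{pmatrix}$$ with $x_k^\alpha\in K_k^*$ ($\alpha\in\{-,+\}$, $0\le k\le n$), $\partial x_{k+1}^\alpha=x_k^+-x_k^-$ for $0\le k<n$, $x_n^-=x_n^+=:x_n$, and $\varepsilon(x_0^-)=\varepsilon(x_0^+)=1$. For $k<n$ the $k$-source $s_kx$ (resp. $k$-target $t_kx$) is the $k$-cell with columns $0,\dots,k-1$ those of $x$ and last column two copies of $x_k^-$ (resp. $x_k^+$). If $t_kx=s_ky$, the $k$-composite is $$x\circ_k y=\begin{pmatrix} x_0^- & \cdots & x_k^- & x_{k+1}^-+y_{k+1}^- & \cdots & x_n^-+y_n^- \\ y_0^+ & \cdots & y_k^+ & x_{k+1}^++y_{k+1}^+ & \cdots & x_n^++y_n^+ \end{pmatrix}.$$ The identity $(n+1)$-cell on $x$ adjoins a last column of two zeros. The atoms of $\mathcal{O}C$ are the $n$-cells $$\langle x\rangle=\begin{pmatrix} \mu(x)_0 & \cdots & \mu(x)_n \\ \pi(x)_0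 & \cdots & \pi(x)_n \end{pmatrix},\qquad n\ge0,\ x\in C_n.$$ **Free generation (Street).** For an $\omega$-category $A$, let $|A|_n$ be its $n$-skeleton (the sub-$\omega$-category generated by the cells of dimension $\le n$, i.e. an $n$-category). $A$ is freely generated by a set $G$ of its cells (with $G_n$ those of dimension $n$) if $G_0$ is the set of all $0$-cells of $A$ and, for every $n\ge0$, every $\omega$-category $X$, every $\omega$-functor $f\colon|A|_n\to X$, and every function $g$ from $G_{n+1}$ to the $(n+1)$-cells of $X$ with $s_n(g(a))=f(s_na)$ and $t_n(g(a))=f(t_na)$ for all $a\in G_{n+1}$, there is a unique $\omega$-functor $h\colon|A|_{n+1}\to X$ extending both $f$ and $g$. *)

theory Defs
  imports Main "HOL-Library.Poly_Mapping"
begin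

section \<open>Strict omega-categories\<close>

text \<open>
  An omega-category is presented by its sets of n-cells. In a record \<open>A\<close>,
  \<open>src A k n x\<close> and \<open>tgt A k n x\<close> are the k-source and k-target of the n-cell \<open>x\<close> (\<open>k < n\<close>),
  \<open>ide A n x\<close> is the identity (n+1)-cell on the n-cell \<open>x\<close>, and \<open>cmp A k n x y\<close> is the
  k-composite of the n-cells \<open>x\<close> and \<open>y\<close> in diagrammatic order, meaningful if the k-target of
  \<open>x\<close> is the k-source of \<open>y\<close>. Dimensions are always passed explicitly, so the sets
  \<open>cell A n\<close> need not be disjoint for different \<open>n\<close>.
\<close>

record 'c omega_data =
  cell :: "nat \<Rightarrow> 'c set"
  src :: "nat \<Rightarrow> nat \<Rightarrow> 'c \<Rightarrow> 'c"
  tgt :: "nat \<Rightarrow> nat \<Rightarrow> 'c \<Rightarrow> 'c"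
  ide :: "nat \<Rightarrow> 'c \<Rightarrow> 'c"
  cmp :: "nat \<Rightarrow> nat \<Rightarrow> 'c \<Rightarrow> 'c \<Rightarrow> 'c"

text \<open>The iterated identity (k+d)-cell on a k-cell.\<close>

primrec ides :: "'c omega_data \<Rightarrow> nat \<Rightarrow> nat \<Rightarrow> 'c \<Rightarrow> 'c" where
  "ides A k 0 x = x"
| "ides A k (Suc d) x = ide A (k + d) (ides A k d x)"

definition composable :: "'c omega_data \<Rightarrow> nat \<Rightarrow> nat \<Rightarrow> 'c \<Rightarrow> 'c \<Rightarrow> bool" where
  "composable A k n x y \<longleftrightarrow>
     k < n \<and> x \<in> cell A n \<and> y \<in> cell A n \<and> tgt A k n x = src A k n y"

locale omega_category =
  fixes A :: "'c omega_data"
  assumes src_cell: "k < n \<Longrightarrow> x \<in> cell A n \<Longrightarrow> src A k n x \<in> cell A k"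
    and tgt_cell: "k < n \<Longrightarrow> x \<in> cell A n \<Longrightarrow> tgt A k n x \<in> cell A k"
    and ide_cell: "x \<in> cell A n \<Longrightarrow> ide A n x \<in> cell A (Suc n)"
    and comp_cell: "composable A k n x y \<Longrightarrow> cmp A k n x y \<in> cell A n"
    and src_src: "j < k \<Longrightarrow> k < n \<Longrightarrow> x \<in> cell A n \<Longrightarrow> src A j k (src A k n x) = src A j n x"
    and src_tgt: "j < k \<Longrightarrow> k < n \<Longrightarrow> x \<in> cell A n \<Longrightarrow> src A j k (tgt A k n x) = src A j n x"
    and tgt_src: "j < k \<Longrightarrow> k < n \<Longrightarrow> x \<in> cell A n \<Longrightarrow> tgt A j k (src A k n x) = tgt A j n x"
    and tgt_tgt: "j < k \<Longrightarrow> k < n \<Longrightarrow> x \<in> cell A n \<Longrightarrow> tgt A j k (tgt A k n x) = tgt A j n x"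
    and src_ide: "x \<in> cell A n \<Longrightarrow> src A n (Suc n) (ide A n x) = x"
    and tgt_ide: "x \<in> cell A n \<Longrightarrow> tgt A n (Suc n) (ide A n x) = x"
    and src_comp: "composable A k n x y \<Longrightarrow> src A k n (cmp A k n x y) = src A k n x"
    and tgt_comp: "composable A k n x y \<Longrightarrow> tgt A k n (cmp A k n x y) = tgt A k n y"
    and src_comp_above: "composable A k n x y \<Longrightarrow> k < j \<Longrightarrow> j < n \<Longrightarrow>
          src A j n (cmp A k n x y) = cmp A k j (src A j n x) (src A j n y)"
    and tgt_comp_above: "composable A k n x y \<Longrightarrow> k < j \<Longrightarrow> j < n \<Longrightarrow>
          tgt A j n (cmp A k n x y) = cmp A k j (tgt A j n x) (tgt A j n y)"
    and comp_assoc: "composable A k n x y \<Longrightarrow> composable A k n y z \<Longrightarrow>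
          cmp A k n (cmp A k n x y) z = cmp A k n x (cmp A k n y z)"
    and unit_left: "k < n \<Longrightarrow> x \<in> cell A n \<Longrightarrow>
          cmp A k n (ides A k (n - k) (src A k n x)) x = x"
    and unit_right: "k < n \<Longrightarrow> x \<in> cell A n \<Longrightarrow>
          cmp A k n x (ides A k (n - k) (tgt A k n x)) = x"
    and ide_comp: "composable A k n x y \<Longrightarrow>
          ide A n (cmp A k n x y) = cmp A k (Suc n) (ide A n x) (ide A n y)"
    and interchange: "j < k \<Longrightarrow> composable A k n x y \<Longrightarrow> composable A k n z w \<Longrightarrow>
          composable A j n x z \<Longrightarrow>
          cmp A j n (cmp A k n x y) (cmp A k n z w) =
          cmp A k n (cmp A j n x z) (cmp A j n y w)"

text \<open>A functor is a family of maps on n-cells; it only matters on the cells of its domain.\<close>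

locale omega_functor =
  fixes A :: "'c omega_data" and B :: "'d omega_data" and f :: "nat \<Rightarrow> 'c \<Rightarrow> 'd"
  assumes map_cell: "x \<in> cell A n \<Longrightarrow> f n x \<in> cell B n"
    and map_src: "k < n \<Longrightarrow> x \<in> cell A n \<Longrightarrow> f k (src A k n x) = src B k n (f n x)"
    and map_tgt: "k < n \<Longrightarrow> x \<in> cell A n \<Longrightarrow> f k (tgt A k n x) = tgt B k n (f n x)"
    and map_ide: "x \<in> cell A n \<Longrightarrow> f (Suc n) (ide A n x) = ide B n (f n x)"
    and map_comp: "composable A k n x y \<Longrightarrow> f n (cmp A k n x y) = cmp B k n (f n x) (f n y)"

text \<open>\<open>generated A S n x\<close>: \<open>x\<close> is an n-cell of the sub-omega-category of \<open>A\<close> generated by \<open>S\<close>.\<close>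

inductive generated :: "'c omega_data \<Rightarrow> (nat \<Rightarrow> 'c set) \<Rightarrow> nat \<Rightarrow> 'c \<Rightarrow> bool"
  for A :: "'c omega_data" and S :: "nat \<Rightarrow> 'c set"
where
  base: "x \<in> S n \<Longrightarrow> generated A S n x"
| src: "generated A S n x \<Longrightarrow> k < n \<Longrightarrow> generated A S k (src A k n x)"
| tgt: "generated A S n x \<Longrightarrow> k < n \<Longrightarrow> generated A S k (tgt A k n x)"
| ide: "generated A S n x \<Longrightarrow> generated A S (Suc n) (ide A n x)"
| cmp: "generated A S n x \<Longrightarrow> generated A S n y \<Longrightarrow> k < n \<Longrightarrow> tgt A k n x = src A k n y \<Longrightarrow>
    generated A S n (cmp A k n x y)"

definition skeleton :: "nat \<Rightarrow> 'c omega_data \<Rightarrow> 'c omega_data" where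
  "skeleton n A =
     A\<lparr>cell := \<lambda>m. {x. generated A (\<lambda>j. if j \<le> n then cell A j else {}) m x}\<rparr>"

text \<open>
  Free generation by \<open>G\<close>, where \<open>G n\<close> is the set of generators of dimension \<open>n\<close>. The quantifier
  over all omega-categories \<open>X\<close> cannot range over types inside a formula; the first argument
  fixes the type of cells of \<open>X\<close>, and universality is expressed by a free type variable \<open>'d\<close>
  in a theorem. Uniqueness of \<open>h\<close> is equality on the cells of the skeleton.
\<close>

definition freely_generated ::
    "'d itself \<Rightarrow> 'c omega_data \<Rightarrow> (nat \<Rightarrow> 'c set) \<Rightarrow> bool" where
  "freely_generated (_ :: 'd itself) A G \<longleftrightarrow>
     omega_category A \<and> (\<forall>n. G n \<subseteq> cell A n) \<and> G 0 = cell A 0 \<and>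
     (\<forall>n (X :: 'd omega_data) f g.
        omega_category X \<and> omega_functor (skeleton n A) X f \<and>
        (\<forall>a \<in> G (Suc n). g a \<in> cell X (Suc n) \<and>
           src X n (Suc n) (g a) = f n (src A n (Suc n) a) \<and>
           tgt X n (Suc n) (g a) = f n (tgt A n (Suc n) a)) \<longrightarrow>
        (let extends = (\<lambda>h. omega_functor (skeleton (Suc n) A) X h \<and>
               (\<forall>m. \<forall>x \<in> cell (skeleton n A) m. h m x = f m x) \<and>
               (\<forall>a \<in> G (Suc n). h (Suc n) a = g a))
         in (\<exists>h. extends h) \<and>
            (\<forall>h h'. extends h \<and> extends h' \<longrightarrow>
               (\<forall>m. \<forall>x \<in> cell (skeleton (Suc n) A) m. h m x = h' m x))))"


section \<open>Parity complexes\<close>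

text \<open>
  \<open>minus_face C n x\<close> and \<open>plus_face C n x\<close> are the face sets of an element \<open>x\<close> of degree \<open>n\<close>;
  they are only meaningful for \<open>n > 0\<close>. Here \<open>n\<close> is the degree of \<open>x\<close>, not of its faces.
\<close>

record 'a parity_data =
  elts :: "nat \<Rightarrow> 'a set"
  minus_face :: "nat \<Rightarrow> 'a \<Rightarrow> 'a set"
  plus_face :: "nat \<Rightarrow> 'a \<Rightarrow> 'a set"

locale parity_structure =
  fixes C :: "'a parity_data"
  assumes minus_elts: "x \<in> elts C (Suc n) \<Longrightarrow> minus_face C (Suc n) x \<subseteq> elts C n"
    and plus_elts: "x \<in> elts C (Suc n) \<Longrightarrow> plus_face C (Suc n) x \<subseteq> elts C n"
    and finite_minus: "x \<in> elts C (Suc n) \<Longrightarrow> finite (minus_face C (Suc n) x)"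
    and finite_plus: "x \<in> elts C (Suc n) \<Longrightarrow> finite (plus_face C (Suc n) x)"
    and disjoint_faces: "x \<in> elts C (Suc n) \<Longrightarrow> minus_face C (Suc n) x \<inter> plus_face C (Suc n) x = {}"

text \<open>For a set \<open>S\<close> of elements of degree \<open>n > 0\<close>, the sets \<open>S\<^sup>-\<close>, \<open>S\<^sup>+\<close>,
  \<open>S\<^sup>- - S\<^sup>+\<close> and \<open>S\<^sup>+ - S\<^sup>-\<close>.\<close>

definition minus_faces :: "'a parity_data \<Rightarrow> nat \<Rightarrow> 'a set \<Rightarrow> 'a set" where
  "minus_faces C n S = (\<Union>x\<in>S. minus_face C n x)"

definition plus_faces :: "'a parity_data \<Rightarrow> nat \<Rightarrow> 'a set \<Rightarrow> 'a set" where
  "plus_faces C n S = (\<Union>x\<in>S. plus_face C n x)"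

definition minus_plus :: "'a parity_data \<Rightarrow> nat \<Rightarrow> 'a set \<Rightarrow> 'a set" where
  "minus_plus C n S = minus_faces C n S - plus_faces C n S"

definition plus_minus :: "'a parity_data \<Rightarrow> nat \<Rightarrow> 'a set \<Rightarrow> 'a set" where
  "plus_minus C n S = plus_faces C n S - minus_faces C n S"

definition well_formed :: "'a parity_data \<Rightarrow> nat \<Rightarrow> 'a set \<Rightarrow> bool" where
  "well_formed C n S \<longleftrightarrow> S \<subseteq> elts C n \<and>
     (if n = 0 then \<exists>x. S = {x}
      else \<forall>x\<in>S. \<forall>y\<in>S. x \<noteq> y \<longrightarrow>
             minus_face C n x \<inter> minus_face C n y = {} \<and> plus_face C n x \<inter> plus_face C n y = {})"

text \<open>The sets \<open>\<mu>(x)\<^sub>k\<close> and \<open>\<pi>(x)\<^sub>k\<close>, written \<open>mu_set C n x k\<close> and \<open>pi_set C n x k\<close>, for \<open>x\<close> of degree \<open>n\<close> and \<open>k \<le> n\<close>; the value for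
  \<open>k > n\<close> is junk.\<close>

function mu_set :: "'a parity_data \<Rightarrow> nat \<Rightarrow> 'a \<Rightarrow> nat \<Rightarrow> 'a set" where
  "mu_set C n x k = (if k < n then minus_plus C (Suc k) (mu_set C n x (Suc k)) else {x})"
  by pat_completeness auto
termination by (relation "measure (\<lambda>(C, n, x, k). n - k)") auto

function pi_set :: "'a parity_data \<Rightarrow> nat \<Rightarrow> 'a \<Rightarrow> nat \<Rightarrow> 'a set" where
  "pi_set C n x k = (if k < n then plus_minus C (Suc k) (pi_set C n x (Suc k)) else {x})"
  by pat_completeness auto
termination by (relation "measure (\<lambda>(C, n, x, k). n - k)") auto

declare mu_set.simps [simp del] pi_set.simps [simp del]

text \<open>The disjoint union of the sets of elements is \<open>SIGMA n:UNIV. elts C n\<close>.\<close>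

locale parity_complex = parity_structure C for C :: "'a parity_data" +
  assumes globular_minus: "n \<ge> 2 \<Longrightarrow> x \<in> elts C n \<Longrightarrow>
        minus_plus C (n - 1) (minus_face C n x) = minus_plus C (n - 1) (plus_face C n x)"
    and globular_plus: "n \<ge> 2 \<Longrightarrow> x \<in> elts C n \<Longrightarrow>
        plus_minus C (n - 1) (minus_face C n x) = plus_minus C (n - 1) (plus_face C n x)"
    and unital_mu: "x \<in> elts C n \<Longrightarrow> k \<le> n \<Longrightarrow> well_formed C k (mu_set C n x k)"
    and unital_pi: "x \<in> elts C n \<Longrightarrow> k \<le> n \<Longrightarrow> well_formed C k (pi_set C n x k)"
    and strongly_loop_free:
      "\<exists>r. partial_order_on (SIGMA n:UNIV. elts C n) r \<and>
         (\<forall>n. \<forall>x \<in> elts C n. \<forall>y \<in> elts C (Suc n).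
            (x \<in> minus_face C (Suc n) y \<longrightarrow> ((n, x), (Suc n, y)) \<in> r) \<and>
            (x \<in> plus_face C (Suc n) y \<longrightarrow> ((Suc n, y), (n, x)) \<in> r))"


section \<open>The augmented directed complex of a parity complex\<close>

text \<open>
  The free abelian group on the elements of degree \<open>n\<close> consists of the finitely supported
  functions \<open>'a \<Rightarrow>\<^sub>0 int\<close> with support in \<open>elts C n\<close>; \<open>pos_cone C n\<close> is its positive cone.
\<close>

definition pos_cone :: "'a parity_data \<Rightarrow> nat \<Rightarrow> ('a \<Rightarrow>\<^sub>0 int) set" where
  "pos_cone C n = {c. Poly_Mapping.keys c \<subseteq> elts C n \<and> (\<forall>x. 0 \<le> Poly_Mapping.lookup c x)}"

definition set_chain :: "'a set \<Rightarrow> ('a \<Rightarrow>\<^sub>0 int)" where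
  "set_chain S = (\<Sum>x\<in>S. frag_of x)"

text \<open>\<open>bd C n\<close> is the boundary of chains of degree \<open>n > 0\<close>.\<close>

definition bd :: "'a parity_data \<Rightarrow> nat \<Rightarrow> ('a \<Rightarrow>\<^sub>0 int) \<Rightarrow> ('a \<Rightarrow>\<^sub>0 int)" where
  "bd C n = frag_extend (\<lambda>x. set_chain (plus_face C n x) - set_chain (minus_face C n x))"

definition aug :: "('a \<Rightarrow>\<^sub>0 int) \<Rightarrow> int" where
  "aug c = (\<Sum>x \<in> Poly_Mapping.keys c. Poly_Mapping.lookup c x)"


section \<open>The omega-category of a parity complex\<close>

text \<open>
  A table is represented by its sequence of columns \<open>x k = (x\<^sub>k\<^sup>-, x\<^sub>k\<^sup>+)\<close>. The table of an
  n-cell has the columns \<open>0, \<dots>, n\<close>; all further columns are required to be zero, so that an n-cell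
  is determined by its genuine columns. In particular adjoining a zero column, which yields
  the identity on a cell, leaves the representing sequence unchanged; only the dimension, which
  is tracked separately, increases.
\<close>

type_synonym 'a table = "nat \<Rightarrow> ('a \<Rightarrow>\<^sub>0 int) \<times> ('a \<Rightarrow>\<^sub>0 int)"

definition table_cell :: "'a parity_data \<Rightarrow> nat \<Rightarrow> 'a table set" where
  "table_cell C n = {x.
     (\<forall>k\<le>n. fst (x k) \<in> pos_cone C k \<and> snd (x k) \<in> pos_cone C k) \<and>
     (\<forall>k<n. bd C (Suc k) (fst (x (Suc k))) = snd (x k) - fst (x k) \<and>
            bd C (Suc k) (snd (x (Suc k))) = snd (x k) - fst (x k)) \<and>
     fst (x n) = snd (x n) \<and>
     aug (fst (x 0)) = 1 \<and> aug (snd (x 0)) = 1 \<and>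
     (\<forall>k>n. x k = (0, 0))}"

definition table_src :: "nat \<Rightarrow> 'a table \<Rightarrow> 'a table" where
  "table_src k x = (\<lambda>j. if j < k then x j else if j = k then (fst (x k), fst (x k)) else (0, 0))"

definition table_tgt :: "nat \<Rightarrow> 'a table \<Rightarrow> 'a table" where
  "table_tgt k x = (\<lambda>j. if j < k then x j else if j = k then (snd (x k), snd (x k)) else (0, 0))"

definition table_comp :: "nat \<Rightarrow> 'a table \<Rightarrow> 'a table \<Rightarrow> 'a table" where
  "table_comp k x y = (\<lambda>j. if j \<le> k then (fst (x j), snd (y j))
     else (fst (x j) + fst (y j), snd (x j) + snd (y j)))"

definition omega_of :: "'a parity_data \<Rightarrow> 'a table omega_data" where
  "omega_of C = \<lparr>
     cell = table_cell C,
     src = (\<lambda>k n. table_src k),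
     tgt = (\<lambda>k n. table_tgt k),
     ide = (\<lambda>n x. x),
     cmp = (\<lambda>k n. table_comp k)\<rparr>"

definition atom :: "'a parity_data \<Rightarrow> nat \<Rightarrow> 'a \<Rightarrow> 'a table" where
  "atom C n x = (\<lambda>k. if k \<le> n then (set_chain (mu_set C n x k), set_chain (pi_set C n x k)) else (0, 0))"

definition atoms :: "'a parity_data \<Rightarrow> nat \<Rightarrow> 'a table set" where
  "atoms C n = atom C n ` elts C n"

end

theory Submission
  imports Defs "HOL-Library.Function_Algebras" "HOL-Library.Product_Plus"
begin

text \<open>
  Write \<open>\<preceq>\<close> for the order of strong loop-freeness. Since the elements of \<open>\<mu>(b)\<close> precede \<open>b\<close> and \<open>b\<close>
  precedes the elements of \<open>\<pi>(b)\<close>, a cell whose only element of top degree is \<open>b\<close> splits uniquely, degree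
  by degree, into the atom of \<open>b\<close> whiskered on the left by elements \<open>\<preceq> b\<close> and on the right by elements
  that are not. This forces the value of the extended functor on such cells. That value
  does not depend on the whiskering: if a whisker can be moved from one side of the atom to
  the other along degree \<open>i\<close>, then the two lie side by side and hence are composable along degree
  \<open>i - 1\<close>, so the move is an instance of the interchange law. The same argument shows that two
  elements of top degree which may be composed in either order give the same value, and the
  value on a general cell is obtained by splitting off a minimal element of top degree.
\<close>

section \<open>Chains\<close>

text \<open>The columns of a table are chains, possibly with coefficients above 1, so the argument
  runs on coefficients rather than on sets. Factoring a cell along degree \<open>k\<close> amounts
  to decomposing the columns above \<open>k\<close>, subject to one inequality: the middle chain,
  \<open>fst (z k)\<close> plus a boundary, must be nonnegative. A part with boundary
  \<open>a\<close> consumes \<open>neg_part a\<close> and produces \<open>pos_part a\<close>. If one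
  part consumes only inside a lower set and the other produces only outside it, the inequality is
  automatic; this is how loop-freeness enters. The obstacle is a circularity: moving a whisker in
  degree \<open>i\<close> without changing the value needs a value that respects whiskering along
  degrees below \<open>i\<close>, while respecting whiskers of dimension \<open>i + 1\<close> needs
  such moves. Induction on the degree (\<open>whiskers\<close>) resolves it, and it starts because
  augmentation 1 leaves no room in degree 0 for two independent parts. For top elements, two
  factorisations are completed to a diamond when one of them is minimal, which suffices to compare
  every factorisation with a chosen minimal one.\<close>

abbreviation coeff :: "('a \<Rightarrow>\<^sub>0 int) \<Rightarrow> 'a \<Rightarrow> int" where
  "coeff \<equiv> Poly_Mapping.lookup"

abbreviation supp :: "('a \<Rightarrow>\<^sub>0 int) \<Rightarrow> 'a set" where
  "supp \<equiv> Poly_Mapping.keys"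

definition nonneg :: "('a \<Rightarrow>\<^sub>0 int) \<Rightarrow> bool" where
  "nonneg c \<longleftrightarrow> (\<forall>x. 0 \<le> coeff c x)"

definition pos_part :: "('a \<Rightarrow>\<^sub>0 int) \<Rightarrow> ('a \<Rightarrow>\<^sub>0 int)" where
  "pos_part c = Poly_Mapping.mapp (\<lambda>_ a. max 0 a) c"

abbreviation neg_part :: "('a \<Rightarrow>\<^sub>0 int) \<Rightarrow> ('a \<Rightarrow>\<^sub>0 int)" where
  "neg_part c \<equiv> pos_part (- c)"

definition restrict_chain :: "'a set \<Rightarrow> ('a \<Rightarrow>\<^sub>0 int) \<Rightarrow> ('a \<Rightarrow>\<^sub>0 int)" where
  "restrict_chain D c = Poly_Mapping.mapp (\<lambda>x a. if x \<in> D then a else 0) c"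

lemma in_pos_cone: "c \<in> pos_cone C n \<longleftrightarrow> supp c \<subseteq> elts C n \<and> nonneg c"
  by (simp add: pos_cone_def nonneg_def)

lemma coeff_pos_part [simp]: "coeff (pos_part c) x = max 0 (coeff c x)"
  by (auto simp: pos_part_def lookup_mapp in_keys_iff when_def)

lemma coeff_restrict_chain [simp]:
  "coeff (restrict_chain D c) x = (if x \<in> D then coeff c x else 0)"
  by (auto simp: restrict_chain_def lookup_mapp in_keys_iff when_def)

lemma pos_part_minus_neg_part: "pos_part c - neg_part c = c"
  by (rule poly_mapping_eqI) (simp add: lookup_minus)

lemma restrict_chain_partition: "restrict_chain D c + restrict_chain (- D) c = c"
  by (rule poly_mapping_eqI) (simp add: lookup_add)

lemma supp_pos_part: "supp (pos_part c) \<subseteq> supp c"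
  by (auto simp: in_keys_iff)

lemma supp_restrict_chain: "supp (restrict_chain D c) = supp c \<inter> D"
  by (auto simp: in_keys_iff split: if_splits)

lemma supp_add_subset: "supp a \<subseteq> S \<Longrightarrow> supp b \<subseteq> S \<Longrightarrow> supp (a + b) \<subseteq> S"
  using Poly_Mapping.keys_add[of a b] by blast

lemma supp_diff_subset: "supp a \<subseteq> S \<Longrightarrow> supp b \<subseteq> S \<Longrightarrow> supp (a - b) \<subseteq> S"
  for a b :: "'a \<Rightarrow>\<^sub>0 int"
  using keys_diff[of a b] by blast

lemma nonneg_coeff: "nonneg c \<Longrightarrow> 0 \<le> coeff c x"
  by (simp add: nonneg_def)

lemma nonneg_pos_part: "nonneg (pos_part c)"
  by (simp add: nonneg_def)

lemma nonneg_add: "nonneg a \<Longrightarrow> nonneg b \<Longrightarrow> nonneg (a + b)"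
  by (simp add: nonneg_def lookup_add)

lemma pos_cone_0: "0 \<in> pos_cone C n"
  by (simp add: in_pos_cone nonneg_def)

lemma pos_cone_add: "a \<in> pos_cone C n \<Longrightarrow> b \<in> pos_cone C n \<Longrightarrow> a + b \<in> pos_cone C n"
  by (simp add: in_pos_cone supp_add_subset nonneg_add)

lemma pos_cone_pos_part: "supp c \<subseteq> elts C n \<Longrightarrow> pos_part c \<in> pos_cone C n"
  using supp_pos_part[of c] by (auto simp: in_pos_cone nonneg_pos_part)

lemma pos_cone_restrict: "c \<in> pos_cone C n \<Longrightarrow> restrict_chain D c \<in> pos_cone C n"
  by (auto simp: in_pos_cone nonneg_def supp_restrict_chain)

lemma supp_add_nonneg:
  assumes "nonneg a" "nonneg b"
  shows "supp (a + b) = supp a \<union> supp b"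
proof (rule set_eqI)
  fix x
  show "x \<in> supp (a + b) \<longleftrightarrow> x \<in> supp a \<union> supp b"
    using assms[THEN nonneg_coeff, of x] by (auto simp: in_keys_iff lookup_add)
qed

lemma pos_cone_frag_of: "x \<in> elts C n \<Longrightarrow> frag_of x \<in> pos_cone C n"
  by (simp add: in_pos_cone nonneg_def)

lemma coeff_set_chain: "finite S \<Longrightarrow> coeff (set_chain S) x = (if x \<in> S then 1 else 0)"
  by (simp add: set_chain_def lookup_sum)

lemma supp_set_chain: "finite S \<Longrightarrow> supp (set_chain S) = S"
  by (auto simp: in_keys_iff coeff_set_chain split: if_splits)

lemma set_chain_singleton [simp]: "set_chain {x} = frag_of x"
  by (simp add: set_chain_def)

lemma set_chain_pos_cone: "finite S \<Longrightarrow> S \<subseteq> elts C n \<Longrightarrow> set_chain S \<in> pos_cone C n"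
  by (simp add: in_pos_cone supp_set_chain nonneg_def coeff_set_chain)

lemma aug_superset: "finite A \<Longrightarrow> supp c \<subseteq> A \<Longrightarrow> aug c = (\<Sum>x\<in>A. coeff c x)"
  unfolding aug_def by (rule sum.mono_neutral_left) (auto simp: in_keys_iff)

lemma aug_0 [simp]: "aug 0 = 0"
  by (simp add: aug_def)

lemma aug_frag_of [simp]: "aug (frag_of x) = 1"
  by (simp add: aug_def)

lemma aug_add: "aug (a + b) = aug a + aug b"
proof -
  have "supp (a + b) \<subseteq> supp a \<union> supp b"
    by (rule supp_add_subset) auto
  then show ?thesis
    by (simp add: aug_superset[of "supp a \<union> supp b"] lookup_add sum.distrib)
qed

lemma aug_minus: "aug (- a) = - aug a"
  using aug_add[of a "- a"] by simp

lemma aug_diff: "aug (a - b) = aug a - aug b"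
  using aug_add[of a "- b"] by (simp add: aug_minus)

lemma aug_nonneg: "nonneg c \<Longrightarrow> 0 \<le> aug c"
  by (simp add: aug_def sum_nonneg nonneg_def)

lemma aug_pos: "nonneg c \<Longrightarrow> c \<noteq> 0 \<Longrightarrow> 0 < aug c"
  unfolding aug_def
  by (rule sum_pos) (auto simp: in_keys_iff nonneg_def order.not_eq_order_implies_strict)

lemma aug_sum_ge_2:
  assumes "nonneg a" "nonneg b" "nonneg (c - (a + b))" "a \<noteq> 0" "b \<noteq> 0"
  shows "2 \<le> aug c"
proof -
  have "aug c = aug (c - (a + b)) + aug a + aug b"
    by (simp add: aug_add aug_diff)
  then show ?thesis
    using aug_nonneg[OF assms(3)] aug_pos[OF assms(1,4)] aug_pos[OF assms(2,5)] by linarith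
qed

text \<open>Removing one element of the support leaves a nonnegative chain of augmentation 0, which
  is zero. This is how the augmentation forces the entries of column 0 of a cell to be single
  elements.\<close>

lemma nonneg_aug_1E:
  assumes "nonneg c" "aug c = 1"
  obtains x where "c = frag_of x"
proof -
  have "c \<noteq> 0"
    using assms(2) by auto
  then obtain x where "x \<in> supp c"
    by (metis keys_eq_empty ex_in_conv)
  with assms(1) have "0 < coeff c x"
    by (metis in_keys_iff nonneg_coeff order_le_less)
  then have "nonneg (c - frag_of x)"
    using assms(1) by (auto simp: nonneg_def lookup_minus)
  moreover have "aug (c - frag_of x) = 0"
    using assms(2) by (simp add: aug_diff)
  ultimately have "c - frag_of x = 0"
    using aug_pos by force
  then have "c = frag_of x"
    by simp
  then show ?thesis
    by (rule that)
qed

lemma bd_add: "bd C n (a + b) = bd C n a + bd C n b"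
  by (simp add: bd_def frag_extend_add)

lemma bd_diff: "bd C n (a - b) = bd C n a - bd C n b"
  by (simp add: bd_def frag_extend_diff)

lemma bd_0 [simp]: "bd C n 0 = 0"
  by (simp add: bd_def)

text \<open>Argue at each element: where both \<open>a\<close> and \<open>b\<close> are negative,
  use \<open>s + (a + b)\<close>; where only one is, use \<open>s + a\<close> or
  \<open>s + b\<close>. The meaning is that two moves possible in either order consume separate
  portions of \<open>s\<close>, counted with multiplicity.\<close>

lemma neg_parts_le:
  assumes "nonneg s" "nonneg (s + a)" "nonneg (s + b)" "nonneg (s + (a + b))"
  shows "nonneg (s - (neg_part a + neg_part b))"
  using assms unfolding nonneg_def
  by (auto simp: lookup_minus lookup_add max_def) (smt (verit))+


lemma mu_set_top [simp]: "mu_set C n x n = {x}"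
  by (simp add: mu_set.simps)

lemma pi_set_top [simp]: "pi_set C n x n = {x}"
  by (simp add: pi_set.simps)


section \<open>Boundaries in a parity complex\<close>

context parity_structure
begin

lemma coeff_bd:
  assumes "supp c \<subseteq> elts C (Suc k)"
  shows "coeff (bd C (Suc k) c) d =
    (\<Sum>x\<in>supp c. coeff c x * ((if d \<in> plus_face C (Suc k) x then 1 else 0) -
                              (if d \<in> minus_face C (Suc k) x then 1 else 0)))"
proof -
  have *: "coeff c x * coeff (set_chain (plus_face C (Suc k) x) - set_chain (minus_face C (Suc k) x)) d =
      coeff c x * ((if d \<in> plus_face C (Suc k) x then 1 else 0) -
                   (if d \<in> minus_face C (Suc k) x then 1 else 0))" if "x \<in> supp c" for x
  proof -
    have "x \<in> elts C (Suc k)"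
      using that assms by auto
    then show ?thesis
      by (simp add: lookup_minus coeff_set_chain finite_plus finite_minus)
  qed
  have "coeff (bd C (Suc k) c) d = (\<Sum>x\<in>supp c. coeff c x *
      coeff (set_chain (plus_face C (Suc k) x) - set_chain (minus_face C (Suc k) x)) d)"
    by (simp add: bd_def frag_extend_def lookup_sum)
  also have "\<dots> = (\<Sum>x\<in>supp c. coeff c x * ((if d \<in> plus_face C (Suc k) x then 1 else 0) -
                              (if d \<in> minus_face C (Suc k) x then 1 else 0)))"
    by (rule sum.cong[OF refl *])
  finally show ?thesis .
qed

lemma bd_negative:
  assumes "c \<in> pos_cone C (Suc k)" "coeff (bd C (Suc k) c) d < 0"
  obtains x where "x \<in> supp c" "d \<in> minus_face C (Suc k) x"
proof (cases "\<exists>x\<in>supp c. d \<in> minus_face C (Suc k) x")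
  case False
  then have "0 \<le> coeff (bd C (Suc k) c) d"
    using assms(1) unfolding in_pos_cone
    by (subst coeff_bd) (auto intro!: sum_nonneg simp: nonneg_def)
  with assms(2) show ?thesis by simp
qed (use that in blast)

lemma bd_positive:
  assumes "c \<in> pos_cone C (Suc k)" "0 < coeff (bd C (Suc k) c) d"
  obtains x where "x \<in> supp c" "d \<in> plus_face C (Suc k) x"
proof (cases "\<exists>x\<in>supp c. d \<in> plus_face C (Suc k) x")
  case False
  then have "coeff (bd C (Suc k) c) d \<le> 0"
    using assms(1) unfolding in_pos_cone
    by (subst coeff_bd) (auto intro!: sum_nonpos simp: nonneg_def)
  with assms(2) show ?thesis by simp
qed (use that in blast)

lemma supp_bd:
  assumes "supp c \<subseteq> elts C (Suc k)"
  shows "supp (bd C (Suc k) c) \<subseteq> elts C k"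
proof
  fix d assume "d \<in> supp (bd C (Suc k) c)"
  then have "coeff (bd C (Suc k) c) d \<noteq> 0"
    by (simp add: in_keys_iff)
  then obtain x where "x \<in> supp c" "d \<in> plus_face C (Suc k) x \<or> d \<in> minus_face C (Suc k) x"
    unfolding coeff_bd[OF assms] by (auto elim!: sum.not_neutral_contains_not_neutral split: if_splits)
  then show "d \<in> elts C k"
    using assms minus_elts plus_elts by blast
qed

lemma finite_mu_set:
  assumes "x \<in> elts C n" "k \<le> n"
  shows "finite (mu_set C n x k) \<and> mu_set C n x k \<subseteq> elts C k"
  using assms(2)
proof (induction k rule: inc_induct)
  case base
  then show ?case using assms(1) by (simp add: mu_set.simps)
next
  case (step k)
  then have "mu_set C n x k = minus_plus C (Suc k) (mu_set C n x (Suc k))"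
    by (simp add: mu_set.simps[of C n x k])
  with step show ?case
    by (auto simp: minus_plus_def minus_faces_def subset_iff intro!: finite_Diff finite_UN_I finite_minus dest!: minus_elts)
qed

lemma finite_pi_set:
  assumes "x \<in> elts C n" "k \<le> n"
  shows "finite (pi_set C n x k) \<and> pi_set C n x k \<subseteq> elts C k"
  using assms(2)
proof (induction k rule: inc_induct)
  case base
  then show ?case using assms(1) by (simp add: pi_set.simps)
next
  case (step k)
  then have "pi_set C n x k = plus_minus C (Suc k) (pi_set C n x (Suc k))"
    by (simp add: pi_set.simps[of C n x k])
  with step show ?case
    by (auto simp: plus_minus_def plus_faces_def subset_iff intro!: finite_Diff finite_UN_I finite_plus dest!: plus_elts)
qed

text \<open>By well-formedness an element is a plus face of at most one member of \<open>S\<close>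
  and a minus face of at most one, so all coefficients are at most 1 in absolute value and the
  elements that are both cancel.\<close>

lemma bd_set_chain:
  assumes "finite S" "well_formed C (Suc k) S"
  shows "bd C (Suc k) (set_chain S) =
    set_chain (plus_minus C (Suc k) S) - set_chain (minus_plus C (Suc k) S)"
proof (rule poly_mapping_eqI)
  fix d
  have S: "S \<subseteq> elts C (Suc k)"
    using assms(2) by (simp add: well_formed_def)
  have count: "(\<Sum>x\<in>S. if d \<in> F x then 1 else 0 :: int) = (if d \<in> (\<Union>x\<in>S. F x) then 1 else 0)"
    if "\<And>x y. x \<in> S \<Longrightarrow> y \<in> S \<Longrightarrow> x \<noteq> y \<Longrightarrow> F x \<inter> F y = {}" for F :: "'a \<Rightarrow> 'a set"
  proof (cases "d \<in> (\<Union>x\<in>S. F x)")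
    case True
    then obtain x where x: "x \<in> S" "d \<in> F x" by blast
    then have "(\<Sum>y\<in>S. if d \<in> F y then 1 else 0 :: int) = (\<Sum>y\<in>S. if y = x then 1 else 0)"
      using that by (intro sum.cong) auto
    then show ?thesis using x assms(1) True by simp
  qed auto
  have plus: "(\<Sum>x\<in>S. if d \<in> plus_face C (Suc k) x then 1 else 0 :: int) =
      (if d \<in> plus_faces C (Suc k) S then 1 else 0)"
    unfolding plus_faces_def using assms(2) by (intro count) (auto simp: well_formed_def)
  have minus: "(\<Sum>x\<in>S. if d \<in> minus_face C (Suc k) x then 1 else 0 :: int) =
      (if d \<in> minus_faces C (Suc k) S then 1 else 0)"
    unfolding minus_faces_def using assms(2) by (intro count) (auto simp: well_formed_def)
  have fin: "finite (plus_faces C (Suc k) S)" "finite (minus_faces C (Suc k) S)"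
    using S assms(1) by (auto simp: plus_faces_def minus_faces_def finite_plus finite_minus)
  have "coeff (bd C (Suc k) (set_chain S)) d =
      (\<Sum>x\<in>S. (if d \<in> plus_face C (Suc k) x then 1 else 0) - (if d \<in> minus_face C (Suc k) x then 1 else 0))"
    using S assms(1) by (simp add: coeff_bd supp_set_chain coeff_set_chain)
  then show "coeff (bd C (Suc k) (set_chain S)) d = coeff (set_chain (plus_minus C (Suc k) S) -
      set_chain (minus_plus C (Suc k) S)) d"
    using fin by (simp add: sum_subtractf plus minus lookup_minus coeff_set_chain
        plus_minus_def minus_plus_def)
qed

end

context parity_complex
begin

lemma bd_mu:
  assumes "x \<in> elts C n" "k < n"
  shows "bd C (Suc k) (set_chain (mu_set C n x (Suc k))) =
    set_chain (plus_minus C (Suc k) (mu_set C n x (Suc k))) - set_chain (mu_set C n x k)"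
  using assms unital_mu[of x n "Suc k"] finite_mu_set[of x n "Suc k"]
  by (simp add: bd_set_chain mu_set.simps[of C n x k])

lemma bd_pi:
  assumes "x \<in> elts C n" "k < n"
  shows "bd C (Suc k) (set_chain (pi_set C n x (Suc k))) =
    set_chain (pi_set C n x k) - set_chain (minus_plus C (Suc k) (pi_set C n x (Suc k)))"
  using assms unital_pi[of x n "Suc k"] finite_pi_set[of x n "Suc k"]
  by (simp add: bd_set_chain pi_set.simps[of C n x k])

lemma mu_faces [simp]: "x \<in> elts C (Suc n) \<Longrightarrow> mu_set C (Suc n) x n = minus_face C (Suc n) x"
  using disjoint_faces[of x n]
  by (auto simp: mu_set.simps minus_plus_def minus_faces_def plus_faces_def)

lemma pi_faces [simp]: "x \<in> elts C (Suc n) \<Longrightarrow> pi_set C (Suc n) x n = plus_face C (Suc n) x"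
  using disjoint_faces[of x n]
  by (auto simp: pi_set.simps plus_minus_def minus_faces_def plus_faces_def)

lemma bd_frag_of: "bd C n (frag_of x) = set_chain (plus_face C n x) - set_chain (minus_face C n x)"
  by (simp add: bd_def)

text \<open>On a generator both face sets are well-formed by unitality, so
  \<open>bd_set_chain\<close> computes their boundaries, and globularity makes the two
  equal.\<close>

lemma bd_bd:
  assumes "supp c \<subseteq> elts C (Suc (Suc k))"
  shows "bd C (Suc k) (bd C (Suc (Suc k)) c) = 0"
  using assms
proof (induction c rule: frag_induction)
  case (one x)
  have "bd C (Suc k) (set_chain (minus_face C (Suc (Suc k)) x)) =
      bd C (Suc k) (set_chain (plus_face C (Suc (Suc k)) x))"
    using one bd_mu[of x "Suc (Suc k)" k] bd_pi[of x "Suc (Suc k)" k]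
      globular_minus[of "Suc (Suc k)" x] globular_plus[of "Suc (Suc k)" x]
    by (simp add: mu_set.simps[of _ _ _ k] pi_set.simps[of _ _ _ k])
  then show ?case
    by (simp add: bd_frag_of bd_diff)
qed (simp_all add: bd_diff)

text \<open>The recursion gives only half of each boundary: its negative part for \<open>mu\<close>,
  its positive part for \<open>pi\<close>. Descending in \<open>k\<close>, \<open>bd_bd\<close>
  makes the boundaries of the two columns equal, and each supplies the half that the other
  lacks.\<close>

lemma bd_mu_pi:
  assumes "x \<in> elts C n" "k < n"
  shows "bd C (Suc k) (set_chain (mu_set C n x (Suc k))) =
      set_chain (pi_set C n x k) - set_chain (mu_set C n x k)"
    and "bd C (Suc k) (set_chain (pi_set C n x (Suc k))) =
      set_chain (pi_set C n x k) - set_chain (mu_set C n x k)"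
proof -
  have "k \<le> n - 1" using assms by simp
  then have "bd C (Suc k) (set_chain (mu_set C n x (Suc k))) = set_chain (pi_set C n x k) - set_chain (mu_set C n x k)
    \<and> bd C (Suc k) (set_chain (pi_set C n x (Suc k))) = set_chain (pi_set C n x k) - set_chain (mu_set C n x k)"
  proof (induction k rule: inc_induct)
    case base
    with assms obtain m where "n = Suc m" by (cases n) auto
    with assms show ?case by (simp add: bd_frag_of)
  next
    case (step k)
    then have k: "Suc k < n" "k < n" by auto
    let ?M = "mu_set C n x (Suc k)" and ?P = "pi_set C n x (Suc k)"
    have "supp (set_chain (mu_set C n x (Suc (Suc k)))) \<subseteq> elts C (Suc (Suc k))"
      using finite_mu_set[OF assms(1), of "Suc (Suc k)"] k by (simp add: supp_set_chain)
    from bd_bd[OF this] have eq: "bd C (Suc k) (set_chain ?P) = bd C (Suc k) (set_chain ?M)"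
      using step by (simp add: bd_diff)
    have fin: "finite ?M" "finite ?P" "?M \<subseteq> elts C (Suc k)" "?P \<subseteq> elts C (Suc k)"
      using finite_mu_set[OF assms(1), of "Suc k"] finite_pi_set[OF assms(1), of "Suc k"] k by auto
    have fin': "finite (plus_minus C (Suc k) S)" "finite (minus_plus C (Suc k) S)"
      if "finite S" "S \<subseteq> elts C (Suc k)" for S
      using that by (auto simp: plus_minus_def minus_plus_def plus_faces_def minus_faces_def
          intro!: finite_Diff finite_UN_I finite_plus finite_minus)
    have *: "set_chain (pi_set C n x k) - set_chain (minus_plus C (Suc k) ?P) =
        set_chain (plus_minus C (Suc k) ?M) - set_chain (mu_set C n x k)"
      using eq bd_mu[OF assms(1) k(2)] bd_pi[OF assms(1) k(2)] by simp
    \<comment> \<open>Each side of \<open>*\<close> is a difference of indicator chains of two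
      disjoint sets, so the positive parts coincide.\<close>
    have "d \<in> pi_set C n x k \<longleftrightarrow> d \<in> plus_minus C (Suc k) ?M" for d
    proof -
      have "coeff (set_chain (pi_set C n x k) - set_chain (minus_plus C (Suc k) ?P)) d =
        coeff (set_chain (plus_minus C (Suc k) ?M) - set_chain (mu_set C n x k)) d"
        using * by simp
      then show ?thesis
        using fin fin' k
        by (auto simp: lookup_minus coeff_set_chain pi_set.simps[of C n x k] mu_set.simps[of C n x k]
            plus_minus_def minus_plus_def plus_faces_def minus_faces_def split: if_splits)
    qed
    then have "pi_set C n x k = plus_minus C (Suc k) ?M" by blast
    with eq bd_mu[OF assms(1) k(2)] show ?case by simp
  qed
  then show "bd C (Suc k) (set_chain (mu_set C n x (Suc k))) =
      set_chain (pi_set C n x k) - set_chain (mu_set C n x k)"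
    and "bd C (Suc k) (set_chain (pi_set C n x (Suc k))) =
      set_chain (pi_set C n x k) - set_chain (mu_set C n x k)" by auto
qed

lemma aug_mu: "x \<in> elts C n \<Longrightarrow> aug (set_chain (mu_set C n x 0)) = 1"
  using unital_mu[of x n 0] by (auto simp: well_formed_def)

lemma aug_pi: "x \<in> elts C n \<Longrightarrow> aug (set_chain (pi_set C n x 0)) = 1"
  using unital_pi[of x n 0] by (auto simp: well_formed_def)

text \<open>For a generator of degree 1, unitality in degree 0 makes both face sets
  singletons.\<close>

lemma aug_bd:
  assumes "supp c \<subseteq> elts C (Suc 0)"
  shows "aug (bd C (Suc 0) c) = 0"
  using assms
proof (induction c rule: frag_induction)
  case (one x)
  then show ?case
    using aug_mu[of x "Suc 0"] aug_pi[of x "Suc 0"] by (simp add: bd_frag_of aug_diff)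
qed (simp_all add: bd_diff aug_diff)

lemma atom_cell: "x \<in> elts C n \<Longrightarrow> atom C n x \<in> table_cell C n"
  using finite_mu_set[of x n] finite_pi_set[of x n]
  by (auto simp: table_cell_def atom_def set_chain_pos_cone bd_mu_pi aug_mu aug_pi)

end

section \<open>Tables\<close>

lemma ides_omega_of [simp]: "ides (omega_of C) k d x = x"
  by (induction d) (simp_all add: omega_of_def)

lemma omega_of_simps [simp]:
  "cell (omega_of C) = table_cell C"
  "src (omega_of C) k n = table_src k"
  "tgt (omega_of C) k n = table_tgt k"
  "ide (omega_of C) n = (\<lambda>x. x)"
  "cmp (omega_of C) k n = table_comp k"
  by (simp_all add: omega_of_def)

lemma table_cell_zero: "x \<in> table_cell C n \<Longrightarrow> n < m \<Longrightarrow> x m = 0"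
  by (simp add: table_cell_def zero_prod_def)

lemma table_cell_top: "x \<in> table_cell C n \<Longrightarrow> snd (x n) = fst (x n)"
  by (simp add: table_cell_def)

lemma table_cell_pos_cone:
  "x \<in> table_cell C n \<Longrightarrow> fst (x k) \<in> pos_cone C k \<and> snd (x k) \<in> pos_cone C k"
  by (cases "k \<le> n") (auto simp: table_cell_def pos_cone_0)

lemma table_cell_bd:
  assumes "x \<in> table_cell C n"
  shows "bd C (Suc k) (fst (x (Suc k))) = snd (x k) - fst (x k)"
    and "bd C (Suc k) (snd (x (Suc k))) = snd (x k) - fst (x k)"
  using assms by (cases k n rule: linorder_cases; simp add: table_cell_def)+

lemma table_cell_aug: "x \<in> table_cell C n \<Longrightarrow> aug (fst (x 0)) = 1 \<and> aug (snd (x 0)) = 1"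
  by (simp add: table_cell_def)

text \<open>With zero columns above \<open>n\<close>, the conditions on columns need no bound, and the one on the
  last column is a boundary condition.\<close>

lemma table_cellI:
  assumes "\<And>k. fst (x k) \<in> pos_cone C k \<and> snd (x k) \<in> pos_cone C k"
    and "\<And>k. bd C (Suc k) (fst (x (Suc k))) = snd (x k) - fst (x k) \<and>
          bd C (Suc k) (snd (x (Suc k))) = snd (x k) - fst (x k)"
    and "\<And>k. n < k \<Longrightarrow> x k = 0" "aug (fst (x 0)) = 1" "aug (snd (x 0)) = 1"
  shows "x \<in> table_cell C n"
  using assms(1,2,4,5) assms(2)[of n] assms(3) unfolding table_cell_def zero_prod_def[symmetric]
  by simp

lemma table_cell_mono: "m \<le> n \<Longrightarrow> x \<in> table_cell C m \<Longrightarrow> x \<in> table_cell C n"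
  by (rule table_cellI) (simp_all add: table_cell_pos_cone table_cell_bd table_cell_zero table_cell_aug)

lemma table_cell_lower:
  "x \<in> table_cell C n \<Longrightarrow> (\<And>k. m < k \<Longrightarrow> x k = 0) \<Longrightarrow> x \<in> table_cell C m"
  by (rule table_cellI) (simp_all add: table_cell_pos_cone table_cell_bd table_cell_aug)

lemma table_src_cell: "x \<in> table_cell C n \<Longrightarrow> table_src k x \<in> table_cell C k"
  by (rule table_cellI) (auto simp: table_src_def table_cell_pos_cone table_cell_bd table_cell_aug
      pos_cone_0 zero_prod_def not_less_eq less_Suc_eq)

lemma table_tgt_cell: "x \<in> table_cell C n \<Longrightarrow> table_tgt k x \<in> table_cell C k"
  by (rule table_cellI) (auto simp: table_tgt_def table_cell_pos_cone table_cell_bd table_cell_aug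
      pos_cone_0 zero_prod_def not_less_eq less_Suc_eq)

lemma table_src_id: "x \<in> table_cell C n \<Longrightarrow> n \<le> k \<Longrightarrow> table_src k x = x"
  by (cases "k = n") (auto simp: table_cell_def table_src_def fun_eq_iff prod_eq_iff)

lemma table_tgt_id: "x \<in> table_cell C n \<Longrightarrow> n \<le> k \<Longrightarrow> table_tgt k x = x"
  by (cases "k = n") (auto simp: table_cell_def table_tgt_def fun_eq_iff prod_eq_iff)

lemma table_tgt_eq_srcD:
  assumes "table_tgt k x = table_src k y"
  shows "j < k \<Longrightarrow> x j = y j" and "snd (x k) = fst (y k)"
  using fun_cong[OF assms, of j] fun_cong[OF assms, of k]
  by (auto simp: table_tgt_def table_src_def)

lemma table_comp_columns:
  assumes "table_tgt k x = table_src k y"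
  shows "j < k \<Longrightarrow> table_comp k x y j = x j"
    and "j < k \<Longrightarrow> table_comp k x y j = y j"
    and "table_comp k x y k = (fst (x k), snd (y k))"
    and "k < j \<Longrightarrow> table_comp k x y j = x j + y j"
  using table_tgt_eq_srcD[OF assms] by (auto simp: table_comp_def plus_prod_def)

lemma table_comp_cell:
  assumes "x \<in> table_cell C n" "y \<in> table_cell C n" "table_tgt k x = table_src k y"
  shows "table_comp k x y \<in> table_cell C n"
proof -
  note eq = table_tgt_eq_srcD[OF assms(3)]
  note x = table_cell_pos_cone[OF assms(1)] table_cell_bd[OF assms(1)] table_cell_aug[OF assms(1)]
  note y = table_cell_pos_cone[OF assms(2)] table_cell_bd[OF assms(2)] table_cell_aug[OF assms(2)]
  have "bd C (Suc j) (fst (table_comp k x y (Suc j))) = snd (table_comp k x y j) - fst (table_comp k x y j)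
    \<and> bd C (Suc j) (snd (table_comp k x y (Suc j))) = snd (table_comp k x y j) - fst (table_comp k x y j)" for j
    by (cases j k rule: linorder_cases) (auto simp: table_comp_def bd_add algebra_simps x y eq Suc_le_eq)
  moreover have "table_comp k x y j = 0" if "n < j" for j
    using that by (simp add: table_cell_zero[OF assms(1)] table_cell_zero[OF assms(2)]
        table_comp_def zero_prod_def)
  ultimately show ?thesis
    using x y by (intro table_cellI) (auto simp: table_comp_def pos_cone_add)
qed

lemma omega_category_omega_of: "omega_category (omega_of C)"
proof unfold_locales
  fix k n x y
  assume *: "composable (omega_of C) k n x y"
  then show "cmp (omega_of C) k n x y \<in> cell (omega_of C) n"
    by (simp add: composable_def table_comp_cell)
next
  fix k n x
  assume "k < n" "x \<in> cell (omega_of C) n"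
  show "cmp (omega_of C) k n (ides (omega_of C) k (n - k) (src (omega_of C) k n x)) x = x"
    by (auto simp: table_comp_def table_src_def fun_eq_iff prod_eq_iff)
next
  fix k n x
  assume "k < n" "x \<in> cell (omega_of C) n"
  show "cmp (omega_of C) k n x (ides (omega_of C) k (n - k) (tgt (omega_of C) k n x)) = x"
    by (auto simp: table_comp_def table_tgt_def fun_eq_iff prod_eq_iff)
next
  fix k n x y
  assume "composable (omega_of C) k n x y"
  then have "table_tgt k x = table_src k y" by (simp add: composable_def)
  note eq = table_tgt_eq_srcD[OF this]
  show "src (omega_of C) k n (cmp (omega_of C) k n x y) = src (omega_of C) k n x"
    using eq by (auto simp: table_comp_def table_src_def fun_eq_iff)
  show "tgt (omega_of C) k n (cmp (omega_of C) k n x y) = tgt (omega_of C) k n y"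
    using eq by (auto simp: table_comp_def table_tgt_def fun_eq_iff)
next
  fix k n x y z
  assume "composable (omega_of C) k n x y" "composable (omega_of C) k n y z"
  then show "cmp (omega_of C) k n (cmp (omega_of C) k n x y) z =
      cmp (omega_of C) k n x (cmp (omega_of C) k n y z)"
    by (auto simp: table_comp_def fun_eq_iff add.assoc)
next
  fix j k n x y z w
  assume "j < k" "composable (omega_of C) k n x y" "composable (omega_of C) k n z w"
    "composable (omega_of C) j n x z"
  then show "cmp (omega_of C) j n (cmp (omega_of C) k n x y) (cmp (omega_of C) k n z w) =
          cmp (omega_of C) k n (cmp (omega_of C) j n x z) (cmp (omega_of C) j n y w)"
    by (auto simp: table_comp_def fun_eq_iff algebra_simps)
next
  fix n x
  assume "x \<in> cell (omega_of C) n"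
  then show "ide (omega_of C) n x \<in> cell (omega_of C) (Suc n)"
    by (simp add: table_cell_mono[of n "Suc n"])
qed (simp_all add: table_src_cell table_tgt_cell table_src_id table_tgt_id,
    auto simp: table_src_def table_tgt_def table_comp_def fun_eq_iff)

lemma (in parity_complex) atoms_0: "atoms C 0 = table_cell C 0"
proof -
  have "x \<in> atoms C 0" if x: "x \<in> table_cell C 0" for x
  proof -
    obtain b where b: "fst (x 0) = frag_of b"
      using table_cell_pos_cone[OF x, of 0] table_cell_aug[OF x]
      by (metis in_pos_cone nonneg_aug_1E)
    then have "b \<in> elts C 0"
      using table_cell_pos_cone[OF x, of 0] by (simp add: in_pos_cone)
    moreover have "x = atom C 0 b"
      using b x by (auto simp: atom_def fun_eq_iff prod_eq_iff table_cell_def)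
    ultimately show ?thesis by (simp add: atoms_def)
  qed
  then show ?thesis by (auto simp: atoms_def atom_cell)
qed

text \<open>The composite determines the columns of both factors below \<open>k\<close> and the
  outer entries of column \<open>k\<close>; above \<open>k\<close>, one factor determines the other
  by subtraction. Every later uniqueness statement about factorisations rests on this.\<close>

lemma table_factor_unique:
  assumes "p \<in> table_cell C n" "q \<in> table_cell C n" "p' \<in> table_cell C n" "q' \<in> table_cell C n"
    and "table_tgt k p = table_src k q" "table_tgt k p' = table_src k q'"
    and "table_comp k p q = table_comp k p' q'"
    and "(\<forall>m>k. p m = p' m) \<or> (\<forall>m>k. q m = q' m)"
  shows "p = p' \<and> q = q'"
proof -
  note c = table_comp_columns[OF assms(5)] table_comp_columns[OF assms(6)]
  have low: "p m = p' m \<and> q m = q' m" if "m < k" for m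
    using that c assms(7) by metis
  have high: "p m = p' m \<and> q m = q' m" if "k < m" for m
    using that c(4)[of m] c(8)[of m] assms(7,8) by auto
  have "fst (p k) = fst (p' k)" "snd (q k) = snd (q' k)"
    using c(3,7) assms(7) by auto
  \<comment> \<open>The inner entry of column \<open>k\<close> is recovered from the outer one and
    the boundary of column \<open>k + 1\<close>.\<close>
  moreover have "snd (p k) = snd (p' k)"
    using high[of "Suc k"] table_cell_bd(1)[OF assms(1), of k] table_cell_bd(1)[OF assms(3), of k] calculation
    by simp
  moreover have "fst (q k) = fst (q' k)"
    using table_tgt_eq_srcD(2)[OF assms(5)] table_tgt_eq_srcD(2)[OF assms(6)] calculation by simp
  ultimately have "p m = p' m \<and> q m = q' m" for m
    using low high by (cases m k rule: linorder_cases) (auto simp: prod_eq_iff)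
  then show ?thesis by blast
qed

section \<open>Splitting a cell\<close>

context parity_complex
begin

text \<open>\<open>upper N k P\<close>: the columns of \<open>P\<close> above \<open>k\<close> could be those of an \<open>N\<close>-cell.\<close>

definition upper :: "nat \<Rightarrow> nat \<Rightarrow> 'a table \<Rightarrow> bool" where
  "upper N k P \<longleftrightarrow>
     (\<forall>m>k. fst (P m) \<in> pos_cone C m \<and> snd (P m) \<in> pos_cone C m \<and>
            bd C (Suc m) (fst (P (Suc m))) = snd (P m) - fst (P m) \<and>
            bd C (Suc m) (snd (P (Suc m))) = snd (P m) - fst (P m)) \<and>
     (\<forall>m>N. P m = 0)"

lemma upper_cell: "x \<in> table_cell C N \<Longrightarrow> upper N k x"
  by (auto simp: upper_def table_cell_pos_cone table_cell_bd table_cell_zero)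

text \<open>The two entries of column \<open>k + 1\<close> differ by a boundary. Hence
  \<open>upper\<close>, which does not constrain column \<open>k\<close>, still assigns one
  well-defined boundary to column \<open>k + 1\<close>.\<close>

lemma upper_bd_eq:
  assumes "upper N k P" "k < N"
  shows "bd C (Suc k) (snd (P (Suc k))) = bd C (Suc k) (fst (P (Suc k)))"
proof -
  have "supp (fst (P (Suc (Suc k)))) \<subseteq> elts C (Suc (Suc k))"
    using assms(1) by (simp add: upper_def in_pos_cone)
  from bd_bd[OF this] show ?thesis
    using assms(1) by (simp add: upper_def bd_diff)
qed

text \<open>A decomposition of the columns above \<open>k\<close> leaves a single candidate for the
  middle chain. All conditions on a cell except nonnegativity are linear and hold for it
  automatically, so \<open>pos\<close> is the only thing to ask.\<close>

lemma split_cell: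
  assumes z: "z \<in> table_cell C N" and "k < N"
    and P: "upper N k P" and Q: "upper N k Q"
    and sum: "\<And>m. k < m \<Longrightarrow> z m = P m + Q m"
    and pos: "nonneg (fst (z k) + bd C (Suc k) (fst (P (Suc k))))"
  obtains p q where "p \<in> table_cell C N" "q \<in> table_cell C N" "table_tgt k p = table_src k q"
    "z = table_comp k p q" "\<And>m. k < m \<Longrightarrow> p m = P m" "\<And>m. k < m \<Longrightarrow> q m = Q m"
proof -
  define mid where "mid = fst (z k) + bd C (Suc k) (fst (P (Suc k)))"
  define p where "p = (\<lambda>j. if j < k then z j else if j = k then (fst (z k), mid) else P j)"
  define q where "q = (\<lambda>j. if j < k then z j else if j = k then (mid, snd (z k)) else Q j)"
  note zz = table_cell_pos_cone[OF z] table_cell_bd[OF z]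
  have PS: "fst (P (Suc k)) \<in> pos_cone C (Suc k)" using P by (simp add: upper_def)
  have mid: "mid \<in> pos_cone C k"
    using pos zz supp_bd[of "fst (P (Suc k))" k] PS
    by (simp add: mid_def in_pos_cone supp_add_subset)
  \<comment> \<open>In degree 0 the middle chain keeps augmentation 1, because boundaries have
    augmentation 0.\<close>
  have aug: "aug mid = 1" if "k = 0"
    using that aug_bd[of "fst (P (Suc k))"] PS table_cell_aug[OF z]
    by (simp add: mid_def aug_add in_pos_cone)
  have snd_z: "snd (z k) = mid + bd C (Suc k) (fst (Q (Suc k)))"
    using zz(2)[of k] by (simp add: mid_def sum plus_prod_def bd_add algebra_simps)
  note eqs = upper_bd_eq[OF P \<open>k < N\<close>] upper_bd_eq[OF Q \<open>k < N\<close>]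
  have P': "fst (P m) \<in> pos_cone C m" "snd (P m) \<in> pos_cone C m"
    "bd C (Suc m) (fst (P (Suc m))) = snd (P m) - fst (P m)"
    "bd C (Suc m) (snd (P (Suc m))) = snd (P m) - fst (P m)"
    "N < m \<Longrightarrow> P m = 0" if "k < m" for m
    using P that by (auto simp: upper_def)
  have Q': "fst (Q m) \<in> pos_cone C m" "snd (Q m) \<in> pos_cone C m"
    "bd C (Suc m) (fst (Q (Suc m))) = snd (Q m) - fst (Q m)"
    "bd C (Suc m) (snd (Q (Suc m))) = snd (Q m) - fst (Q m)"
    "N < m \<Longrightarrow> Q m = 0" if "k < m" for m
    using Q that by (auto simp: upper_def)
  have mid_bd: "bd C (Suc m) mid = snd (z m) - fst (z m)" if "k = Suc m" for m
    using zz(2)[of m] bd_bd[of "fst (P (Suc k))" m] PS that by (simp add: mid_def bd_add in_pos_cone)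
  have p_bd: "bd C (Suc m) (fst (p (Suc m))) = snd (p m) - fst (p m) \<and>
      bd C (Suc m) (snd (p (Suc m))) = snd (p m) - fst (p m)" for m
    by (cases m k rule: linorder_cases; cases "Suc m = k")
      (auto simp: p_def P' zz eqs mid_bd, auto simp: mid_def)
  have q_bd: "bd C (Suc m) (fst (q (Suc m))) = snd (q m) - fst (q m) \<and>
      bd C (Suc m) (snd (q (Suc m))) = snd (q m) - fst (q m)" for m
    by (cases m k rule: linorder_cases; cases "Suc m = k")
      (auto simp: q_def Q' zz eqs mid_bd, auto simp: snd_z)
  have p_cell: "p \<in> table_cell C N"
    by (rule table_cellI[OF _ p_bd])
      (use \<open>k < N\<close> in \<open>auto simp: p_def P' zz mid aug table_cell_aug[OF z]\<close>)
  have q_cell: "q \<in> table_cell C N"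
    by (rule table_cellI[OF _ q_bd])
      (use \<open>k < N\<close> in \<open>auto simp: q_def Q' zz mid aug table_cell_aug[OF z]\<close>)
  have "z = table_comp k p q" "table_tgt k p = table_src k q"
    using sum by (auto simp: fun_eq_iff table_comp_def p_def q_def plus_prod_def table_tgt_def table_src_def)
  then show ?thesis
    using p_cell q_cell by (intro that[of p q]) (auto simp: p_def q_def)
qed

text \<open>The sets \<open>D m\<close> of elements of degree \<open>m\<close> form a lower set for the order of strong
  loop-freeness.\<close>

definition lower_set :: "(nat \<Rightarrow> 'a set) \<Rightarrow> bool" where
  "lower_set D \<longleftrightarrow> (\<forall>m. \<forall>x\<in>elts C (Suc m).
     (x \<in> D (Suc m) \<longrightarrow> minus_face C (Suc m) x \<subseteq> D m) \<and>
     (plus_face C (Suc m) x \<inter> D m \<noteq> {} \<longrightarrow> x \<in> D (Suc m)))"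

lemma lower_set_minus:
  "lower_set D \<Longrightarrow> x \<in> elts C (Suc m) \<Longrightarrow> x \<in> D (Suc m) \<Longrightarrow> d \<in> minus_face C (Suc m) x \<Longrightarrow> d \<in> D m"
  unfolding lower_set_def by blast

lemma lower_set_plus:
  "lower_set D \<Longrightarrow> x \<in> elts C (Suc m) \<Longrightarrow> d \<in> plus_face C (Suc m) x \<Longrightarrow> d \<in> D m \<Longrightarrow> x \<in> D (Suc m)"
  unfolding lower_set_def by blast

text \<open>A negative coefficient comes from a minus face of some element of \<open>c\<close>, and
  such a face precedes that element.\<close>

lemma bd_lower_set_negative:
  assumes "lower_set D" "c \<in> pos_cone C (Suc m)" "supp c \<subseteq> D (Suc m)" "coeff (bd C (Suc m) c) d < 0"
  shows "d \<in> D m"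
proof -
  obtain x where "x \<in> supp c" "d \<in> minus_face C (Suc m) x"
    using bd_negative[OF assms(2,4)] .
  moreover from this assms(2) have "x \<in> elts C (Suc m)"
    by (auto simp: in_pos_cone)
  ultimately show ?thesis
    using lower_set_minus[OF assms(1)] assms(3) by blast
qed

lemma bd_lower_set_positive:
  assumes "lower_set D" "c \<in> pos_cone C (Suc m)" "supp c \<inter> D (Suc m) = {}" "0 < coeff (bd C (Suc m) c) d"
  shows "d \<notin> D m"
proof -
  obtain x where "x \<in> supp c" "d \<in> plus_face C (Suc m) x"
    using bd_positive[OF assms(2,4)] .
  moreover from this assms(2) have "x \<in> elts C (Suc m)"
    by (auto simp: in_pos_cone)
  ultimately show ?thesis
    using lower_set_plus[OF assms(1)] assms(3) by blast
qed

text \<open>Inside \<open>D\<close> the chain \<open>b\<close> adds nothing, so \<open>s + a\<close>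
  is at least \<open>s + (a + b)\<close>; outside \<open>D\<close> the chain \<open>a\<close>
  removes nothing, so \<open>s + a\<close> is at least \<open>s\<close>.\<close>

lemma nonneg_intermediate:
  assumes "nonneg s" "nonneg (s + (a + b))"
    and "\<And>d. coeff a d < 0 \<Longrightarrow> d \<in> D" "\<And>d. 0 < coeff b d \<Longrightarrow> d \<notin> D"
  shows "nonneg (s + a)"
  unfolding nonneg_def
proof
  fix d
  show "0 \<le> coeff (s + a) d"
    using nonneg_coeff[OF assms(1), of d] nonneg_coeff[OF assms(2), of d] assms(3,4)[of d]
    unfolding lookup_add by linarith
qed

lemma cell_snd_eq:
  assumes "z \<in> table_cell C N" "z (Suc k) = P (Suc k) + Q (Suc k)"
  shows "snd (z k) = fst (z k) + (bd C (Suc k) (fst (P (Suc k))) + bd C (Suc k) (fst (Q (Suc k))))"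
  using table_cell_bd(1)[OF assms(1), of k] assms(2) by (simp add: plus_prod_def bd_add algebra_simps)

text \<open>If \<open>P\<close> consumes only inside \<open>D\<close> and \<open>Q\<close> produces
  only outside \<open>D\<close>, then \<open>P\<close> never waits for something made by
  \<open>Q\<close>, so it can be performed first.\<close>

lemma split_cell_lower_set:
  assumes z: "z \<in> table_cell C N" and "k < N"
    and P: "upper N k P" and Q: "upper N k Q"
    and sum: "\<And>m. k < m \<Longrightarrow> z m = P m + Q m"
    and "\<And>d. coeff (bd C (Suc k) (fst (P (Suc k)))) d < 0 \<Longrightarrow> d \<in> D"
    and "\<And>d. 0 < coeff (bd C (Suc k) (fst (Q (Suc k)))) d \<Longrightarrow> d \<notin> D"
  obtains p q where "p \<in> table_cell C N" "q \<in> table_cell C N" "table_tgt k p = table_src k q"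
    "z = table_comp k p q" "\<And>m. k < m \<Longrightarrow> p m = P m" "\<And>m. k < m \<Longrightarrow> q m = Q m"
proof -
  have "nonneg (fst (z k) + bd C (Suc k) (fst (P (Suc k))))"
  proof (rule nonneg_intermediate)
    show "nonneg (fst (z k) + (bd C (Suc k) (fst (P (Suc k))) + bd C (Suc k) (fst (Q (Suc k)))))"
      using table_cell_pos_cone[OF z, of k] cell_snd_eq[where P = P and Q = Q, OF z sum]
      by (simp add: in_pos_cone)
    show "nonneg (fst (z k))"
      using table_cell_pos_cone[OF z, of k] by (simp add: in_pos_cone)
  qed (fact assms(6,7))+
  from split_cell[OF z \<open>k < N\<close> P Q sum this] that show ?thesis by blast
qed

text \<open>If a cell splits in both orders along \<open>k + 1\<close>, the two parts sit side by side in column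
  \<open>k + 1\<close>. The remainder of that column is distributed according to \<open>D\<close>, which makes the two
  parts composable along \<open>k\<close>.\<close>

lemma separate_cell:
  assumes z: "z \<in> table_cell C N" and "Suc k < N"
    and P: "upper N (Suc k) P" and Q: "upper N (Suc k) Q"
    and sum: "\<And>m. Suc k < m \<Longrightarrow> z m = P m + Q m"
    and D: "lower_set D"
    and a: "\<And>d. coeff (bd C (Suc (Suc k)) (fst (P (Suc (Suc k))))) d < 0 \<Longrightarrow> d \<in> D (Suc k)"
    and b: "\<And>d. 0 < coeff (bd C (Suc (Suc k)) (fst (Q (Suc (Suc k))))) d \<Longrightarrow> d \<notin> D (Suc k)"
    and swap: "nonneg (fst (z (Suc k)) + bd C (Suc (Suc k)) (fst (Q (Suc (Suc k)))))"
  obtains p q where "p \<in> table_cell C N" "q \<in> table_cell C N" "table_tgt k p = table_src k q"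
    "z = table_comp k p q" "\<And>m. Suc k < m \<Longrightarrow> p m = P m" "\<And>m. Suc k < m \<Longrightarrow> q m = Q m"
proof -
  define a where "a = bd C (Suc (Suc k)) (fst (P (Suc (Suc k))))"
  define b where "b = bd C (Suc (Suc k)) (fst (Q (Suc (Suc k))))"
  let ?s = "fst (z (Suc k))"
  let ?E = "D (Suc k)"
  \<comment> \<open>What is left of the source chain once the consumption of both parts has been set
    aside.\<close>
  define rest where "rest = ?s - (neg_part a + neg_part b)"
  \<comment> \<open>The first part turns \<open>neg_part a\<close> into \<open>pos_part a\<close>
    and carries along, unchanged, the share of \<open>rest\<close> inside \<open>D\<close>; the
    second part gets the share outside.\<close>
  define P' where "P' = P(Suc k := (neg_part a + restrict_chain ?E rest, pos_part a + restrict_chain ?E rest))"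
  define Q' where "Q' = Q(Suc k := (neg_part b + restrict_chain (- ?E) rest, pos_part b + restrict_chain (- ?E) rest))"
  have s: "supp ?s \<subseteq> elts C (Suc k)" "nonneg ?s" "nonneg (snd (z (Suc k)))"
    using table_cell_pos_cone[OF z, of "Suc k"] by (auto simp: in_pos_cone)
  have z_snd: "snd (z (Suc k)) = ?s + (a + b)"
    unfolding a_def b_def by (rule cell_snd_eq[where P = P and Q = Q, OF z sum[OF lessI]])
  have PQ: "supp (fst (P (Suc (Suc k)))) \<subseteq> elts C (Suc (Suc k))"
      "supp (fst (Q (Suc (Suc k)))) \<subseteq> elts C (Suc (Suc k))"
    using P Q by (simp_all add: upper_def in_pos_cone)
  have supp_ab: "supp a \<subseteq> elts C (Suc k)" "supp b \<subseteq> elts C (Suc k)"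
    unfolding a_def b_def using PQ by (simp_all add: supp_bd)
  have "nonneg (?s + a)"
  proof (rule nonneg_intermediate[of _ _ b ?E])
    show "nonneg (?s + (a + b))" using s z_snd by simp
  qed (use s assms(7,8) in \<open>simp_all add: a_def b_def\<close>)
  \<comment> \<open>Here \<open>swap\<close> enters: with it all four chains \<open>?s\<close>,
    \<open>?s + a\<close>, \<open>?s + b\<close> and \<open>?s + (a + b)\<close> are nonnegative, as
    \<open>neg_parts_le\<close> requires.\<close>
  then have "nonneg rest"
    using neg_parts_le[of ?s a b] s swap z_snd by (simp add: rest_def b_def[symmetric])
  moreover have "supp (neg_part a) \<subseteq> elts C (Suc k)" "supp (neg_part b) \<subseteq> elts C (Suc k)"
    using supp_ab supp_pos_part[of "- a"] supp_pos_part[of "- b"] by simp_all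
  then have "supp rest \<subseteq> elts C (Suc k)"
    unfolding rest_def using s(1) by (intro supp_diff_subset supp_add_subset)
  ultimately have rest: "rest \<in> pos_cone C (Suc k)"
    by (simp add: in_pos_cone)
  have ab_cone: "pos_part a \<in> pos_cone C (Suc k)" "neg_part a \<in> pos_cone C (Suc k)"
      "pos_part b \<in> pos_cone C (Suc k)" "neg_part b \<in> pos_cone C (Suc k)"
    using supp_ab by (auto intro!: pos_cone_pos_part)
  have parts: "pos_part c = c + neg_part c" for c :: "'a \<Rightarrow>\<^sub>0 int"
    using pos_part_minus_neg_part[of c] by (metis diff_add_cancel)
  have bd_ab: "bd C (Suc k) a = 0" "bd C (Suc k) b = 0"
    unfolding a_def b_def using PQ by (simp_all add: bd_bd)
  note eqs = upper_bd_eq[OF P \<open>Suc k < N\<close>] upper_bd_eq[OF Q \<open>Suc k < N\<close>]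
  have uP: "upper N k P'"
    unfolding upper_def
  proof (intro conjI allI impI)
    fix m
    assume "k < m"
    then consider "m = Suc k" | "Suc k < m" by linarith
    then have "fst (P' m) \<in> pos_cone C m \<and> snd (P' m) \<in> pos_cone C m \<and>
        bd C (Suc m) (fst (P' (Suc m))) = snd (P' m) - fst (P' m) \<and>
        bd C (Suc m) (snd (P' (Suc m))) = snd (P' m) - fst (P' m)"
    proof cases
      case 1
      then show ?thesis
        using rest ab_cone eqs
        by (simp add: P'_def pos_cone_add pos_cone_restrict parts[of a] a_def[symmetric])
    next
      case 2
      then show ?thesis
        using P by (simp add: P'_def upper_def)
    qed
    then show "fst (P' m) \<in> pos_cone C m" "snd (P' m) \<in> pos_cone C m"
        "bd C (Suc m) (fst (P' (Suc m))) = snd (P' m) - fst (P' m)"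
        "bd C (Suc m) (snd (P' (Suc m))) = snd (P' m) - fst (P' m)"
      by auto
  next
    fix m
    assume "N < m"
    then show "P' m = 0"
      using P \<open>Suc k < N\<close> by (simp add: P'_def upper_def)
  qed
  have uQ: "upper N k Q'"
    unfolding upper_def
  proof (intro conjI allI impI)
    fix m
    assume "k < m"
    then consider "m = Suc k" | "Suc k < m" by linarith
    then have "fst (Q' m) \<in> pos_cone C m \<and> snd (Q' m) \<in> pos_cone C m \<and>
        bd C (Suc m) (fst (Q' (Suc m))) = snd (Q' m) - fst (Q' m) \<and>
        bd C (Suc m) (snd (Q' (Suc m))) = snd (Q' m) - fst (Q' m)"
    proof cases
      case 1
      then show ?thesis
        using rest ab_cone eqs
        by (simp add: Q'_def pos_cone_add pos_cone_restrict parts[of b] b_def[symmetric])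
    next
      case 2
      then show ?thesis
        using Q by (simp add: Q'_def upper_def)
    qed
    then show "fst (Q' m) \<in> pos_cone C m" "snd (Q' m) \<in> pos_cone C m"
        "bd C (Suc m) (fst (Q' (Suc m))) = snd (Q' m) - fst (Q' m)"
        "bd C (Suc m) (snd (Q' (Suc m))) = snd (Q' m) - fst (Q' m)"
      by auto
  next
    fix m
    assume "N < m"
    then show "Q' m = 0"
      using Q \<open>Suc k < N\<close> by (simp add: Q'_def upper_def)
  qed
  have "neg_part a + restrict_chain ?E rest + (neg_part b + restrict_chain (- ?E) rest) =
      restrict_chain ?E rest + restrict_chain (- ?E) rest + (neg_part a + neg_part b)"
    by (simp add: algebra_simps)
  also have "\<dots> = ?s"
    unfolding restrict_chain_partition by (simp add: rest_def)
  finally have fst_sum: "neg_part a + restrict_chain ?E rest + (neg_part b + restrict_chain (- ?E) rest) = ?s" .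
  have sum': "z m = P' m + Q' m" if "k < m" for m
  proof (cases "m = Suc k")
    case True
    have "snd (z (Suc k)) = snd (P' (Suc k) + Q' (Suc k))"
      unfolding z_snd fst_sum[symmetric] by (simp add: P'_def Q'_def parts[of a] parts[of b] algebra_simps)
    then show ?thesis
      using True fst_sum by (simp add: P'_def Q'_def prod_eq_iff)
  next
    case False
    with that show ?thesis by (simp add: P'_def Q'_def sum)
  qed
  have crit_P: "d \<in> D k" if "coeff (bd C (Suc k) (fst (P' (Suc k)))) d < 0" for d
  proof (rule bd_lower_set_negative[OF D _ _ that])
    show "fst (P' (Suc k)) \<in> pos_cone C (Suc k)"
      using uP by (simp add: upper_def)
    show "supp (fst (P' (Suc k))) \<subseteq> D (Suc k)"
    proof -
      have "supp (neg_part a) \<subseteq> D (Suc k)"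
        using assms(7) unfolding a_def[symmetric] by (auto simp: in_keys_iff max_def split: if_splits)
      then show ?thesis
        by (simp add: P'_def supp_add_subset supp_restrict_chain)
    qed
  qed
  \<comment> \<open>The entry \<open>fst\<close> of \<open>Q'\<close> contains
    \<open>neg_part b\<close>, which may meet \<open>D\<close>; the entry \<open>snd\<close>
    contains \<open>pos_part b\<close>, which does not. Both have the same boundary since that of
    \<open>b\<close> vanishes, so \<open>snd\<close> is used.\<close>
  have crit_Q: "d \<notin> D k" if "0 < coeff (bd C (Suc k) (fst (Q' (Suc k)))) d" for d
  proof (rule bd_lower_set_positive[OF D])
    show "snd (Q' (Suc k)) \<in> pos_cone C (Suc k)"
      using uQ by (simp add: upper_def)
    show "0 < coeff (bd C (Suc k) (snd (Q' (Suc k)))) d"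
      using that bd_ab by (simp add: Q'_def parts[of b] bd_add)
    show "supp (snd (Q' (Suc k))) \<inter> D (Suc k) = {}"
    proof -
      have "supp (pos_part b) \<subseteq> - D (Suc k)"
        using assms(8) unfolding b_def[symmetric] by (auto simp: in_keys_iff max_def split: if_splits)
      then have "supp (snd (Q' (Suc k))) \<subseteq> - D (Suc k)"
        by (simp add: Q'_def supp_add_subset supp_restrict_chain)
      then show ?thesis by blast
    qed
  qed
  show ?thesis
  proof (rule split_cell_lower_set[OF z _ uP uQ sum' crit_P crit_Q])
    show "k < N" using \<open>Suc k < N\<close> by simp
    fix p q
    assume "p \<in> table_cell C N" "q \<in> table_cell C N" "table_tgt k p = table_src k q"
      "z = table_comp k p q" "\<And>m. k < m \<Longrightarrow> p m = P' m" "\<And>m. k < m \<Longrightarrow> q m = Q' m"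
    then show thesis
      by (intro that[of p q]) (auto simp: P'_def Q'_def)
  qed
qed

end

section \<open>Cells of a fixed dimension\<close>

text \<open>The \<open>N\<close>-cells of an omega-category with sources and targets regarded as
  \<open>N\<close>-cells through iterated identities.\<close>

locale one_sorted =
  fixes N :: nat and M :: "'c set" and S T :: "nat \<Rightarrow> 'c \<Rightarrow> 'c" and comp :: "nat \<Rightarrow> 'c \<Rightarrow> 'c \<Rightarrow> 'c"
  assumes S_closed: "k < N \<Longrightarrow> x \<in> M \<Longrightarrow> S k x \<in> M"
    and T_closed: "k < N \<Longrightarrow> x \<in> M \<Longrightarrow> T k x \<in> M"
    and comp_closed: "k < N \<Longrightarrow> x \<in> M \<Longrightarrow> y \<in> M \<Longrightarrow> T k x = S k y \<Longrightarrow> comp k x y \<in> M"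
    and S_S: "j < N \<Longrightarrow> k < N \<Longrightarrow> x \<in> M \<Longrightarrow> S j (S k x) = S (min j k) x"
    and S_T: "j < N \<Longrightarrow> k < N \<Longrightarrow> x \<in> M \<Longrightarrow> S j (T k x) = (if j < k then S j x else T k x)"
    and T_S: "j < N \<Longrightarrow> k < N \<Longrightarrow> x \<in> M \<Longrightarrow> T j (S k x) = (if j < k then T j x else S k x)"
    and T_T: "j < N \<Longrightarrow> k < N \<Longrightarrow> x \<in> M \<Longrightarrow> T j (T k x) = T (min j k) x"
    and S_comp: "k < N \<Longrightarrow> x \<in> M \<Longrightarrow> y \<in> M \<Longrightarrow> T k x = S k y \<Longrightarrow> S k (comp k x y) = S k x"
    and T_comp: "k < N \<Longrightarrow> x \<in> M \<Longrightarrow> y \<in> M \<Longrightarrow> T k x = S k y \<Longrightarrow> T k (comp k x y) = T k y"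
    and S_comp_ne: "j \<noteq> k \<Longrightarrow> j < N \<Longrightarrow> k < N \<Longrightarrow> x \<in> M \<Longrightarrow> y \<in> M \<Longrightarrow> T k x = S k y \<Longrightarrow>
          S j (comp k x y) = comp k (S j x) (S j y)"
    and T_comp_ne: "j \<noteq> k \<Longrightarrow> j < N \<Longrightarrow> k < N \<Longrightarrow> x \<in> M \<Longrightarrow> y \<in> M \<Longrightarrow> T k x = S k y \<Longrightarrow>
          T j (comp k x y) = comp k (T j x) (T j y)"
    and assoc: "k < N \<Longrightarrow> x \<in> M \<Longrightarrow> y \<in> M \<Longrightarrow> z \<in> M \<Longrightarrow> T k x = S k y \<Longrightarrow> T k y = S k z \<Longrightarrow>
          comp k (comp k x y) z = comp k x (comp k y z)"
    and unit_left: "k < N \<Longrightarrow> x \<in> M \<Longrightarrow> comp k (S k x) x = x"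
    and unit_right: "k < N \<Longrightarrow> x \<in> M \<Longrightarrow> comp k x (T k x) = x"
    and interchange: "j < k \<Longrightarrow> k < N \<Longrightarrow> x \<in> M \<Longrightarrow> y \<in> M \<Longrightarrow> z \<in> M \<Longrightarrow> w \<in> M \<Longrightarrow>
          T k x = S k y \<Longrightarrow> T k z = S k w \<Longrightarrow> T j x = S j z \<Longrightarrow>
          comp j (comp k x y) (comp k z w) = comp k (comp j x z) (comp j y w)"
begin

section \<open>Consequences of interchange\<close>

lemma T_low_comp: "j < k \<Longrightarrow> k < N \<Longrightarrow> x \<in> M \<Longrightarrow> y \<in> M \<Longrightarrow> T k x = S k y \<Longrightarrow>
   T j x = T j y \<and> S j x = S j y"
  using T_T[of j k x] T_S[of j k y] S_T[of j k x] S_S[of j k y] by simp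

text \<open>Two cells side by side along \<open>k\<close> may be performed one after the other along
  \<open>i\<close>, each whiskered with the source or target of the other. Here \<open>y\<close>
  goes first, in \<open>exchange_right\<close> it is \<open>x\<close>; both are interchange with
  units.\<close>

lemma exchange_left:
  assumes "k < i" "i < N" "x \<in> M" "y \<in> M" "T k x = S k y"
  shows "comp i (comp k (S i x) y) (comp k x (T i y)) = comp k x y"
  using interchange[of k i "S i x" x y "T i y"] assms
  by (simp add: S_closed T_closed T_S S_T unit_left unit_right)

lemma exchange_right:
  assumes "k < i" "i < N" "x \<in> M" "y \<in> M" "T k x = S k y"
  shows "comp i (comp k x (S i y)) (comp k (T i x) y) = comp k x y"
  using interchange[of k i x "T i x" "S i y" y] assms
  by (simp add: S_closed T_closed S_S S_T T_S unit_left unit_right)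

text \<open>As \<open>v\<close> is a unit along \<open>k\<close>, it equals
  \<open>comp k v v\<close>, and interchange distributes it over the composite.\<close>

lemma whisker_comp_right:
  assumes "j < k" "k < N" "x \<in> M" "y \<in> M" "v \<in> M" "T k x = S k y" "T j x = S j v" "S k v = v" "T k v = v"
  shows "comp j (comp k x y) v = comp k (comp j x v) (comp j y v)"
  using interchange[of j k x y v v] unit_left[of k v] assms by simp

lemma whisker_comp_left:
  assumes "j < k" "k < N" "x \<in> M" "y \<in> M" "v \<in> M" "T k x = S k y" "T j v = S j x" "S k v = v" "T k v = v"
  shows "comp j v (comp k x y) = comp k (comp j v x) (comp j v y)"
  using interchange[of j k v v x y] unit_left[of k v] assms by simp

lemma composable_S:
  "j \<noteq> k \<Longrightarrow> j < N \<Longrightarrow> k < N \<Longrightarrow> x \<in> M \<Longrightarrow> y \<in> M \<Longrightarrow> T k x = S k y \<Longrightarrow> T k (S j x) = S k (S j y)"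
  using T_low_comp[of j k x y] by (cases "k < j") (auto simp: T_S S_S)

lemma composable_T:
  "j \<noteq> k \<Longrightarrow> j < N \<Longrightarrow> k < N \<Longrightarrow> x \<in> M \<Longrightarrow> y \<in> M \<Longrightarrow> T k x = S k y \<Longrightarrow> T k (T j x) = S k (T j y)"
  using T_low_comp[of j k x y] by (cases "k < j") (auto simp: T_T S_T)

lemma low_comp:
  assumes "j < k" "k < N" "x \<in> M" "y \<in> M" "T k x = S k y"
  shows "S j (comp k x y) = S j x" "T j (comp k x y) = T j y"
  using S_S[of j k "comp k x y"] S_S[of j k x] T_T[of j k "comp k x y"] T_T[of j k y]
    comp_closed[OF assms(2-5)] S_comp[OF assms(2-5)] T_comp[OF assms(2-5)] assms by simp_all

end

section \<open>The one-sorted structure on the cells of one dimension of an omega-category\<close>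

context omega_category
begin

lemma ides_cell: "x \<in> cell A k \<Longrightarrow> ides A k d x \<in> cell A (k + d)"
  by (induction d) (simp_all add: ide_cell)

lemma src_ides:
  "x \<in> cell A k \<Longrightarrow> j < k + d \<Longrightarrow>
   src A j (k + d) (ides A k d x) = (if j < k then src A j k x else ides A k (j - k) x)"
proof (induction d)
  case (Suc d)
  note c = ides_cell[OF Suc.prems(1), of d]
  show ?case
  proof (cases "j = k + d")
    case False
    then have "src A j (Suc (k + d)) (ide A (k + d) (ides A k d x)) = src A j (k + d) (ides A k d x)"
      using src_src[of j "k + d" "Suc (k + d)", OF _ _ ide_cell[OF c]] Suc.prems c
      by (simp add: src_ide)
    with Suc False show ?thesis by simp
  qed (simp add: src_ide c)
qed simp

lemma tgt_ides:
  "x \<in> cell A k \<Longrightarrow> j < k + d \<Longrightarrow>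
   tgt A j (k + d) (ides A k d x) = (if j < k then tgt A j k x else ides A k (j - k) x)"
proof (induction d)
  case (Suc d)
  note c = ides_cell[OF Suc.prems(1), of d]
  show ?case
  proof (cases "j = k + d")
    case False
    then have "tgt A j (Suc (k + d)) (ide A (k + d) (ides A k d x)) = tgt A j (k + d) (ides A k d x)"
      using tgt_tgt[of j "k + d" "Suc (k + d)", OF _ _ ide_cell[OF c]] Suc.prems c
      by (simp add: tgt_ide)
    with Suc False show ?thesis by simp
  qed (simp add: tgt_ide c)
qed simp

lemma ides_ides: "ides A (k + d) e (ides A k d x) = ides A k (d + e) x"
  by (induction e) (simp_all add: add.assoc)

lemma composable_ides: "composable A k n x y \<Longrightarrow> composable A k (n + d) (ides A n d x) (ides A n d y)"
  by (auto simp: composable_def ides_cell src_ides tgt_ides)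

lemma ides_comp:
  "composable A k n x y \<Longrightarrow> ides A n d (cmp A k n x y) = cmp A k (n + d) (ides A n d x) (ides A n d y)"
  by (induction d) (simp_all add: ide_comp[OF composable_ides])

definition usrc :: "nat \<Rightarrow> nat \<Rightarrow> 'c \<Rightarrow> 'c" where
  "usrc N k x = ides A k (N - k) (src A k N x)"

definition utgt :: "nat \<Rightarrow> nat \<Rightarrow> 'c \<Rightarrow> 'c" where
  "utgt N k x = ides A k (N - k) (tgt A k N x)"

lemma usrc_cell: "k < N \<Longrightarrow> x \<in> cell A N \<Longrightarrow> usrc N k x \<in> cell A N"
  using ides_cell[OF src_cell, of k N x "N - k"] by (simp add: usrc_def)

lemma utgt_cell: "k < N \<Longrightarrow> x \<in> cell A N \<Longrightarrow> utgt N k x \<in> cell A N"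
  using ides_cell[OF tgt_cell, of k N x "N - k"] by (simp add: utgt_def)

lemma src_ides': "y \<in> cell A k \<Longrightarrow> k \<le> N \<Longrightarrow> j < N \<Longrightarrow>
    src A j N (ides A k (N - k) y) = (if j < k then src A j k y else ides A k (j - k) y)"
  using src_ides[of y k j "N - k"] by simp

lemma tgt_ides': "y \<in> cell A k \<Longrightarrow> k \<le> N \<Longrightarrow> j < N \<Longrightarrow>
    tgt A j N (ides A k (N - k) y) = (if j < k then tgt A j k y else ides A k (j - k) y)"
  using tgt_ides[of y k j "N - k"] by simp

lemma src_utgt: "k < N \<Longrightarrow> x \<in> cell A N \<Longrightarrow> src A k N (utgt N k x) = tgt A k N x"
  by (simp add: utgt_def src_ides' tgt_cell)

lemma src_usrc: "k < N \<Longrightarrow> x \<in> cell A N \<Longrightarrow> src A k N (usrc N k x) = src A k N x"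
  by (simp add: usrc_def src_ides' src_cell)

text \<open>Passing to iterated identities loses nothing: the \<open>k\<close>-source of
  \<open>ides A k (N - k) y\<close> gives back \<open>y\<close>.\<close>

lemma composable_iff:
  "k < N \<Longrightarrow> x \<in> cell A N \<Longrightarrow> y \<in> cell A N \<Longrightarrow> utgt N k x = usrc N k y \<longleftrightarrow> composable A k N x y"
  using src_utgt[of k N x] src_usrc[of k N y] unfolding composable_def utgt_def usrc_def by metis

lemma ides_ides': "k \<le> j \<Longrightarrow> j \<le> N \<Longrightarrow> ides A j (N - j) (ides A k (j - k) x) = ides A k (N - k) x"
  using ides_ides[of k "j - k" "N - j" x] by simp

lemma usrc_low_comp:
  assumes "j < k" "composable A k N x y"
  shows "src A j N (cmp A k N x y) = src A j N x" "src A j N y = src A j N x"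
    "tgt A j N (cmp A k N x y) = tgt A j N x" "tgt A j N y = tgt A j N x"
proof -
  have c: "k < N" "x \<in> cell A N" "y \<in> cell A N" "tgt A k N x = src A k N y"
    using assms by (auto simp: composable_def)
  note cc = comp_cell[OF assms(2)]
  show "src A j N y = src A j N x"
    using src_src[OF assms(1) c(1,3)] src_tgt[OF assms(1) c(1,2)] c(4) by simp
  show "tgt A j N y = tgt A j N x"
    using tgt_src[OF assms(1) c(1,3)] tgt_tgt[OF assms(1) c(1,2)] c(4) by simp
  show "src A j N (cmp A k N x y) = src A j N x"
    using src_src[OF assms(1) c(1) cc] src_src[OF assms(1) c(1,2)] src_comp[OF assms(2)] by simp
  show "tgt A j N (cmp A k N x y) = tgt A j N x"
    using tgt_src[OF assms(1) c(1) cc] tgt_src[OF assms(1) c(1,2)] src_comp[OF assms(2)] by simp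
qed

lemma usrc_unit:
  assumes "j \<le> k" "k < N" "x \<in> cell A N"
  shows "cmp A k N (usrc N j x) (usrc N j x) = usrc N j x"
    and "cmp A k N (utgt N j x) (utgt N j x) = utgt N j x"
proof -
  have "ides A k (N - k) (src A k N (usrc N j x)) = usrc N j x"
    using assms by (simp add: usrc_def src_ides' src_cell ides_ides')
  then show "cmp A k N (usrc N j x) (usrc N j x) = usrc N j x"
    using unit_left[of k N "usrc N j x"] usrc_cell[of j N x] assms by simp
  have "ides A k (N - k) (src A k N (utgt N j x)) = utgt N j x"
    using assms by (simp add: utgt_def src_ides' tgt_cell ides_ides')
  then show "cmp A k N (utgt N j x) (utgt N j x) = utgt N j x"
    using unit_left[of k N "utgt N j x"] utgt_cell[of j N x] assms by simp
qed

text \<open>For \<open>j < k\<close> the \<open>j\<close>-boundaries of \<open>x\<close>,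
  \<open>y\<close> and the composite coincide and are units along \<open>k\<close>. For
  \<open>j > k\<close> the axioms on sources and targets of composites apply, and iterated
  identities respect composition.\<close>

lemma usrc_comp_ne:
  assumes "j \<noteq> k" "j < N" and c: "composable A k N x y"
  shows "usrc N j (cmp A k N x y) = cmp A k N (usrc N j x) (usrc N j y)"
    and "utgt N j (cmp A k N x y) = cmp A k N (utgt N j x) (utgt N j y)"
proof -
  have xy: "k < N" "x \<in> cell A N" "y \<in> cell A N" "tgt A k N x = src A k N y"
    using c by (auto simp: composable_def)
  have "usrc N j (cmp A k N x y) = cmp A k N (usrc N j x) (usrc N j y) \<and>
      utgt N j (cmp A k N x y) = cmp A k N (utgt N j x) (utgt N j y)"
  proof (cases "j < k")
    case True
    then have "usrc N j y = usrc N j x" "utgt N j y = utgt N j x"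
      "usrc N j (cmp A k N x y) = usrc N j x" "utgt N j (cmp A k N x y) = utgt N j x"
      using usrc_low_comp[OF True c] by (simp_all add: usrc_def utgt_def)
    then show ?thesis
      using usrc_unit[of j k N x] True xy by simp
  next
    case False
    with assms have "k < j" by simp
    have "composable A k j (src A j N x) (src A j N y)" "composable A k j (tgt A j N x) (tgt A j N y)"
      using xy \<open>k < j\<close> \<open>j < N\<close>
      by (auto simp: composable_def src_cell tgt_cell tgt_src src_src tgt_tgt src_tgt)
    note this[THEN ides_comp, of "N - j"]
    then show ?thesis
      using src_comp_above[OF c \<open>k < j\<close> \<open>j < N\<close>] tgt_comp_above[OF c \<open>k < j\<close> \<open>j < N\<close>] \<open>j < N\<close>
      by (simp add: usrc_def utgt_def)
  qed
  then show "usrc N j (cmp A k N x y) = cmp A k N (usrc N j x) (usrc N j y)"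
    and "utgt N j (cmp A k N x y) = cmp A k N (utgt N j x) (utgt N j y)" by auto
qed

lemma one_sorted: "one_sorted N (cell A N) (usrc N) (utgt N) (\<lambda>k. cmp A k N)"
proof (unfold_locales, goal_cases)
  case (4 j k x)
  then show ?case
    by (cases "j < k") (simp_all add: usrc_def src_ides' src_cell src_src ides_ides' min_def)
next
  case (5 j k x)
  then show ?case
    by (cases "j < k") (simp_all add: usrc_def utgt_def src_ides' tgt_cell src_tgt ides_ides')
next
  case (6 j k x)
  then show ?case
    by (cases "j < k") (simp_all add: usrc_def utgt_def tgt_ides' src_cell tgt_src ides_ides')
next
  case (7 j k x)
  then show ?case
    by (cases "j < k") (simp_all add: utgt_def tgt_ides' tgt_cell tgt_tgt ides_ides' min_def)
next
  case (3 k x y)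
  then show ?case using composable_iff[of k N x y] comp_cell[of k N x y] by blast
next
  case (8 k x y)
  then show ?case using composable_iff[of k N x y] src_comp[of k N x y] by (metis usrc_def)
next
  case (9 k x y)
  then show ?case using composable_iff[of k N x y] tgt_comp[of k N x y] by (metis utgt_def)
next
  case (10 j k x y)
  then show ?case using composable_iff[of k N x y] usrc_comp_ne(1)[of j k N x y] by blast
next
  case (11 j k x y)
  then show ?case using composable_iff[of k N x y] usrc_comp_ne(2)[of j k N x y] by blast
next
  case (12 k x y z)
  then show ?case
    using composable_iff[of k N x y] composable_iff[of k N y z] comp_assoc[of k N x y z] by blast
next
  case (13 k x)
  then show ?case using unit_left[of k N x] by (simp add: usrc_def)
next
  case (14 k x)
  then show ?case using unit_right[of k N x] by (simp add: utgt_def)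
next
  case (15 j k x y z w)
  then show ?case
    using composable_iff[of k N x y] composable_iff[of k N z w] composable_iff[of j N x z]
      interchange[of j k N x y z w] by fastforce
qed (simp_all add: usrc_cell utgt_cell)

end

text \<open>Identities leave a table unchanged, so here \<open>usrc\<close> and \<open>utgt\<close>
  are the truncations themselves.\<close>

lemma one_sorted_omega_of:
  "one_sorted N (table_cell C N) table_src table_tgt table_comp"
proof -
  have "omega_category.usrc (omega_of C) N = table_src" "omega_category.utgt (omega_of C) N = table_tgt"
    by (simp_all add: fun_eq_iff omega_category.usrc_def[OF omega_category_omega_of]
        omega_category.utgt_def[OF omega_category_omega_of])
  then show ?thesis
    using omega_category.one_sorted[OF omega_category_omega_of[of C], of N] by simp
qed

section \<open>The order on elements\<close>

context parity_complex
begin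

text \<open>One witness of strong loop-freeness, chosen once; \<open>below\<close>, and through it
  the canonical splitting, refers to it.\<close>

definition prec :: "((nat \<times> 'a) \<times> (nat \<times> 'a)) set" where
  "prec = (SOME r. partial_order_on (SIGMA n:UNIV. elts C n) r \<and>
         (\<forall>n. \<forall>x \<in> elts C n. \<forall>y \<in> elts C (Suc n).
            (x \<in> minus_face C (Suc n) y \<longrightarrow> ((n, x), (Suc n, y)) \<in> r) \<and>
            (x \<in> plus_face C (Suc n) y \<longrightarrow> ((Suc n, y), (n, x)) \<in> r)))"

lemma prec:
  "partial_order_on (SIGMA n:UNIV. elts C n) prec"
  "x \<in> elts C n \<Longrightarrow> y \<in> elts C (Suc n) \<Longrightarrow> x \<in> minus_face C (Suc n) y \<Longrightarrow> ((n, x), (Suc n, y)) \<in> prec"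
  "x \<in> elts C n \<Longrightarrow> y \<in> elts C (Suc n) \<Longrightarrow> x \<in> plus_face C (Suc n) y \<Longrightarrow> ((Suc n, y), (n, x)) \<in> prec"
  using someI_ex[OF strongly_loop_free] unfolding prec_def[symmetric] by blast+

lemma prec_refl: "x \<in> elts C n \<Longrightarrow> ((n, x), (n, x)) \<in> prec"
  using prec(1) by (auto simp: partial_order_on_def preorder_on_def intro: refl_onD)

lemma prec_trans: "(p, q) \<in> prec \<Longrightarrow> (q, s) \<in> prec \<Longrightarrow> (p, s) \<in> prec"
  using prec(1) by (auto simp: partial_order_on_def preorder_on_def dest: transD)

lemma prec_antisym: "(p, q) \<in> prec \<Longrightarrow> (q, p) \<in> prec \<Longrightarrow> p = q"
  using prec(1) by (auto simp: partial_order_on_def dest: antisymD)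

definition below :: "nat \<Rightarrow> 'a \<Rightarrow> nat \<Rightarrow> 'a set" where
  "below N b m = {x. ((m, x), (N, b)) \<in> prec}"

lemma lower_set_below: "lower_set (below N b)"
  unfolding lower_set_def below_def using prec(2,3) prec_trans minus_elts plus_elts by blast

lemma mu_set_below: "b \<in> elts C N \<Longrightarrow> k \<le> N \<Longrightarrow> mu_set C N b k \<subseteq> below N b k"
proof -
  assume b: "b \<in> elts C N" and "k \<le> N"
  from this(2) show ?thesis
  proof (induction k rule: inc_induct)
    case base
    then show ?case using b by (simp add: below_def prec_refl)
  next
    case (step k)
    show ?case
    proof
      fix d assume "d \<in> mu_set C N b k"
      with step(2) obtain x where "x \<in> mu_set C N b (Suc k)" "d \<in> minus_face C (Suc k) x"
        by (auto simp: mu_set.simps[of C N b k] minus_plus_def minus_faces_def)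
      moreover from this have "x \<in> elts C (Suc k)" "x \<in> below N b (Suc k)"
        using step finite_mu_set[OF b, of "Suc k"] by auto
      ultimately show "d \<in> below N b k"
        using lower_set_minus[OF lower_set_below] by blast
    qed
  qed
qed

lemma above_pi_set: "b \<in> elts C N \<Longrightarrow> k \<le> N \<Longrightarrow> d \<in> pi_set C N b k \<Longrightarrow> ((N, b), (k, d)) \<in> prec"
proof -
  assume b: "b \<in> elts C N" and "k \<le> N" "d \<in> pi_set C N b k"
  from this(2,3) show ?thesis
  proof (induction k arbitrary: d rule: inc_induct)
    case base
    then show ?case using b by (simp add: prec_refl)
  next
    case (step k)
    then obtain x where x: "x \<in> pi_set C N b (Suc k)" "d \<in> plus_face C (Suc k) x"
      by (auto simp: pi_set.simps[of C N b k] plus_minus_def plus_faces_def)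
    then have "x \<in> elts C (Suc k)"
      using step(2) finite_pi_set[OF b, of "Suc k"] by auto
    then have "((Suc k, x), (k, d)) \<in> prec"
      using x(2) plus_elts[of x k] by (intro prec(3)) auto
    with step.IH[OF x(1)] show ?case
      by (rule prec_trans)
  qed
qed

text \<open>Otherwise \<open>d\<close> would be both before and after \<open>b\<close>, hence equal
  to it by antisymmetry, although the degrees \<open>k < N\<close> differ.\<close>

lemma pi_set_not_below:
  assumes "b \<in> elts C N" "k < N" "d \<in> pi_set C N b k"
  shows "d \<notin> below N b k"
  using above_pi_set[of b N k d] prec_antisym[of "(N, b)" "(k, d)"] assms by (auto simp: below_def)

lemma mu_pi_disjoint: "b \<in> elts C N \<Longrightarrow> k < N \<Longrightarrow> mu_set C N b k \<inter> pi_set C N b k = {}"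
  using mu_set_below[of b N k] pi_set_not_below[of b N k] by auto

lemma atom_bd_negative:
  assumes "b \<in> elts C N" "k < N" "coeff (bd C (Suc k) (fst (atom C N b (Suc k)))) d < 0"
  shows "d \<in> below N b k"
  using assms mu_set_below[of b N k] finite_mu_set[of b N k] finite_pi_set[of b N k]
  by (auto simp: atom_def bd_mu_pi lookup_minus coeff_set_chain split: if_splits)

lemma atom_bd_positive:
  assumes "b \<in> elts C N" "k < N" "0 < coeff (bd C (Suc k) (fst (atom C N b (Suc k)))) d"
  shows "d \<notin> below N b k"
  using assms pi_set_not_below[of b N k] finite_mu_set[of b N k] finite_pi_set[of b N k]
  by (auto simp: atom_def bd_mu_pi lookup_minus coeff_set_chain split: if_splits)

text \<open>Take \<open>x\<close> minimal for \<open>prec\<close>. If \<open>d\<close> is a minus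
  face of \<open>x\<close> and a plus face of \<open>y\<close>, then \<open>y\<close> precedes
  \<open>d\<close> and \<open>d\<close> precedes \<open>x\<close>, so \<open>y = x\<close>, against
  the disjointness of the face sets.\<close>

lemma minimal_supp:
  assumes "supp c \<subseteq> elts C (Suc k)" "c \<noteq> 0"
  obtains x where "x \<in> supp c"
    "\<And>y d. y \<in> supp c \<Longrightarrow> d \<in> minus_face C (Suc k) x \<Longrightarrow> d \<notin> plus_face C (Suc k) y"
proof -
  let ?R = "\<lambda>x y. ((Suc k, x), (Suc k, y)) \<in> prec \<and> x \<noteq> y"
  have "supp c \<noteq> {}"
    using assms(2) by simp
  moreover have "asymp_on (supp c) ?R" "transp_on (supp c) ?R"
    using prec_antisym prec_trans by (auto intro!: asymp_onI transp_onI)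
  ultimately obtain x where x: "x \<in> supp c" "\<forall>y\<in>supp c. \<not> ?R y x"
    using Finite_Set.bex_min_element[of "supp c" ?R] by auto
  show ?thesis
  proof (rule that[OF x(1)])
    fix y d
    assume y: "y \<in> supp c" and d: "d \<in> minus_face C (Suc k) x"
    show "d \<notin> plus_face C (Suc k) y"
    proof
      assume d': "d \<in> plus_face C (Suc k) y"
      have e: "x \<in> elts C (Suc k)" "y \<in> elts C (Suc k)"
        using x y assms(1) by auto
      then have "((Suc k, y), (Suc k, x)) \<in> prec"
        using d d' minus_elts[OF e(1)] prec(2,3)[of d k] prec_trans by blast
      with x y have "y = x" by blast
      with d d' e show False
        using disjoint_faces by blast
    qed
  qed
qed

text \<open>Nothing in \<open>c\<close> produces \<open>d\<close>, so no contribution to its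
  coefficient is positive and that of \<open>x\<close> is strictly negative.\<close>

lemma minimal_bd:
  assumes "c \<in> pos_cone C (Suc k)" "x \<in> supp c"
    and min: "\<And>y. y \<in> supp c \<Longrightarrow> d \<notin> plus_face C (Suc k) y"
    and "d \<in> minus_face C (Suc k) x"
  shows "coeff (bd C (Suc k) c) d < 0"
proof -
  have c: "supp c \<subseteq> elts C (Suc k)" "nonneg c"
    using assms(1) by (auto simp: in_pos_cone)
  let ?t = "\<lambda>y. coeff c y * (if d \<in> minus_face C (Suc k) y then 1 else 0)"
  have "coeff (bd C (Suc k) c) d = - (\<Sum>y\<in>supp c. ?t y)"
    unfolding coeff_bd[OF c(1)] sum_negf[symmetric] using min by (intro sum.cong) auto
  moreover have "?t x \<le> (\<Sum>y\<in>supp c. ?t y)"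
    using assms(2) c(2) by (intro member_le_sum) (auto simp: nonneg_def)
  moreover have "0 < ?t x"
    using assms(2,4) nonneg_coeff[OF c(2), of x] by (auto simp: in_keys_iff)
  ultimately show ?thesis by linarith
qed

text \<open>A minimal element of a nonzero \<open>c\<close> has a minus face by unitality, and
  nothing in \<open>c\<close> cancels that face.\<close>

lemma neg_part_bd_eq_0:
  assumes "c \<in> pos_cone C (Suc 0)" "nonneg (bd C (Suc 0) c)"
  shows "c = 0"
proof (rule ccontr)
  assume "c \<noteq> 0"
  have c: "supp c \<subseteq> elts C (Suc 0)" using assms(1) by (simp add: in_pos_cone)
  obtain x where x: "x \<in> supp c"
    "\<And>y d. y \<in> supp c \<Longrightarrow> d \<in> minus_face C (Suc 0) x \<Longrightarrow> d \<notin> plus_face C (Suc 0) y"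
    using minimal_supp[OF c \<open>c \<noteq> 0\<close>] by blast
  have "well_formed C 0 (mu_set C (Suc 0) x 0)"
    using x c by (intro unital_mu) auto
  then obtain d where d: "d \<in> minus_face C (Suc 0) x"
    using x c by (auto simp: well_formed_def)
  then have "coeff (bd C (Suc 0) c) d < 0"
    using x by (intro minimal_bd[OF assms(1) x(1)]) auto
  with nonneg_coeff[OF assms(2), of d] show False by simp
qed

text \<open>There is no room for two independent parts in degree \<open>0\<close>, by the augmentation.\<close>

lemma no_swap_in_degree_0:
  assumes "a \<in> pos_cone C (Suc 0)" "b \<in> pos_cone C (Suc 0)" "nonneg s" "aug s = 1"
    and "nonneg (s + bd C (Suc 0) a)" "nonneg (s + bd C (Suc 0) b)"
    and "nonneg (s + (bd C (Suc 0) a + bd C (Suc 0) b))"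
  shows "a = 0 \<or> b = 0"
proof (rule ccontr)
  assume "\<not> (a = 0 \<or> b = 0)"
  \<comment> \<open>Each nonzero part consumes something. As both consumptions fit into
    \<open>s\<close> at the same time, \<open>s\<close> would have augmentation at least 2.\<close>
  have "neg_part (bd C (Suc 0) c) \<noteq> 0" if "c \<in> pos_cone C (Suc 0)" "c \<noteq> 0" for c
  proof
    assume "neg_part (bd C (Suc 0) c) = 0"
    then have "nonneg (bd C (Suc 0) c)"
      unfolding nonneg_def
      by (metis coeff_pos_part lookup_uminus lookup_zero max.cobounded2 neg_le_0_iff_le)
    with neg_part_bd_eq_0 that show False by blast
  qed
  with \<open>\<not> (a = 0 \<or> b = 0)\<close> have "2 \<le> aug s"
    using neg_parts_le[OF assms(3,5-7)] assms(1,2)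
    by (intro aug_sum_ge_2[OF nonneg_pos_part nonneg_pos_part]) auto
  with assms(4) show False by simp
qed


section \<open>Cells with a single top element\<close>

text \<open>For \<open>m = k + 1\<close> these are the columns above \<open>k\<close> of a
  \<open>(k + 1)\<close>-cell with top chain \<open>c\<close>, that is, of a whisker.\<close>

definition column :: "nat \<Rightarrow> ('a \<Rightarrow>\<^sub>0 int) \<Rightarrow> 'a table" where
  "column m c = (\<lambda>_. 0)(m := (c, c))"

lemma column_simps [simp]: "column m c m = (c, c)" "j \<noteq> m \<Longrightarrow> column m c j = 0"
  by (simp_all add: column_def)

lemma upper_column: "c \<in> pos_cone C (Suc k) \<Longrightarrow> Suc k \<le> N \<Longrightarrow> upper N k (column (Suc k) c)"
  by (auto simp: upper_def column_def pos_cone_0)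

lemma upper_add: "upper N k P \<Longrightarrow> upper N k Q \<Longrightarrow> upper N k (P + Q)"
  by (auto simp: upper_def pos_cone_add bd_add)

lemma cell_column: "v \<in> table_cell C (Suc k) \<Longrightarrow> k < m \<Longrightarrow> v m = column (Suc k) (fst (v (Suc k))) m"
  using table_cell_zero[of v C "Suc k" m] table_cell_top[of v C "Suc k"]
  by (cases "m = Suc k") (auto simp: prod_eq_iff)

lemma column_cell:
  "v \<in> table_cell C N \<Longrightarrow> (\<And>m. k < m \<Longrightarrow> v m = column (Suc k) c m) \<Longrightarrow> v \<in> table_cell C (Suc k)"
  by (erule table_cell_lower) simp

text \<open>The stages of stripping off whiskers. For \<open>N = Suc n\<close>, the stage
  \<open>i = n\<close> contains the cells with top chain \<open>frag_of b\<close>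
  (\<open>reduced_top\<close>), and at \<open>i = 0\<close> only the atom is left
  (\<open>reduced_0\<close>).\<close>

definition reduced :: "nat \<Rightarrow> nat \<Rightarrow> 'a \<Rightarrow> 'a table \<Rightarrow> bool" where
  "reduced N i b x \<longleftrightarrow> x \<in> table_cell C N \<and> (\<forall>m>i. x m = atom C N b m)"

lemma reduced_cell: "reduced N i b x \<Longrightarrow> x \<in> table_cell C N"
  by (simp add: reduced_def)

lemma reduced_mono: "i \<le> j \<Longrightarrow> reduced N i b x \<Longrightarrow> reduced N j b x"
  by (simp add: reduced_def)

lemma reduced_atom: "b \<in> elts C N \<Longrightarrow> reduced N i b (atom C N b)"
  by (simp add: reduced_def atom_cell)

lemma reduced_top:
  assumes "x \<in> table_cell C (Suc n)" "fst (x (Suc n)) = frag_of b"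
  shows "reduced (Suc n) n b x"
  unfolding reduced_def
proof (intro conjI allI impI)
  fix m assume "n < m"
  then show "x m = atom C (Suc n) b m"
    using assms table_cell_top[OF assms(1)] table_cell_zero[OF assms(1), of m]
    by (cases "m = Suc n") (auto simp: atom_def prod_eq_iff)
qed fact

text \<open>The entries of column 0 are single elements by the augmentation, and a difference of two
  distinct elements determines both of them. They are distinct because \<open>mu\<close> and
  \<open>pi\<close> are disjoint.\<close>

lemma reduced_0:
  assumes "b \<in> elts C (Suc n)" "reduced (Suc n) 0 b x"
  shows "x = atom C (Suc n) b"
proof -
  let ?a = "atom C (Suc n) b"
  note x = reduced_cell[OF assms(2)] and a = atom_cell[OF assms(1)]
  have "snd (x 0) - fst (x 0) = snd (?a 0) - fst (?a 0)"
    using table_cell_bd(1)[OF x, of 0] table_cell_bd(1)[OF a, of 0] assms(2)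
    by (simp add: reduced_def)
  moreover obtain p q r s where pq: "fst (x 0) = frag_of p" "snd (x 0) = frag_of q"
    "fst (?a 0) = frag_of r" "snd (?a 0) = frag_of s"
    using table_cell_aug[OF x] table_cell_aug[OF a]
      table_cell_pos_cone[OF x, of 0] table_cell_pos_cone[OF a, of 0]
    by (metis in_pos_cone nonneg_aug_1E)
  moreover have "r \<noteq> s"
  proof -
    have "mu_set C (Suc n) b 0 = {r}" "pi_set C (Suc n) b 0 = {s}"
      using pq(3,4) finite_mu_set[OF assms(1), of 0] finite_pi_set[OF assms(1), of 0]
        supp_set_chain[of "mu_set C (Suc n) b 0"] supp_set_chain[of "pi_set C (Suc n) b 0"]
      by (auto simp: atom_def)
    then show ?thesis
      using mu_pi_disjoint[OF assms(1), of 0] by auto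
  qed
  ultimately have eq: "frag_of q - frag_of p = frag_of s - frag_of r" by simp
  have "coeff (frag_of q - frag_of p) r = coeff (frag_of s - frag_of r) r"
    "coeff (frag_of q - frag_of p) s = coeff (frag_of s - frag_of r) s"
    by (simp_all only: eq)
  with \<open>r \<noteq> s\<close> have "p = r" "q = s"
    by (auto simp: lookup_minus split: if_splits)
  with pq have "x 0 = ?a 0" by (simp add: prod_eq_iff)
  moreover have "x m = ?a m" if "0 < m" for m
    using assms(2) that by (simp add: reduced_def)
  ultimately show ?thesis
    by (metis ext neq0_conv)
qed

text \<open>The difference of the two entries of column \<open>i + 1\<close> is that of the atom,
  where \<open>mu\<close> and \<open>pi\<close> are disjoint. So a nonnegative column with this
  difference exceeds the column of the atom by one nonnegative chain, the same in both
  entries.\<close>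

lemma reduced_column:
  assumes "b \<in> elts C N" "reduced N (Suc i) b x" "Suc i < N"
  obtains c where "c \<in> pos_cone C (Suc i)"
    "\<And>m. i < m \<Longrightarrow> x m = (atom C N b + column (Suc i) c) m"
proof -
  let ?a = "atom C N b"
  note x = reduced_cell[OF assms(2)] and a = atom_cell[OF assms(1)]
  define c where "c = fst (x (Suc i)) - fst (?a (Suc i))"
  have eq: "snd (x (Suc i)) - fst (x (Suc i)) = snd (?a (Suc i)) - fst (?a (Suc i))"
    using table_cell_bd(1)[OF x, of "Suc i"] table_cell_bd(1)[OF a, of "Suc i"] assms(2)
    by (simp add: reduced_def)
  note pos = table_cell_pos_cone[OF x, of "Suc i"] table_cell_pos_cone[OF a, of "Suc i"]
  have "0 \<le> coeff c d" for d
  proof -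
    have "coeff (snd (x (Suc i)) - fst (x (Suc i))) d = coeff (snd (?a (Suc i)) - fst (?a (Suc i))) d"
      using eq by simp
    then show ?thesis
      using pos mu_pi_disjoint[OF assms(1,3)] assms(3)
        finite_mu_set[OF assms(1), of "Suc i"] finite_pi_set[OF assms(1), of "Suc i"]
        nonneg_coeff[of "fst (x (Suc i))" d] nonneg_coeff[of "snd (x (Suc i))" d]
      by (auto simp: c_def in_pos_cone lookup_minus atom_def coeff_set_chain split: if_splits)
  qed
  then have "c \<in> pos_cone C (Suc i)"
    using pos by (simp add: in_pos_cone nonneg_def c_def supp_diff_subset)
  moreover have "x m = (?a + column (Suc i) c) m" if "i < m" for m
  proof (cases "m = Suc i")
    case True
    have "snd (x (Suc i)) = snd (?a (Suc i)) + c"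
      using eq by (simp add: c_def algebra_simps)
    with True show ?thesis
      by (auto simp: c_def prod_eq_iff)
  next
    case False
    with that assms(2) show ?thesis by (simp add: reduced_def)
  qed
  ultimately show ?thesis by (rule that)
qed

lemma reduced_whisker:
  assumes "reduced N i b x" "v \<in> table_cell C i" "k < i" "i \<le> N"
  shows "table_tgt k x = table_src k v \<Longrightarrow> reduced N i b (table_comp k x v)"
    and "table_tgt k v = table_src k x \<Longrightarrow> reduced N i b (table_comp k v x)"
  using assms table_cell_zero[OF assms(2)]
  by (auto simp: reduced_def table_comp_columns table_comp_cell table_cell_mono[OF assms(4)])

section \<open>The canonical splitting of whiskers in one degree\<close>

lemma restrict_bd_negative:
  assumes "c \<in> pos_cone C (Suc k)" "supp c \<subseteq> below N b (Suc k)" "coeff (bd C (Suc k) c) d < 0"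
  shows "d \<in> below N b k"
  using bd_lower_set_negative[OF lower_set_below assms] .

lemma restrict_bd_positive:
  assumes "c \<in> pos_cone C (Suc k)" "supp c \<inter> below N b (Suc k) = {}" "0 < coeff (bd C (Suc k) c) d"
  shows "d \<notin> below N b k"
  using bd_lower_set_positive[OF lower_set_below assms] .

definition canonical :: "nat \<Rightarrow> nat \<Rightarrow> 'a \<Rightarrow> 'a table \<Rightarrow> 'a table \<Rightarrow> 'a table \<Rightarrow> 'a table \<Rightarrow> bool" where
  "canonical N i b x l y r \<longleftrightarrow>
     l \<in> table_cell C (Suc i) \<and> reduced N i b y \<and> r \<in> table_cell C (Suc i) \<and>
     supp (fst (l (Suc i))) \<subseteq> below N b (Suc i) \<and> supp (fst (r (Suc i))) \<inter> below N b (Suc i) = {} \<and>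
     table_tgt i l = table_src i y \<and> table_tgt i y = table_src i r \<and>
     x = table_comp i (table_comp i l y) r"

lemma table_tgt_comp: "table_tgt k x = table_src k y \<Longrightarrow> table_tgt k (table_comp k x y) = table_tgt k y"
  using table_tgt_eq_srcD[of k x y] by (auto simp: table_comp_def table_tgt_def fun_eq_iff)

lemma table_src_comp: "table_tgt k x = table_src k y \<Longrightarrow> table_src k (table_comp k x y) = table_src k x"
  using table_tgt_eq_srcD[of k x y] by (auto simp: table_comp_def table_src_def fun_eq_iff)

lemma table_assoc: "table_comp k (table_comp k x y) z = table_comp k x (table_comp k y z)"
  by (auto simp: table_comp_def fun_eq_iff add.assoc)

text \<open>Cut the excess \<open>c\<close> over the atom by \<open>below N b\<close>. First
  \<open>l\<close> splits off, consuming only inside the lower set while the atom and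
  \<open>r\<close> produce only outside it; then the atom splits off from \<open>r\<close> for the
  same reason.\<close>

lemma canonical_exists:
  assumes b: "b \<in> elts C N" and x: "reduced N (Suc i) b x" and "Suc i < N"
  shows "\<exists>l y r. canonical N i b x l y r"
proof -
  let ?a = "atom C N b" and ?D = "below N b (Suc i)"
  note a = upper_cell[OF atom_cell[OF b], of i]
  obtain c where c: "c \<in> pos_cone C (Suc i)"
    and xm: "\<And>m. i < m \<Longrightarrow> x m = (?a + column (Suc i) c) m"
    using reduced_column[OF b x assms(3)] by blast
  define cl cr where "cl = restrict_chain ?D c" and "cr = restrict_chain (- ?D) c"
  have cc: "cl \<in> pos_cone C (Suc i)" "cr \<in> pos_cone C (Suc i)" "cl + cr = c"
    using c unfolding cl_def cr_def by (simp_all add: pos_cone_restrict restrict_chain_partition)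
  have supp: "supp cl \<subseteq> ?D" "supp cr \<inter> ?D = {}"
    by (auto simp: cl_def cr_def supp_restrict_chain)
  have ul: "upper N i (column (Suc i) cl)" and ur: "upper N i (column (Suc i) cr)"
    using cc assms(3) by (simp_all add: upper_column)
  have sum: "x m = column (Suc i) cl m + (?a + column (Suc i) cr) m" if "i < m" for m
  proof (cases "m = Suc i")
    case True
    then show ?thesis using xm[OF that] cc(3)[symmetric] by (simp add: prod_eq_iff algebra_simps)
  next
    case False
    then show ?thesis using xm[OF that] by simp
  qed
  have posQ: "d \<notin> below N b i"
    if "0 < coeff (bd C (Suc i) (fst ((?a + column (Suc i) cr) (Suc i)))) d" for d
  proof -
    have "0 < coeff (bd C (Suc i) (fst (?a (Suc i)))) d \<or> 0 < coeff (bd C (Suc i) cr) d"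
      using that by (simp add: bd_add lookup_add) linarith
    then show ?thesis
      using atom_bd_positive[OF b, of i d] restrict_bd_positive[OF cc(2) supp(2), of d] assms(3) by auto
  qed
  obtain l w where lw: "l \<in> table_cell C N" "w \<in> table_cell C N" "table_tgt i l = table_src i w"
      "x = table_comp i l w" "\<And>m. i < m \<Longrightarrow> l m = column (Suc i) cl m"
      "\<And>m. i < m \<Longrightarrow> w m = (?a + column (Suc i) cr) m"
  proof (rule split_cell_lower_set[OF reduced_cell[OF x] _ ul upper_add[OF a ur] sum, of "below N b i"])
    fix d assume "coeff (bd C (Suc i) (fst (column (Suc i) cl (Suc i)))) d < 0"
    then show "d \<in> below N b i"
      using restrict_bd_negative[OF cc(1) supp(1), of d] by simp
  qed (use posQ assms(3) that in auto)
  obtain y r where yr: "y \<in> table_cell C N" "r \<in> table_cell C N" "table_tgt i y = table_src i r"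
      "w = table_comp i y r" "\<And>m. i < m \<Longrightarrow> y m = ?a m"
      "\<And>m. i < m \<Longrightarrow> r m = column (Suc i) cr m"
  proof (rule split_cell_lower_set[OF lw(2) _ a ur, of "below N b i"])
    fix m assume "i < m"
    then show "w m = ?a m + column (Suc i) cr m" by (simp add: lw(6))
  next
    fix d assume "0 < coeff (bd C (Suc i) (fst (column (Suc i) cr (Suc i)))) d"
    then show "d \<notin> below N b i"
      using restrict_bd_positive[OF cc(2) supp(2), of d] by simp
  qed (use atom_bd_negative[OF b] assms(3) that in auto)
  have "canonical N i b x l y r"
    unfolding canonical_def
  proof (intro conjI)
    show "l \<in> table_cell C (Suc i)" "r \<in> table_cell C (Suc i)"
      by (rule column_cell[OF lw(1) lw(5)], assumption) (rule column_cell[OF yr(2) yr(6)])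
    show "reduced N i b y" using yr by (simp add: reduced_def)
    show "supp (fst (l (Suc i))) \<subseteq> ?D" "supp (fst (r (Suc i))) \<inter> ?D = {}"
      using lw(5) yr(6) supp by simp_all
    show "table_tgt i l = table_src i y"
      using lw(3) yr(3,4) by (simp add: table_src_comp)
    show "x = table_comp i (table_comp i l y) r"
      using lw(4) yr(4) by (simp add: table_assoc)
  qed (fact yr(3))
  then show ?thesis by blast
qed

lemma restrict_chain_eq:
  assumes "a + c = a' + c'" "supp a \<subseteq> D" "supp a' \<subseteq> D" "supp c \<inter> D = {}" "supp c' \<inter> D = {}"
  shows "a = a' \<and> c = c'"
proof -
  have "coeff a x = coeff a' x" for x
  proof (cases "x \<in> D")
    case True
    then have "coeff c x = 0" "coeff c' x = 0"
      using assms(4,5) by (auto simp: in_keys_iff)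
    then show ?thesis
      using arg_cong[OF assms(1), of "\<lambda>c. coeff c x"] by (simp add: lookup_add)
  next
    case False
    then show ?thesis
      using assms(2,3) by (metis in_keys_iff subsetD)
  qed
  then have "a = a'" by (rule poly_mapping_eqI)
  with assms(1) show ?thesis by simp
qed

text \<open>In column \<open>i + 1\<close> the atom cancels, and the two support conditions separate
  the contributions of \<open>l\<close> and \<open>r\<close>. Then
  \<open>table_factor_unique\<close> applies to both compositions.\<close>

lemma canonical_unique:
  assumes "canonical N i b x l y r" "canonical N i b x l' y' r'" "Suc i < N"
  shows "l = l' \<and> y = y' \<and> r = r'"
proof -
  note c = assms(1)[unfolded canonical_def] and c' = assms(2)[unfolded canonical_def]
  have up: "l \<in> table_cell C N" "r \<in> table_cell C N" "l' \<in> table_cell C N" "r' \<in> table_cell C N"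
      "y \<in> table_cell C N" "y' \<in> table_cell C N"
    using c c' assms(3) by (auto intro: table_cell_mono[of "Suc i"] reduced_cell)
  have w: "table_comp i l y \<in> table_cell C N" "table_comp i l' y' \<in> table_cell C N"
    using c c' up by (auto intro: table_comp_cell)
  have t: "table_tgt i (table_comp i l y) = table_src i r" "table_tgt i (table_comp i l' y') = table_src i r'"
    using c c' by (simp_all add: table_tgt_comp)
  have y: "y m = y' m" if "i < m" for m
    using c c' that by (simp add: reduced_def)
  have ty: "table_tgt i l = table_src i y" "table_tgt i l' = table_src i y'"
    using c c' by simp_all
  have "l (Suc i) + y (Suc i) + r (Suc i) = l' (Suc i) + y' (Suc i) + r' (Suc i)"
  proof -
    have "table_comp i (table_comp i l y) r (Suc i) = table_comp i (table_comp i l' y') r' (Suc i)"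
      using c c' by simp
    then show ?thesis
      by (simp add: table_comp_columns(4)[OF t(1)] table_comp_columns(4)[OF t(2)]
          table_comp_columns(4)[OF ty(1)] table_comp_columns(4)[OF ty(2)])
  qed
  then have "fst (l (Suc i)) + fst (r (Suc i)) = fst (l' (Suc i)) + fst (r' (Suc i))"
    using y[of "Suc i"] by (simp add: prod_eq_iff algebra_simps)
  then have "fst (l (Suc i)) = fst (l' (Suc i)) \<and> fst (r (Suc i)) = fst (r' (Suc i))"
    using c c' by (intro restrict_chain_eq[of _ _ _ _ "below N b (Suc i)"]) auto
  then have lr: "l m = l' m" "r m = r' m" if "i < m" for m
    using c c' cell_column[of l i m] cell_column[of l' i m] cell_column[of r i m] cell_column[of r' i m] that
    by simp_all
  have "table_comp i l y = table_comp i l' y' \<and> r = r'"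
    using c c' up w t lr by (intro table_factor_unique[of _ C N _ _ _ i]) auto
  moreover have "l = l' \<and> y = y'"
    using c c' up lr calculation by (intro table_factor_unique[of _ C N _ _ _ i]) auto
  ultimately show ?thesis by blast
qed

text \<open>Serves to normalise a composite of whiskers: the first factor may stay to the left of
  \<open>b\<close>, the second belongs on its right.\<close>

lemma split_below:
  assumes v: "v \<in> table_cell C (Suc i)"
  obtains v1 v2 where "v1 \<in> table_cell C (Suc i)" "v2 \<in> table_cell C (Suc i)"
    "table_tgt i v1 = table_src i v2" "v = table_comp i v1 v2"
    "supp (fst (v1 (Suc i))) \<subseteq> below N b (Suc i)" "supp (fst (v2 (Suc i))) \<inter> below N b (Suc i) = {}"
proof -
  let ?D = "below N b (Suc i)" and ?c = "fst (v (Suc i))"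
  define cl cr where "cl = restrict_chain ?D ?c" and "cr = restrict_chain (- ?D) ?c"
  have cc: "cl \<in> pos_cone C (Suc i)" "cr \<in> pos_cone C (Suc i)" "cl + cr = ?c"
    using table_cell_pos_cone[OF v, of "Suc i"] unfolding cl_def cr_def
    by (simp_all add: pos_cone_restrict restrict_chain_partition)
  have supp: "supp cl \<subseteq> ?D" "supp cr \<inter> ?D = {}"
    by (auto simp: cl_def cr_def supp_restrict_chain)
  have ul: "upper (Suc i) i (column (Suc i) cl)" and ur: "upper (Suc i) i (column (Suc i) cr)"
    using cc by (simp_all add: upper_column)
  show ?thesis
  proof (rule split_cell_lower_set[OF v _ ul ur, of "below N b i"])
    fix m assume "i < m"
    then show "v m = column (Suc i) cl m + column (Suc i) cr m"
      using cell_column[OF v] cc(3)[symmetric] by (cases "m = Suc i") simp_all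
  next
    fix d assume "coeff (bd C (Suc i) (fst (column (Suc i) cl (Suc i)))) d < 0"
    then show "d \<in> below N b i"
      using restrict_bd_negative[OF cc(1) supp(1), of d] by simp
  next
    fix d assume "0 < coeff (bd C (Suc i) (fst (column (Suc i) cr (Suc i)))) d"
    then show "d \<notin> below N b i"
      using restrict_bd_positive[OF cc(2) supp(2), of d] by simp
  next
    fix v1 v2
    assume *: "v1 \<in> table_cell C (Suc i)" "v2 \<in> table_cell C (Suc i)" "table_tgt i v1 = table_src i v2"
      "v = table_comp i v1 v2" "\<And>m. i < m \<Longrightarrow> v1 m = column (Suc i) cl m"
      "\<And>m. i < m \<Longrightarrow> v2 m = column (Suc i) cr m"
    show thesis
      by (rule that[OF *(1-4)]) (simp_all add: *(5,6) supp)
  qed simp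
qed

text \<open>The atom consumes only elements of the lower set of \<open>b\<close>, and
  \<open>v\<close> produces none of these; so the same cell also splits with the atom first.\<close>

lemma swap_past_reduced_right:
  assumes b: "b \<in> elts C N" and "Suc i < N" and v: "v \<in> table_cell C (Suc i)"
    and "supp (fst (v (Suc i))) \<inter> below N b (Suc i) = {}"
    and x: "reduced N i b x" and t: "table_tgt i v = table_src i x"
  obtains x' v' where "reduced N i b x'" "v' \<in> table_cell C (Suc i)" "v' (Suc i) = v (Suc i)"
    "table_tgt i x' = table_src i v'" "table_comp i v x = table_comp i x' v'"
proof -
  let ?c = "fst (v (Suc i))"
  have c: "?c \<in> pos_cone C (Suc i)" using table_cell_pos_cone[OF v] by simp
  have z: "table_comp i v x \<in> table_cell C N"
    using table_cell_mono[OF _ v, of N] assms(2) reduced_cell[OF x] t by (intro table_comp_cell) auto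
  have u: "upper N i (column (Suc i) ?c)"
    using c assms(2) by (simp add: upper_column)
  show ?thesis
  proof (rule split_cell_lower_set[OF z _ upper_cell[OF atom_cell[OF b]] u, of "below N b i"])
    fix m assume "i < m"
    then show "table_comp i v x m = atom C N b m + column (Suc i) ?c m"
      using x t cell_column[OF v, of m] by (simp add: table_comp_columns reduced_def add.commute)
  next
    fix d assume "0 < coeff (bd C (Suc i) (fst (column (Suc i) ?c (Suc i)))) d"
    then show "d \<notin> below N b i"
      using restrict_bd_positive[OF c assms(4), of d] by simp
  next
    fix x' v'
    assume *: "x' \<in> table_cell C N" "v' \<in> table_cell C N" "table_tgt i x' = table_src i v'"
      "table_comp i v x = table_comp i x' v'" "\<And>m. i < m \<Longrightarrow> x' m = atom C N b m"
      "\<And>m. i < m \<Longrightarrow> v' m = column (Suc i) ?c m"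
    show thesis
    proof (rule that[OF _ _ _ *(3,4)])
      show "reduced N i b x'" using * by (simp add: reduced_def)
      show "v' \<in> table_cell C (Suc i)" by (rule column_cell[OF *(2,6)])
      show "v' (Suc i) = v (Suc i)" using *(6)[of "Suc i"] table_cell_top[OF v] by (simp add: prod_eq_iff)
    qed
  qed (use atom_bd_negative[OF b] assms(2) in auto)
qed

lemma swap_past_reduced_left:
  assumes b: "b \<in> elts C N" and "Suc i < N" and v: "v \<in> table_cell C (Suc i)"
    and "supp (fst (v (Suc i))) \<subseteq> below N b (Suc i)"
    and x: "reduced N i b x" and t: "table_tgt i x = table_src i v"
  obtains x' v' where "reduced N i b x'" "v' \<in> table_cell C (Suc i)" "v' (Suc i) = v (Suc i)"
    "table_tgt i v' = table_src i x'" "table_comp i x v = table_comp i v' x'"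
proof -
  let ?c = "fst (v (Suc i))"
  have c: "?c \<in> pos_cone C (Suc i)" using table_cell_pos_cone[OF v] by simp
  have z: "table_comp i x v \<in> table_cell C N"
    using table_cell_mono[OF _ v, of N] assms(2) reduced_cell[OF x] t by (intro table_comp_cell) auto
  have u: "upper N i (column (Suc i) ?c)"
    using c assms(2) by (simp add: upper_column)
  show ?thesis
  proof (rule split_cell_lower_set[OF z _ u upper_cell[OF atom_cell[OF b]], of "below N b i"])
    fix m assume "i < m"
    then show "table_comp i x v m = column (Suc i) ?c m + atom C N b m"
      using x t cell_column[OF v, of m] by (simp add: table_comp_columns reduced_def add.commute)
  next
    fix d assume "coeff (bd C (Suc i) (fst (column (Suc i) ?c (Suc i)))) d < 0"
    then show "d \<in> below N b i"
      using restrict_bd_negative[OF c assms(4), of d] by simp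
  next
    fix v' x'
    assume *: "v' \<in> table_cell C N" "x' \<in> table_cell C N" "table_tgt i v' = table_src i x'"
      "table_comp i x v = table_comp i v' x'" "\<And>m. i < m \<Longrightarrow> v' m = column (Suc i) ?c m"
      "\<And>m. i < m \<Longrightarrow> x' m = atom C N b m"
    show thesis
    proof (rule that[OF _ _ _ *(3,4)])
      show "reduced N i b x'" using * by (simp add: reduced_def)
      show "v' \<in> table_cell C (Suc i)" by (rule column_cell[OF *(1,5)])
      show "v' (Suc i) = v (Suc i)" using *(5)[of "Suc i"] table_cell_top[OF v] by (simp add: prod_eq_iff)
    qed
  qed (use atom_bd_positive[OF b] assms(2) in auto)
qed

end

section \<open>Extending a functor along the top elements\<close>

text \<open>\<open>exchange_left\<close> factors the same table along \<open>i\<close>, with the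
  columns of \<open>q\<close> above \<open>i\<close> in the first factor, so
  \<open>table_factor_unique\<close> identifies it with the given factorisation.\<close>

lemma table_factor_side_by_side_right:
  assumes "k < i" "i < N" and pq: "p \<in> table_cell C N" "q \<in> table_cell C N" "table_tgt k p = table_src k q"
    and xy: "x \<in> table_cell C N" "y \<in> table_cell C N" "table_tgt i x = table_src i y"
    and eq: "table_comp i x y = table_comp k p q"
    and col: "\<And>m. i < m \<Longrightarrow> x m = q m"
  shows "x = table_comp k (table_src i p) q \<and> y = table_comp k p (table_tgt i q)"
proof -
  interpret A: one_sorted N "table_cell C N" table_src table_tgt table_comp
    by (rule one_sorted_omega_of)
  have k: "k < N" using assms by simp
  have c: "table_tgt k (table_src i p) = table_src k q" "table_tgt k p = table_src k (table_tgt i q)"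
    using assms k by (simp_all add: A.T_S A.S_T)
  have cells: "table_comp k (table_src i p) q \<in> table_cell C N" "table_comp k p (table_tgt i q) \<in> table_cell C N"
    using A.comp_closed[OF k _ _ c(1)] A.comp_closed[OF k _ _ c(2)] assms
    by (auto simp: A.S_closed A.T_closed)
  have t: "table_tgt i (table_comp k (table_src i p) q) = table_src i (table_comp k p (table_tgt i q))"
    using assms k c by (simp add: A.T_comp_ne A.S_comp_ne A.S_closed A.T_closed A.T_S A.S_T)
  have "(table_comp k (table_src i p) q) m = q m" if "i < m" for m
    using that assms(1) c by (simp add: table_comp_columns) (simp add: table_src_def zero_prod_def[symmetric])
  then have "\<forall>m>i. x m = (table_comp k (table_src i p) q) m"
    using col by simp
  then show ?thesis
    using A.exchange_left[OF assms(1,2) pq] eq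
    by (intro table_factor_unique[OF xy(1,2) cells xy(3) t]) auto
qed

lemma table_factor_side_by_side_left:
  assumes "k < i" "i < N" and pq: "p \<in> table_cell C N" "q \<in> table_cell C N" "table_tgt k p = table_src k q"
    and xy: "x \<in> table_cell C N" "y \<in> table_cell C N" "table_tgt i x = table_src i y"
    and eq: "table_comp i x y = table_comp k p q"
    and col: "\<And>m. i < m \<Longrightarrow> x m = p m"
  shows "x = table_comp k p (table_src i q) \<and> y = table_comp k (table_tgt i p) q"
proof -
  interpret A: one_sorted N "table_cell C N" table_src table_tgt table_comp
    by (rule one_sorted_omega_of)
  have k: "k < N" using assms by simp
  have c: "table_tgt k p = table_src k (table_src i q)" "table_tgt k (table_tgt i p) = table_src k q"
    using assms k by (simp_all add: A.S_S A.T_T)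
  have cells: "table_comp k p (table_src i q) \<in> table_cell C N" "table_comp k (table_tgt i p) q \<in> table_cell C N"
    using A.comp_closed[OF k _ _ c(1)] A.comp_closed[OF k _ _ c(2)] assms
    by (auto simp: A.S_closed A.T_closed)
  have t: "table_tgt i (table_comp k p (table_src i q)) = table_src i (table_comp k (table_tgt i p) q)"
    using assms k c by (simp add: A.T_comp_ne A.S_comp_ne A.S_closed A.T_closed A.T_S A.S_T)
  have "(table_comp k p (table_src i q)) m = p m" if "i < m" for m
    using that assms(1) c by (simp add: table_comp_columns) (simp add: table_src_def zero_prod_def[symmetric])
  then have "\<forall>m>i. x m = (table_comp k p (table_src i q)) m"
    using col by simp
  then show ?thesis
    using A.exchange_right[OF assms(1,2) pq] eq
    by (intro table_factor_unique[OF xy(1,2) cells xy(3) t]) auto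
qed

text \<open>The problem in the single dimension \<open>n + 1\<close>: \<open>F\<close> is the given
  functor on \<open>n\<close>-cells regarded as identity \<open>(n + 1)\<close>-cells. Nothing is
  lost, because the cells of the skeleton in higher dimensions are iterated identities.\<close>

locale extension_problem = parity_complex C + X: one_sorted "Suc n" M S T comp
  for C :: "'a parity_data" and n :: nat and M :: "'c set" and S T :: "nat \<Rightarrow> 'c \<Rightarrow> 'c"
    and comp :: "nat \<Rightarrow> 'c \<Rightarrow> 'c \<Rightarrow> 'c" +
  fixes F :: "'a table \<Rightarrow> 'c" and G :: "'a \<Rightarrow> 'c"
  assumes F_closed: "x \<in> table_cell C n \<Longrightarrow> F x \<in> M"
    and F_src: "x \<in> table_cell C n \<Longrightarrow> k \<le> n \<Longrightarrow> F (table_src k x) = S k (F x)"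
    and F_tgt: "x \<in> table_cell C n \<Longrightarrow> k \<le> n \<Longrightarrow> F (table_tgt k x) = T k (F x)"
    and F_comp: "x \<in> table_cell C n \<Longrightarrow> y \<in> table_cell C n \<Longrightarrow> k \<le> n \<Longrightarrow> table_tgt k x = table_src k y \<Longrightarrow>
          F (table_comp k x y) = comp k (F x) (F y)"
    and G_closed: "b \<in> elts C (Suc n) \<Longrightarrow> G b \<in> M"
    and G_src: "b \<in> elts C (Suc n) \<Longrightarrow> S n (G b) = F (table_src n (atom C (Suc n) b))"
    and G_tgt: "b \<in> elts C (Suc n) \<Longrightarrow> T n (G b) = F (table_tgt n (atom C (Suc n) b))"
begin

sublocale A: one_sorted "Suc n" "table_cell C (Suc n)" table_src table_tgt table_comp
  by (rule one_sorted_omega_of)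

abbreviation K :: "nat \<Rightarrow> 'a table set" where "K \<equiv> table_cell C"

section \<open>Values with prescribed sources and targets\<close>

lemma cell_up: "x \<in> K i \<Longrightarrow> i \<le> Suc n \<Longrightarrow> x \<in> K (Suc n)"
  by (rule table_cell_mono)

lemma src_n: "x \<in> K j \<Longrightarrow> k \<le> n \<Longrightarrow> table_src k x \<in> K n"
  by (rule table_cell_mono[OF _ table_src_cell])

lemma tgt_n: "x \<in> K j \<Longrightarrow> k \<le> n \<Longrightarrow> table_tgt k x \<in> K n"
  by (rule table_cell_mono[OF _ table_tgt_cell])

text \<open>The invariant that makes composites of values defined: when tables match along
  \<open>k\<close>, so do the values over them (\<open>lies_over_match\<close>).\<close>

definition lies_over :: "'c \<Rightarrow> 'a table \<Rightarrow> bool" where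
  "lies_over \<xi> x \<longleftrightarrow> x \<in> K (Suc n) \<and> \<xi> \<in> M \<and>
     (\<forall>k\<le>n. S k \<xi> = F (table_src k x) \<and> T k \<xi> = F (table_tgt k x))"

lemma lies_overD:
  assumes "lies_over \<xi> x"
  shows "x \<in> K (Suc n)" "\<xi> \<in> M" "k \<le> n \<Longrightarrow> S k \<xi> = F (table_src k x)" "k \<le> n \<Longrightarrow> T k \<xi> = F (table_tgt k x)"
  using assms by (auto simp: lies_over_def)

lemma lies_over_F: "v \<in> K n \<Longrightarrow> lies_over (F v) v"
  by (simp add: lies_over_def F_closed F_src F_tgt cell_up)

lemma lies_over_match:
  "lies_over \<xi> x \<Longrightarrow> lies_over \<eta> y \<Longrightarrow> k \<le> n \<Longrightarrow> table_tgt k x = table_src k y \<Longrightarrow> T k \<xi> = S k \<eta>"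
  by (simp add: lies_over_def)

lemma lies_over_comp:
  assumes x: "lies_over \<xi> x" and y: "lies_over \<eta> y" and k: "k \<le> n" and t: "table_tgt k x = table_src k y"
  shows "lies_over (comp k \<xi> \<eta>) (table_comp k x y)"
proof -
  note X = lies_overD[OF x] and Y = lies_overD[OF y]
  have m: "T k \<xi> = S k \<eta>" by (rule lies_over_match[OF x y k t])
  have "S j (comp k \<xi> \<eta>) = F (table_src j (table_comp k x y)) \<and>
      T j (comp k \<xi> \<eta>) = F (table_tgt j (table_comp k x y))" if "j \<le> n" for j
  proof (cases "j = k")
    case True
    then show ?thesis
      using X Y m t k by (simp add: X.S_comp X.T_comp A.S_comp A.T_comp)
  next
    case False
    have cS: "table_tgt k (table_src j x) = table_src k (table_src j y)"
      and cT: "table_tgt k (table_tgt j x) = table_src k (table_tgt j y)"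
      using A.composable_S[of j k x y] A.composable_T[of j k x y] False that k X(1) Y(1) t by auto
    have "S j (comp k \<xi> \<eta>) = comp k (F (table_src j x)) (F (table_src j y))"
      using False that k X Y m by (simp add: X.S_comp_ne)
    also have "\<dots> = F (table_comp k (table_src j x) (table_src j y))"
      using F_comp[OF src_n src_n k cS] X(1) Y(1) that by simp
    finally have 1: "S j (comp k \<xi> \<eta>) = F (table_src j (table_comp k x y))"
      using False that k X(1) Y(1) t by (simp add: A.S_comp_ne)
    have "T j (comp k \<xi> \<eta>) = comp k (F (table_tgt j x)) (F (table_tgt j y))"
      using False that k X Y m by (simp add: X.T_comp_ne)
    also have "\<dots> = F (table_comp k (table_tgt j x) (table_tgt j y))"
      using F_comp[OF tgt_n tgt_n k cT] X(1) Y(1) that by simp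
    finally have "T j (comp k \<xi> \<eta>) = F (table_tgt j (table_comp k x y))"
      using False that k X(1) Y(1) t by (simp add: A.T_comp_ne)
    with 1 show ?thesis by simp
  qed
  then show ?thesis
    using X Y m t k by (simp add: lies_over_def A.comp_closed X.comp_closed)
qed

text \<open>Only the degree \<open>n\<close> is prescribed; lower sources and targets factor through
  the \<open>n\<close>-source.\<close>

lemma lies_over_G:
  assumes b: "b \<in> elts C (Suc n)"
  shows "lies_over (G b) (atom C (Suc n) b)"
proof -
  let ?a = "atom C (Suc n) b"
  note a = atom_cell[OF b] and g = G_closed[OF b]
  have "S k (G b) = F (table_src k ?a) \<and> T k (G b) = F (table_tgt k ?a)" if "k \<le> n" for k
  proof (cases "k = n")
    case False
    with that have "k < n" by simp
    then have "S k (G b) = S k (S n (G b))" "T k (G b) = T k (S n (G b))"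
      using g by (simp_all add: X.S_S X.T_S min_def)
    then show ?thesis
      using \<open>k < n\<close> a F_src[OF src_n[OF a], of n k] F_tgt[OF src_n[OF a], of n k]
      by (simp add: G_src[OF b] A.S_S A.T_S min_def)
  qed (simp add: G_src G_tgt b)
  then show ?thesis
    using a g by (simp add: lies_over_def)
qed

lemma exchange_values:
  assumes p: "lies_over \<phi> p" and q: "lies_over \<psi> q" and "k < i" "i \<le> n" and t: "table_tgt k p = table_src k q"
  shows "comp i (comp k (F (table_src i p)) \<psi>) (comp k \<phi> (F (table_tgt i q))) = comp k \<phi> \<psi>"
    and "comp i (comp k \<phi> (F (table_src i q))) (comp k (F (table_tgt i p)) \<psi>) = comp k \<phi> \<psi>"
  using X.exchange_left[of k i \<phi> \<psi>] X.exchange_right[of k i \<phi> \<psi>] lies_overD[OF p] lies_overD[OF q]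
    lies_over_match[OF p q _ t] assms(3,4) by simp_all

text \<open>The forced value on a cell reduced to stage \<open>i\<close>. At stage 0 the cell can
  only be the atom, so \<open>x\<close> is ignored; at later stages the choice is determined by
  \<open>canonical_unique\<close>.\<close>

primrec can :: "nat \<Rightarrow> 'a \<Rightarrow> 'a table \<Rightarrow> 'c" where
  "can 0 b x = G b"
| "can (Suc i) b x = (case SOME (l, y, r). canonical (Suc n) i b x l y r of
     (l, y, r) \<Rightarrow> comp i (comp i (F l) (can i b y)) (F r))"

lemma can_Suc:
  assumes "canonical (Suc n) i b x l y r" "i < n"
  shows "can (Suc i) b x = comp i (comp i (F l) (can i b y)) (F r)"
proof -
  define t where "t = (SOME (l, y, r). canonical (Suc n) i b x l y r)"
  obtain l' y' r' where t: "t = (l', y', r')"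
    by (cases t) auto
  have "case t of (l, y, r) \<Rightarrow> canonical (Suc n) i b x l y r"
    unfolding t_def by (rule someI[of _ "(l, y, r)"]) (simp add: assms(1))
  then have "canonical (Suc n) i b x l' y' r'"
    unfolding t by simp
  from canonical_unique[OF this assms(1)] assms(2) have "t = (l, y, r)"
    by (simp add: t)
  then show ?thesis unfolding t_def by simp
qed

lemma canonicalE:
  assumes "b \<in> elts C (Suc n)" "i < n" "reduced (Suc n) (Suc i) b x"
  obtains l y r where "canonical (Suc n) i b x l y r"
    "l \<in> K (Suc i)" "r \<in> K (Suc i)" "l \<in> K n" "r \<in> K n" "reduced (Suc n) i b y"
    "table_tgt i l = table_src i y" "table_tgt i y = table_src i r"
    "x = table_comp i (table_comp i l y) r"
    "supp (fst (l (Suc i))) \<subseteq> below (Suc n) b (Suc i)" "supp (fst (r (Suc i))) \<inter> below (Suc n) b (Suc i) = {}"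
    "can (Suc i) b x = comp i (comp i (F l) (can i b y)) (F r)"
proof -
  obtain l y r where c: "canonical (Suc n) i b x l y r"
    using canonical_exists[OF assms(1,3)] assms(2) by auto
  note c' = c[unfolded canonical_def]
  show ?thesis
    by (rule that[OF c]) (use c' table_cell_mono[of "Suc i" n] assms(2) can_Suc[OF c] in auto)
qed

lemma lies_over_can:
  "b \<in> elts C (Suc n) \<Longrightarrow> i \<le> n \<Longrightarrow> reduced (Suc n) i b x \<Longrightarrow> lies_over (can i b x) x"
proof (induction i arbitrary: x)
  case 0
  then show ?case using reduced_0[of b n x] lies_over_G by simp
next
  case (Suc i)
  then have "i < n" by simp
  obtain l y r where c: "canonical (Suc n) i b x l y r"
    "l \<in> K (Suc i)" "r \<in> K (Suc i)" "l \<in> K n" "r \<in> K n" "reduced (Suc n) i b y"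
    "table_tgt i l = table_src i y" "table_tgt i y = table_src i r"
    "x = table_comp i (table_comp i l y) r"
    "can (Suc i) b x = comp i (comp i (F l) (can i b y)) (F r)"
    using canonicalE[OF Suc.prems(1) \<open>i < n\<close> Suc.prems(3)] by metis
  have "lies_over (comp i (F l) (can i b y)) (table_comp i l y)"
    using c Suc by (intro lies_over_comp lies_over_F) auto
  then show ?case
    unfolding c(10) using c(3,5,7,8,9) \<open>i < n\<close>
    by (auto intro!: lies_over_comp lies_over_F simp: table_tgt_comp)
qed

text \<open>The canonical whiskers of a cell that is already reduced are the identities on its
  source and target, so passing to a later stage does not change the value.\<close>

lemma can_of_reduced:
  assumes "b \<in> elts C (Suc n)" "i < n" "reduced (Suc n) i b x"
  shows "can (Suc i) b x = can i b x"
proof -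
  note x = reduced_cell[OF assms(3)]
  have i: "i < Suc n" using assms(2) by simp
  have "canonical (Suc n) i b x (table_src i x) x (table_tgt i x)"
    unfolding canonical_def
  proof (intro conjI)
    show "table_src i x \<in> K (Suc i)" "table_tgt i x \<in> K (Suc i)"
      using table_cell_mono[OF _ table_src_cell[OF x], of i "Suc i"]
        table_cell_mono[OF _ table_tgt_cell[OF x], of i "Suc i"] by simp_all
    show "supp (fst (table_src i x (Suc i))) \<subseteq> below (Suc n) b (Suc i)"
      "supp (fst (table_tgt i x (Suc i))) \<inter> below (Suc n) b (Suc i) = {}"
      by (simp_all add: table_src_def table_tgt_def)
    show "table_tgt i (table_src i x) = table_src i x" "table_tgt i x = table_src i (table_tgt i x)"
      using A.T_S[OF i i x] A.S_T[OF i i x] by simp_all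
    show "x = table_comp i (table_comp i (table_src i x) x) (table_tgt i x)"
      by (simp only: A.unit_left[OF i x] A.unit_right[OF i x])
  qed fact
  note can = can_Suc[OF this assms(2)]
  have lo: "lies_over (can i b x) x"
    using lies_over_can[OF assms(1) _ assms(3)] assms(2) by simp
  have ST: "F (table_src i x) = S i (can i b x)" "F (table_tgt i x) = T i (can i b x)"
    using lies_overD(3,4)[OF lo, of i] assms(2) by simp_all
  show ?thesis
    unfolding can ST by (simp only: X.unit_left[OF i lies_overD(2)[OF lo]] X.unit_right[OF i lies_overD(2)[OF lo]])
qed

lemma can_atom: "b \<in> elts C (Suc n) \<Longrightarrow> i \<le> n \<Longrightarrow> can i b (atom C (Suc n) b) = G b"
proof (induction i)
  case (Suc i)
  then show ?case
    using can_of_reduced[of b i "atom C (Suc n) b"] reduced_atom[of b "Suc n" i] by simp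
qed simp

text \<open>The statement carried by the induction: \<open>whiskers i\<close> justifies moving
  whiskers past the atom in degree \<open>i\<close>, and these moves yield
  \<open>whiskers (Suc i)\<close>.\<close>

definition whiskers :: "nat \<Rightarrow> bool" where
  "whiskers i \<longleftrightarrow> (\<forall>b\<in>elts C (Suc n). \<forall>x v k. reduced (Suc n) i b x \<and> v \<in> K i \<and> k < i \<longrightarrow>
     (table_tgt k x = table_src k v \<longrightarrow> can i b (table_comp k x v) = comp k (can i b x) (F v)) \<and>
     (table_tgt k v = table_src k x \<longrightarrow> can i b (table_comp k v x) = comp k (F v) (can i b x)))"

lemma whiskersD:
  assumes "whiskers i" "b \<in> elts C (Suc n)" "reduced (Suc n) i b x" "v \<in> K i" "k < i"
  shows "table_tgt k x = table_src k v \<Longrightarrow> can i b (table_comp k x v) = comp k (can i b x) (F v)"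
    and "table_tgt k v = table_src k x \<Longrightarrow> can i b (table_comp k v x) = comp k (F v) (can i b x)"
  using assms unfolding whiskers_def by blast+

section \<open>Moving a whisker past the atom\<close>

lemma identity_cell:
  assumes "v \<in> K (Suc i)" "fst (v (Suc i)) = 0"
  shows "table_src i v = v" "table_tgt i v = v"
proof -
  have "v m = 0" if "i < m" for m
    using cell_column[OF assms(1) that] assms(2) by (cases "m = Suc i") (simp_all add: prod_eq_iff)
  then have "v \<in> K i"
    using assms(1) by (rule table_cell_lower[rotated])
  then show "table_src i v = v" "table_tgt i v = v"
    by (simp_all add: table_src_id table_tgt_id)
qed

text \<open>Otherwise the entries of column 0 of the atom would agree, but they come from disjoint
  nonempty sets.\<close>

lemma atom_column_1_nonzero:
  assumes "b \<in> elts C (Suc n)"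
  shows "fst (atom C (Suc n) b (Suc 0)) \<noteq> 0"
proof
  let ?a = "atom C (Suc n) b"
  assume "fst (?a (Suc 0)) = 0"
  then have "snd (?a 0) = fst (?a 0)"
    using table_cell_bd(1)[OF atom_cell[OF assms], of 0] by simp
  then have "pi_set C (Suc n) b 0 = mu_set C (Suc n) b 0"
    using finite_mu_set[OF assms, of 0] finite_pi_set[OF assms, of 0]
    by (metis atom_def fst_conv snd_conv le0 supp_set_chain)
  moreover have "mu_set C (Suc n) b 0 \<noteq> {}"
    using aug_mu[OF assms] by (auto simp: set_chain_def)
  ultimately show False
    using mu_pi_disjoint[OF assms, of 0] by auto
qed

text \<open>The atom already uses the only element available in degree 0, so a whisker that can be
  moved past it there is an identity.\<close>

lemma no_swap_with_reduced_0:
  assumes b: "b \<in> elts C (Suc n)" and y: "reduced (Suc n) 0 b y" "reduced (Suc n) 0 b y'"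
    and v: "v \<in> K (Suc 0)"
    and z: "z \<in> K (Suc n)" "fst (z 0) = fst (v 0)" "fst (z 0) = fst (y' 0)" "z (Suc 0) = y (Suc 0) + v (Suc 0)"
      "0 < n"
  shows "fst (v (Suc 0)) = 0"
proof -
  let ?a = "fst (atom C (Suc n) b (Suc 0))" and ?c = "fst (v (Suc 0))"
  note y' = reduced_cell[OF y(2)]
  have a: "fst (y' (Suc 0)) = ?a" "fst (y (Suc 0)) = ?a"
    using y by (simp_all add: reduced_def)
  have "?a = 0 \<or> ?c = 0"
  proof (rule no_swap_in_degree_0)
    show "?a \<in> pos_cone C (Suc 0)" "?c \<in> pos_cone C (Suc 0)"
      using table_cell_pos_cone[OF atom_cell[OF b]] table_cell_pos_cone[OF v] by auto
    show "nonneg (fst (z 0))" "aug (fst (z 0)) = 1"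
      using table_cell_pos_cone[OF z(1), of 0] table_cell_aug[OF z(1)] by (auto simp: in_pos_cone)
    show "nonneg (fst (z 0) + bd C (Suc 0) ?a)"
      using table_cell_bd(1)[OF y', of 0] table_cell_pos_cone[OF y', of 0] z(3) a by (simp add: in_pos_cone)
    show "nonneg (fst (z 0) + bd C (Suc 0) ?c)"
      using table_cell_bd(1)[OF v, of 0] table_cell_pos_cone[OF v, of 0] z(2) by (simp add: in_pos_cone)
    show "nonneg (fst (z 0) + (bd C (Suc 0) ?a + bd C (Suc 0) ?c))"
      using cell_snd_eq[where P = y and Q = v, OF z(1,4)] table_cell_pos_cone[OF z(1), of 0] a
      by (simp add: in_pos_cone)
  qed
  then show ?thesis
    using atom_column_1_nonzero[OF b] by blast
qed

lemma table_comp_fst: "table_tgt k x = table_src k y \<Longrightarrow> fst (table_comp k x y k) = fst (x k)"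
  by (simp add: table_comp_columns)

lemma nonneg_first_factor:
  "x \<in> K j \<Longrightarrow> nonneg (fst (x k) + bd C (Suc k) (fst (x (Suc k))))"
  using table_cell_bd(1)[of x C j k] table_cell_pos_cone[of x C j k] by (simp add: in_pos_cone)

text \<open>For \<open>i = Suc k\<close>, \<open>separate_cell\<close> puts an atom part
  \<open>p\<close> and a whisker \<open>q\<close> side by side along \<open>k\<close>. The two given
  factorisations along \<open>i\<close> are its two exchanges, and \<open>whiskers i\<close>
  evaluates \<open>can i\<close> on each, since \<open>k < i\<close>.\<close>

lemma swap_value_right:
  assumes W: "whiskers i" and b: "b \<in> elts C (Suc n)" and "i < n"
    and y: "reduced (Suc n) i b y" "reduced (Suc n) i b y'" and v: "v \<in> K (Suc i)" "v' \<in> K (Suc i)"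
    and D: "supp (fst (v (Suc i))) \<inter> below (Suc n) b (Suc i) = {}"
    and t: "table_tgt i v = table_src i y" "table_tgt i y' = table_src i v'"
    and eq: "table_comp i v y = table_comp i y' v'"
  shows "comp i (F v) (can i b y) = comp i (can i b y') (F v')"
proof -
  let ?z = "table_comp i v y" and ?c = "fst (v (Suc i))"
  note yN = reduced_cell[OF y(1)] reduced_cell[OF y(2)]
  have vN: "v \<in> K (Suc n)" "v' \<in> K (Suc n)" and vn: "v \<in> K n" "v' \<in> K n"
    using v \<open>i < n\<close> by (auto intro: table_cell_mono[of "Suc i"])
  have z: "?z \<in> K (Suc n)"
    using vN yN t by (intro table_comp_cell) auto
  have zm: "?z m = v m + y m" "?z m = y' m + v' m" if "i < m" for m
    using that table_comp_columns(4)[OF t(1)] table_comp_columns(4)[OF t(2)] eq by metis+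
  have yy: "y m = y' m" if "i < m" for m
    using y that by (simp add: reduced_def)
  have vv: "v m = v' m" if "i < m" for m
    using zm[OF that] yy[OF that] by (simp add: add.commute)
  have lo: "lies_over (can i b y) y" "lies_over (can i b y') y'"
    using lies_over_can[OF b _ y(1)] lies_over_can[OF b _ y(2)] \<open>i < n\<close> by auto
  show ?thesis
  proof (cases i)
    case 0
    have "fst (v (Suc 0)) = 0"
    proof (rule no_swap_with_reduced_0[OF b])
      show "reduced (Suc n) 0 b y" "reduced (Suc n) 0 b y'" "v \<in> K (Suc 0)" "0 < n" "?z \<in> K (Suc n)"
        using y v 0 \<open>i < n\<close> z by auto
      show "fst (?z 0) = fst (v 0)"
        using table_comp_fst[OF t(1)] 0 by simp
      show "fst (?z 0) = fst (y' 0)"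
        using table_comp_fst[OF t(2)] 0 eq by simp
      show "?z (Suc 0) = y (Suc 0) + v (Suc 0)"
        using zm(1)[of "Suc 0"] 0 by (simp add: add.commute)
    qed
    then have v0: "table_src i v = v" "table_tgt i v = v" "table_src i v' = v'" "table_tgt i v' = v'"
      using identity_cell[OF v(1)] identity_cell[OF v(2)] vv[of "Suc i"] 0 by auto
    have "?z = y" "table_comp i y' v' = y'"
      using A.unit_left[of i y] A.unit_right[of i y'] yN t v0 \<open>i < n\<close> by auto
    with eq have "y = y'" by simp
    then show ?thesis
      using X.unit_left[of i "can i b y"] X.unit_right[of i "can i b y"] lies_overD[OF lo(1)] t v0 \<open>i < n\<close>
      by simp
  next
    case (Suc k)
    have k: "k < i" "Suc k < Suc n" "k \<le> n" using Suc \<open>i < n\<close> by auto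
    have c: "?c \<in> pos_cone C (Suc i)"
      using table_cell_pos_cone[OF v(1)] by simp
    obtain p q where pq: "p \<in> K (Suc n)" "q \<in> K (Suc n)" "table_tgt k p = table_src k q"
      "?z = table_comp k p q" "\<And>m. Suc k < m \<Longrightarrow> p m = atom C (Suc n) b m"
      "\<And>m. Suc k < m \<Longrightarrow> q m = column (Suc i) ?c m"
    proof (rule separate_cell[OF z k(2) upper_cell[OF atom_cell[OF b]] _ _ lower_set_below[of "Suc n" b]])
      show "upper (Suc n) (Suc k) (column (Suc i) ?c)"
        using upper_column[OF c] Suc \<open>i < n\<close> by simp
    next
      fix m assume "Suc k < m"
      then show "?z m = atom C (Suc n) b m + column (Suc i) ?c m"
        using zm[of m] cell_column[OF v(1), of m] y(1) Suc by (simp add: reduced_def add.commute)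
    next
      fix d assume "coeff (bd C (Suc (Suc k)) (fst (atom C (Suc n) b (Suc (Suc k))))) d < 0"
      then show "d \<in> below (Suc n) b (Suc k)"
        using atom_bd_negative[OF b k(2)] by simp
    next
      fix d assume "0 < coeff (bd C (Suc (Suc k)) (fst (column (Suc i) ?c (Suc (Suc k))))) d"
      then show "d \<notin> below (Suc n) b (Suc k)"
        using restrict_bd_positive[OF c D] Suc by simp
    next
      \<comment> \<open>Since \<open>v\<close> comes first in \<open>?z\<close>, the chain reached
        after it is \<open>snd (v i)\<close>.\<close>
      show "nonneg (fst (?z (Suc k)) + bd C (Suc (Suc k)) (fst (column (Suc i) ?c (Suc (Suc k)))))"
        using nonneg_first_factor[OF v(1), of i] table_comp_fst[OF t(1)] Suc by simp
    qed (rule that)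
    have p: "reduced (Suc n) i b p"
      using pq(1,5) Suc by (simp add: reduced_def)
    have q: "q \<in> K (Suc i)"
      using column_cell[OF pq(2), of i ?c] pq(6) Suc by simp
    then have qn: "q \<in> K n" using \<open>i < n\<close> by (auto intro: table_cell_mono[of "Suc i"])
    have qv: "q m = v m" if "i < m" for m
      using pq(6) that Suc cell_column[OF v(1) that] by simp
    have "v = table_comp k (table_src i p) q \<and> y = table_comp k p (table_tgt i q)"
      using qv pq \<open>i < n\<close> vN yN t
      by (intro table_factor_side_by_side_right[OF k(1) _ pq(1-3), of v y]) auto
    then have vy: "v = table_comp k (table_src i p) q" "y = table_comp k p (table_tgt i q)" by auto
    have "y' = table_comp k p (table_src i q) \<and> v' = table_comp k (table_tgt i p) q"
      using y(2) p pq eq \<open>i < n\<close> vN yN t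
      by (intro table_factor_side_by_side_left[OF k(1) _ pq(1-3), of y' v']) (auto simp: reduced_def)
    then have vy': "y' = table_comp k p (table_src i q)" "v' = table_comp k (table_tgt i p) q" by auto
    have tk: "table_tgt k (table_src i p) = table_src k q" "table_tgt k p = table_src k (table_tgt i q)"
      "table_tgt k p = table_src k (table_src i q)" "table_tgt k (table_tgt i p) = table_src k q"
      using pq(1-3) k \<open>i < n\<close> by (simp_all add: A.T_S A.S_T A.S_S A.T_T)
    have "F v = comp k (F (table_src i p)) (F q)" "F v' = comp k (F (table_tgt i p)) (F q)"
      unfolding vy vy' using F_comp[OF src_n[OF pq(1)] qn k(3) tk(1)] F_comp[OF tgt_n[OF pq(1)] qn k(3) tk(4)]
        \<open>i < n\<close> by simp_all
    moreover have "can i b y = comp k (can i b p) (F (table_tgt i q))"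
      unfolding vy by (rule whiskersD(1)[OF W b p table_tgt_cell[OF q] k(1) tk(2)])
    moreover have "can i b y' = comp k (can i b p) (F (table_src i q))"
      unfolding vy' by (rule whiskersD(1)[OF W b p table_src_cell[OF q] k(1) tk(3)])
    ultimately show ?thesis
      using exchange_values[OF lies_over_can[OF b _ p] lies_over_F[OF qn] k(1) _ pq(3)] \<open>i < n\<close>
      by simp
  qed
qed

lemma swap_value_left:
  assumes W: "whiskers i" and b: "b \<in> elts C (Suc n)" and "i < n"
    and y: "reduced (Suc n) i b y" "reduced (Suc n) i b y'" and v: "v \<in> K (Suc i)" "v' \<in> K (Suc i)"
    and D: "supp (fst (v (Suc i))) \<subseteq> below (Suc n) b (Suc i)"
    and t: "table_tgt i y = table_src i v" "table_tgt i v' = table_src i y'"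
    and eq: "table_comp i y v = table_comp i v' y'"
  shows "comp i (can i b y) (F v) = comp i (F v') (can i b y')"
proof -
  let ?z = "table_comp i y v" and ?c = "fst (v (Suc i))"
  note yN = reduced_cell[OF y(1)] reduced_cell[OF y(2)]
  have vN: "v \<in> K (Suc n)" "v' \<in> K (Suc n)" and vn: "v \<in> K n" "v' \<in> K n"
    using v \<open>i < n\<close> by (auto intro: table_cell_mono[of "Suc i"])
  have z: "?z \<in> K (Suc n)"
    using vN yN t by (intro table_comp_cell) auto
  have zm: "?z m = y m + v m" "?z m = v' m + y' m" if "i < m" for m
    using that table_comp_columns(4)[OF t(1)] table_comp_columns(4)[OF t(2)] eq by metis+
  have yy: "y m = y' m" if "i < m" for m
    using y that by (simp add: reduced_def)
  have vv: "v m = v' m" if "i < m" for m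
    using zm[OF that] yy[OF that] by (simp add: add.commute)
  have lo: "lies_over (can i b y) y" "lies_over (can i b y') y'"
    using lies_over_can[OF b _ y(1)] lies_over_can[OF b _ y(2)] \<open>i < n\<close> by auto
  show ?thesis
  proof (cases i)
    case 0
    have "fst (v' (Suc 0)) = 0"
    proof (rule no_swap_with_reduced_0[OF b])
      show "reduced (Suc n) 0 b y'" "reduced (Suc n) 0 b y" "v' \<in> K (Suc 0)" "0 < n" "?z \<in> K (Suc n)"
        using y v 0 \<open>i < n\<close> z by auto
      show "fst (?z 0) = fst (v' 0)"
        using table_comp_fst[OF t(2)] 0 eq by simp
      show "fst (?z 0) = fst (y 0)"
        using table_comp_fst[OF t(1)] 0 by simp
      show "?z (Suc 0) = y' (Suc 0) + v' (Suc 0)"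
        using zm(2)[of "Suc 0"] 0 by (simp add: add.commute)
    qed
    then have v0: "table_src i v = v" "table_tgt i v = v" "table_src i v' = v'" "table_tgt i v' = v'"
      using identity_cell[OF v(1)] identity_cell[OF v(2)] vv[of "Suc i"] 0 by auto
    have "?z = y" "table_comp i v' y' = y'"
      using A.unit_left[of i y'] A.unit_right[of i y] yN t v0 \<open>i < n\<close> by auto
    with eq have "y = y'" by simp
    then show ?thesis
      using X.unit_left[of i "can i b y"] X.unit_right[of i "can i b y"] lies_overD[OF lo(1)] t v0 \<open>i < n\<close>
      by simp
  next
    case (Suc k)
    have k: "k < i" "Suc k < Suc n" "k \<le> n" using Suc \<open>i < n\<close> by auto
    have c: "?c \<in> pos_cone C (Suc i)"
      using table_cell_pos_cone[OF v(1)] by simp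
    obtain q p where pq: "q \<in> K (Suc n)" "p \<in> K (Suc n)" "table_tgt k q = table_src k p"
      "?z = table_comp k q p" "\<And>m. Suc k < m \<Longrightarrow> q m = column (Suc i) ?c m"
      "\<And>m. Suc k < m \<Longrightarrow> p m = atom C (Suc n) b m"
    proof (rule separate_cell[OF z k(2) _ upper_cell[OF atom_cell[OF b]] _ lower_set_below[of "Suc n" b]])
      show "upper (Suc n) (Suc k) (column (Suc i) ?c)"
        using upper_column[OF c] Suc \<open>i < n\<close> by simp
    next
      fix m assume "Suc k < m"
      then show "?z m = column (Suc i) ?c m + atom C (Suc n) b m"
        using zm[of m] cell_column[OF v(1), of m] y(1) Suc by (simp add: reduced_def add.commute)
    next
      fix d assume "0 < coeff (bd C (Suc (Suc k)) (fst (atom C (Suc n) b (Suc (Suc k))))) d"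
      then show "d \<notin> below (Suc n) b (Suc k)"
        using atom_bd_positive[OF b k(2)] by simp
    next
      fix d assume "coeff (bd C (Suc (Suc k)) (fst (column (Suc i) ?c (Suc (Suc k))))) d < 0"
      then show "d \<in> below (Suc n) b (Suc k)"
        using restrict_bd_negative[OF c D] Suc by simp
    next
      show "nonneg (fst (?z (Suc k)) + bd C (Suc (Suc k)) (fst (atom C (Suc n) b (Suc (Suc k)))))"
        using nonneg_first_factor[OF yN(1), of i] table_comp_fst[OF t(1)] y(1) Suc
        by (simp add: reduced_def)
    qed (rule that)
    have p: "reduced (Suc n) i b p"
      using pq(2,6) Suc by (simp add: reduced_def)
    have q: "q \<in> K (Suc i)"
      using column_cell[OF pq(1), of i ?c] pq(5) Suc by simp
    then have qn: "q \<in> K n" using \<open>i < n\<close> by (auto intro: table_cell_mono[of "Suc i"])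
    have qv: "q m = v m" if "i < m" for m
      using pq(5) that Suc cell_column[OF v(1) that] by simp
    have "y = table_comp k (table_src i q) p \<and> v = table_comp k q (table_tgt i p)"
      using y(1) p pq \<open>i < n\<close> vN yN t
      by (intro table_factor_side_by_side_right[OF k(1) _ pq(1-3), of y v]) (auto simp: reduced_def)
    then have vy: "y = table_comp k (table_src i q) p" "v = table_comp k q (table_tgt i p)" by auto
    have "v' = table_comp k q (table_src i p) \<and> y' = table_comp k (table_tgt i q) p"
      using qv vv pq eq \<open>i < n\<close> vN yN t
      by (intro table_factor_side_by_side_left[OF k(1) _ pq(1-3), of v' y']) auto
    then have vy': "v' = table_comp k q (table_src i p)" "y' = table_comp k (table_tgt i q) p" by auto
    have tk: "table_tgt k (table_src i q) = table_src k p" "table_tgt k q = table_src k (table_tgt i p)"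
      "table_tgt k q = table_src k (table_src i p)" "table_tgt k (table_tgt i q) = table_src k p"
      using pq(1-3) k \<open>i < n\<close> by (simp_all add: A.T_S A.S_T A.S_S A.T_T)
    have "F v = comp k (F q) (F (table_tgt i p))" "F v' = comp k (F q) (F (table_src i p))"
      unfolding vy vy' using F_comp[OF qn tgt_n[OF pq(2)] k(3) tk(2)] F_comp[OF qn src_n[OF pq(2)] k(3) tk(3)]
        \<open>i < n\<close> by simp_all
    moreover have "can i b y = comp k (F (table_src i q)) (can i b p)"
      unfolding vy by (rule whiskersD(2)[OF W b p table_src_cell[OF q] k(1) tk(1)])
    moreover have "can i b y' = comp k (F (table_tgt i q)) (can i b p)"
      unfolding vy' by (rule whiskersD(2)[OF W b p table_tgt_cell[OF q] k(1) tk(4)])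
    ultimately show ?thesis
      using exchange_values[OF lies_over_F[OF qn] lies_over_can[OF b _ p] k(1) _ pq(3)] \<open>i < n\<close>
      by simp
  qed
qed

section \<open>From moves in one degree to whiskering in the next\<close>

declare can.simps(2) [simp del]

lemma lies_over_assoc:
  assumes "lies_over \<xi> x" "lies_over \<eta> y" "lies_over \<zeta> z" "k \<le> n"
    "table_tgt k x = table_src k y" "table_tgt k y = table_src k z"
  shows "comp k (comp k \<xi> \<eta>) \<zeta> = comp k \<xi> (comp k \<eta> \<zeta>)"
  using assms by (intro X.assoc) (auto intro: lies_over_match lies_overD(2))

text \<open>The composite of \<open>v\<close> and \<open>l\<close> may contain elements not below
  \<open>b\<close>, so it is no longer a canonical left whisker. Split it into \<open>w1\<close> and
  \<open>w2\<close>, move \<open>w2\<close> past \<open>y\<close>, and absorb it into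
  \<open>r\<close>; the values follow along by \<open>swap_value_right\<close>.\<close>

lemma whisker_top_left:
  assumes W: "whiskers i" and b: "b \<in> elts C (Suc n)" and "i < n"
    and x: "reduced (Suc n) (Suc i) b x" and v: "v \<in> K (Suc i)" and t: "table_tgt i v = table_src i x"
  shows "can (Suc i) b (table_comp i v x) = comp i (F v) (can (Suc i) b x)"
proof -
  let ?D = "below (Suc n) b (Suc i)"
  obtain l y r where c: "l \<in> K (Suc i)" "r \<in> K (Suc i)" "l \<in> K n" "r \<in> K n" "reduced (Suc n) i b y"
    "table_tgt i l = table_src i y" "table_tgt i y = table_src i r"
    "x = table_comp i (table_comp i l y) r" "supp (fst (r (Suc i))) \<inter> ?D = {}"
    "can (Suc i) b x = comp i (comp i (F l) (can i b y)) (F r)"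
    using canonicalE[OF b \<open>i < n\<close> x] by metis
  have i: "i \<le> n" "Suc i < Suc n" using \<open>i < n\<close> by auto
  have vl: "table_tgt i v = table_src i l"
    using t c(6,7) unfolding c(8) by (simp add: table_src_comp table_tgt_comp)
  define w where "w = table_comp i v l"
  have w: "w \<in> K (Suc i)" "table_tgt i w = table_src i y"
    using table_comp_cell[OF v c(1) vl] c(6) by (simp_all add: w_def table_tgt_comp vl)
  obtain w1 w2 where ww: "w1 \<in> K (Suc i)" "w2 \<in> K (Suc i)" "table_tgt i w1 = table_src i w2"
    "w = table_comp i w1 w2" "supp (fst (w1 (Suc i))) \<subseteq> ?D" "supp (fst (w2 (Suc i))) \<inter> ?D = {}"
    using split_below[OF w(1)] by metis
  have w2y: "table_tgt i w2 = table_src i y"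
    using w(2) ww(3,4) by (simp add: table_tgt_comp)
  obtain y' w2' where y': "reduced (Suc n) i b y'" "w2' \<in> K (Suc i)" "w2' (Suc i) = w2 (Suc i)"
    "table_tgt i y' = table_src i w2'" "table_comp i w2 y = table_comp i y' w2'"
    using swap_past_reduced_right[OF b i(2) ww(2,6) c(5) w2y] by metis
  have w1y': "table_tgt i w1 = table_src i y'"
    using ww(3) arg_cong[OF y'(5), of "table_src i"] by (simp add: table_src_comp w2y y'(4))
  have w2r: "table_tgt i w2' = table_src i r"
    using c(7) arg_cong[OF y'(5), of "table_tgt i"] by (simp add: table_tgt_comp w2y y'(4))
  define r' where "r' = table_comp i w2' r"
  have r': "r' \<in> K (Suc i)" "table_src i r' = table_src i w2'" "r' (Suc i) = w2 (Suc i) + r (Suc i)"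
    using table_comp_cell[OF y'(2) c(2) w2r] by (simp_all add: r'_def table_src_comp w2r table_comp_columns(4)[OF w2r] y'(3))
  have supp_r': "supp (fst (r' (Suc i))) \<inter> ?D = {}"
  proof -
    have "supp (fst (w2 (Suc i)) + fst (r (Suc i))) \<subseteq> - ?D"
      using ww(6) c(9) by (intro supp_add_subset) auto
    then show ?thesis by (auto simp: r'(3))
  qed
  have "table_comp i v x = table_comp i (table_comp i w y) r"
    by (simp add: c(8) w_def table_assoc)
  also have "\<dots> = table_comp i (table_comp i w1 (table_comp i w2 y)) r"
    by (simp add: ww(4) table_assoc)
  also have "\<dots> = table_comp i (table_comp i w1 y') r'"
    by (simp add: y'(5) r'_def table_assoc)
  finally have "canonical (Suc n) i b (table_comp i v x) w1 y' r'"
    unfolding canonical_def using ww y' r' w1y' supp_r' by simp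
  from can_Suc[OF this \<open>i < n\<close>]
  have can: "can (Suc i) b (table_comp i v x) = comp i (comp i (F w1) (can i b y')) (F r')" .
  have n: "v \<in> K n" "w1 \<in> K n" "w2 \<in> K n" "w2' \<in> K n"
    using v ww y' \<open>i < n\<close> by (auto intro: table_cell_mono[of "Suc i"])
  note lo = lies_over_can[OF b i(1) c(5)] lies_over_can[OF b i(1) y'(1)]
    n[THEN lies_over_F] c(3,4)[THEN lies_over_F]
  have swap: "comp i (F w2) (can i b y) = comp i (can i b y') (F w2')"
    by (rule swap_value_right[OF W b \<open>i < n\<close> c(5) y'(1) ww(2) y'(2) ww(6) w2y y'(4,5)])
  have Fw: "comp i (F v) (F l) = comp i (F w1) (F w2)"
    using F_comp[OF n(1) c(3) i(1) vl] F_comp[OF n(2,3) i(1) ww(3)] ww(4) by (simp add: w_def)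
  have "comp i (F v) (can (Suc i) b x) = comp i (comp i (comp i (F v) (F l)) (can i b y)) (F r)"
    using lies_over_assoc[OF lo(3,7,1) i(1) vl c(6)]
      lies_over_assoc[OF lo(3) lies_over_comp[OF lo(7,1) i(1) c(6)] lo(8) i(1)] vl c(6,7)
    by (simp add: c(10) table_src_comp table_tgt_comp)
  also have "\<dots> = comp i (comp i (comp i (F w1) (can i b y')) (F w2')) (F r)"
    unfolding Fw lies_over_assoc[OF lo(4,5,1) i(1) ww(3) w2y] swap
      lies_over_assoc[OF lo(4,2,6) i(1) w1y' y'(4)] ..
  also have "\<dots> = comp i (comp i (F w1) (can i b y')) (F r')"
    using lies_over_assoc[OF lies_over_comp[OF lo(4,2) i(1) w1y'] lo(6,8) i(1)] w1y' y'(4) w2r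
      F_comp[OF n(4) c(4) i(1) w2r]
    by (simp add: r'_def table_tgt_comp)
  finally show ?thesis
    by (simp add: can)
qed

lemma whisker_top_right:
  assumes W: "whiskers i" and b: "b \<in> elts C (Suc n)" and "i < n"
    and x: "reduced (Suc n) (Suc i) b x" and v: "v \<in> K (Suc i)" and t: "table_tgt i x = table_src i v"
  shows "can (Suc i) b (table_comp i x v) = comp i (can (Suc i) b x) (F v)"
proof -
  let ?D = "below (Suc n) b (Suc i)"
  obtain l y r where c: "l \<in> K (Suc i)" "r \<in> K (Suc i)" "l \<in> K n" "r \<in> K n" "reduced (Suc n) i b y"
    "table_tgt i l = table_src i y" "table_tgt i y = table_src i r"
    "x = table_comp i (table_comp i l y) r" "supp (fst (l (Suc i))) \<subseteq> ?D"
    "can (Suc i) b x = comp i (comp i (F l) (can i b y)) (F r)"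
    using canonicalE[OF b \<open>i < n\<close> x] by metis
  have i: "i \<le> n" "Suc i < Suc n" using \<open>i < n\<close> by auto
  have rv: "table_tgt i r = table_src i v"
    using t c(6,7) unfolding c(8) by (simp add: table_src_comp table_tgt_comp)
  define w where "w = table_comp i r v"
  have w: "w \<in> K (Suc i)" "table_tgt i y = table_src i w"
    using table_comp_cell[OF c(2) v rv] c(7) by (simp_all add: w_def table_src_comp rv)
  obtain w1 w2 where ww: "w1 \<in> K (Suc i)" "w2 \<in> K (Suc i)" "table_tgt i w1 = table_src i w2"
    "w = table_comp i w1 w2" "supp (fst (w1 (Suc i))) \<subseteq> ?D" "supp (fst (w2 (Suc i))) \<inter> ?D = {}"
    using split_below[OF w(1)] by metis
  have yw1: "table_tgt i y = table_src i w1"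
    using w(2) ww(3,4) by (simp add: table_src_comp)
  obtain y' w1' where y': "reduced (Suc n) i b y'" "w1' \<in> K (Suc i)" "w1' (Suc i) = w1 (Suc i)"
    "table_tgt i w1' = table_src i y'" "table_comp i y w1 = table_comp i w1' y'"
    using swap_past_reduced_left[OF b i(2) ww(1,5) c(5) yw1] by metis
  have y'w2: "table_tgt i y' = table_src i w2"
    using ww(3) arg_cong[OF y'(5), of "table_tgt i"] by (simp add: table_tgt_comp yw1 y'(4))
  have lw1: "table_tgt i l = table_src i w1'"
    using c(6) arg_cong[OF y'(5), of "table_src i"] by (simp add: table_src_comp yw1 y'(4))
  define l' where "l' = table_comp i l w1'"
  have l': "l' \<in> K (Suc i)" "table_tgt i l' = table_tgt i w1'" "l' (Suc i) = l (Suc i) + w1 (Suc i)"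
    using table_comp_cell[OF c(1) y'(2) lw1] by (simp_all add: l'_def table_tgt_comp lw1 table_comp_columns(4)[OF lw1] y'(3))
  have supp_l': "supp (fst (l' (Suc i))) \<subseteq> ?D"
    using supp_add_subset[OF c(9) ww(5)] by (simp add: l'(3))
  have "table_comp i x v = table_comp i (table_comp i l y) w"
    by (simp add: c(8) w_def table_assoc)
  also have "\<dots> = table_comp i (table_comp i l (table_comp i y w1)) w2"
    by (simp add: ww(4) table_assoc)
  also have "\<dots> = table_comp i (table_comp i l' y') w2"
    by (simp add: y'(5) l'_def table_assoc)
  finally have "canonical (Suc n) i b (table_comp i x v) l' y' w2"
    unfolding canonical_def using ww y' l' y'w2 supp_l' by simp
  from can_Suc[OF this \<open>i < n\<close>]
  have can: "can (Suc i) b (table_comp i x v) = comp i (comp i (F l') (can i b y')) (F w2)" .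
  have n: "v \<in> K n" "w1 \<in> K n" "w2 \<in> K n" "w1' \<in> K n"
    using v ww y' \<open>i < n\<close> by (auto intro: table_cell_mono[of "Suc i"])
  note lo = lies_over_can[OF b i(1) c(5)] lies_over_can[OF b i(1) y'(1)]
    n[THEN lies_over_F] c(3,4)[THEN lies_over_F]
  have swap: "comp i (can i b y) (F w1) = comp i (F w1') (can i b y')"
    by (rule swap_value_left[OF W b \<open>i < n\<close> c(5) y'(1) ww(1) y'(2) ww(5) yw1 y'(4,5)])
  have Fw: "comp i (F r) (F v) = comp i (F w1) (F w2)"
    using F_comp[OF c(4) n(1) i(1) rv] F_comp[OF n(2,3) i(1) ww(3)] ww(4) by (simp add: w_def)
  have ly: "lies_over (comp i (F l) (can i b y)) (table_comp i l y)"
    "table_tgt i (table_comp i l y) = table_tgt i y"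
    by (rule lies_over_comp[OF lo(7,1) i(1) c(6)]) (simp add: table_tgt_comp c(6))
  have "comp i (can (Suc i) b x) (F v) = comp i (comp i (F l) (can i b y)) (comp i (F w1) (F w2))"
    using lies_over_assoc[OF ly(1) lo(8,3) i(1)] ly(2) c(7) rv by (simp add: c(10) Fw)
  also have "\<dots> = comp i (comp i (comp i (F l) (can i b y)) (F w1)) (F w2)"
    using lies_over_assoc[OF ly(1) lo(4,5) i(1)] ly(2) yw1 ww(3) by simp
  also have "\<dots> = comp i (comp i (comp i (F l) (F w1')) (can i b y')) (F w2)"
    unfolding lies_over_assoc[OF lo(7,1,4) i(1) c(6) yw1] swap
      lies_over_assoc[OF lo(7,6,2) i(1) lw1 y'(4)] ..
  also have "\<dots> = comp i (comp i (F l') (can i b y')) (F w2)"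
    using F_comp[OF c(3) n(4) i(1) lw1] by (simp add: l'_def)
  finally show ?thesis
    by (simp add: can)
qed

text \<open>For \<open>k = i\<close> this is \<open>whisker_top_left\<close> and
  \<open>whisker_top_right\<close>. For \<open>k < i\<close> and an \<open>i\<close>-cell
  \<open>v\<close>, distribute \<open>v\<close> over the canonical splitting. For
  \<open>k < i\<close> and an \<open>(i + 1)\<close>-cell, an exchange reduces to these two
  cases.\<close>

lemma whiskers_Suc:
  assumes W: "whiskers i" and "i < n"
  shows "whiskers (Suc i)"
  unfolding whiskers_def
proof (intro ballI allI impI, elim conjE)
  fix b x v k
  assume b: "b \<in> elts C (Suc n)" and x: "reduced (Suc n) (Suc i) b x" and v: "v \<in> K (Suc i)" and "k < Suc i"
  have i: "i \<le> n" "i < Suc n" "i \<le> Suc n" using \<open>i < n\<close> by auto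
  note xN = reduced_cell[OF x]
  have lx: "lies_over (can (Suc i) b x) x"
    using lies_over_can[OF b _ x] \<open>i < n\<close> by simp
  \<comment> \<open>An \<open>i\<close>-cell is a unit along \<open>i\<close>, so it distributes
    over \<open>l\<close>, \<open>y\<close> and \<open>r\<close>. The whiskered splitting is
    evaluated by the case \<open>k = i\<close>, and its middle factor by
    \<open>whiskers i\<close>.\<close>
  have low: "(table_tgt k x = table_src k v \<longrightarrow> can (Suc i) b (table_comp k x v) = comp k (can (Suc i) b x) (F v)) \<and>
     (table_tgt k v = table_src k x \<longrightarrow> can (Suc i) b (table_comp k v x) = comp k (F v) (can (Suc i) b x))"
    if "k < i" and v: "v \<in> K i" for v
  proof -
    have k: "k \<le> n" "k < Suc n" using that(1) \<open>i < n\<close> by auto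
    obtain l y r where c: "l \<in> K (Suc i)" "r \<in> K (Suc i)" "l \<in> K n" "r \<in> K n" "reduced (Suc n) i b y"
      "table_tgt i l = table_src i y" "table_tgt i y = table_src i r"
      "x = table_comp i (table_comp i l y) r"
      "can (Suc i) b x = comp i (comp i (F l) (can i b y)) (F r)"
      using canonicalE[OF b \<open>i < n\<close> x] by metis
    have vi: "v \<in> K (Suc i)" "v \<in> K n" "v \<in> K (Suc n)" "table_src i v = v" "table_tgt i v = v"
      using v \<open>i < n\<close> table_cell_mono[of i _ v] by (auto simp: table_src_id table_tgt_id)
    have N: "l \<in> K (Suc n)" "y \<in> K (Suc n)" "r \<in> K (Suc n)"
      using c(1,2,5) \<open>i < n\<close> by (auto intro: table_cell_mono[of "Suc i"] reduced_cell)
    have lyN: "table_comp i l y \<in> K (Suc n)" "table_tgt i (table_comp i l y) = table_src i r"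
      using A.comp_closed[OF i(2) N(1,2) c(6)] c(6,7) by (auto simp: table_tgt_comp)
    have ends: "table_tgt k l = table_tgt k y" "table_src k l = table_src k y"
      "table_tgt k y = table_tgt k r" "table_src k y = table_src k r"
      using A.T_low_comp[OF that(1) i(2) N(1,2) c(6)] A.T_low_comp[OF that(1) i(2) N(2,3) c(7)] by auto
    have "table_src k x = table_src k y" "table_tgt k x = table_tgt k y"
      using ends A.low_comp[OF that(1) i(2) lyN(1) N(3) lyN(2)] A.low_comp[OF that(1) i(2) N(1,2) c(6)]
      by (simp_all add: c(8))
    note ends = ends this
    note lo = lies_over_can[OF b i(1) c(5)] lies_over_F[OF vi(2)] c(3,4)[THEN lies_over_F]
    have y_red: "reduced (Suc n) (Suc i) b z" if "reduced (Suc n) i b z" for z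
      using that by (rule reduced_mono[rotated]) simp
    have Flv: "S i (F v) = F v" "T i (F v) = F v"
      using F_src[OF vi(2) i(1)] F_tgt[OF vi(2) i(1)] vi(4,5) by simp_all
    note mm = lies_over_match[OF lo(3,1) i(1) c(6)] lies_over_match[OF lo(1,4) i(1) c(7)]
      lies_over_match[OF lies_over_comp[OF lo(3,1) i(1) c(6)] lo(4) i(1) lyN(2)]
    have M: "F l \<in> M" "can i b y \<in> M" "F r \<in> M" "F v \<in> M" "comp i (F l) (can i b y) \<in> M"
      using lo lies_overD(2)[OF lies_over_comp[OF lo(3,1) i(1) c(6)]] by (auto dest: lies_overD(2))
    show ?thesis
    proof (intro conjI impI)
      assume "table_tgt k x = table_src k v"
      then have t: "table_tgt k l = table_src k v" "table_tgt k y = table_src k v" "table_tgt k r = table_src k v"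
        using ends by auto
      let ?l = "table_comp k l v" and ?y = "table_comp k y v" and ?r = "table_comp k r v"
      have lyv: "table_tgt k (table_comp i l y) = table_src k v"
        using A.low_comp(2)[OF that(1) i(2) N(1,2) c(6)] t by simp
      have y': "reduced (Suc n) i b ?y"
        using reduced_whisker(1)[OF c(5) v that(1) i(3) t(2)] .
      have l': "?l \<in> K (Suc i)" "?r \<in> K (Suc i)"
        using table_comp_cell[OF c(1) vi(1) t(1)] table_comp_cell[OF c(2) vi(1) t(3)] .
      have ly': "table_tgt i ?l = table_src i ?y" "table_tgt i ?y = table_src i ?r"
        using that(1) k i N vi c(6,7) t by (simp_all add: A.T_comp_ne A.S_comp_ne)
      have eq: "table_comp k x v = table_comp i (table_comp i ?l ?y) ?r"
        unfolding c(8) A.whisker_comp_right[OF that(1) i(2) lyN(1) N(3) vi(3) lyN(2) lyv vi(4,5)]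
          A.whisker_comp_right[OF that(1) i(2) N(1,2) vi(3) c(6) t(1) vi(4,5)] ..
      have r1: "reduced (Suc n) (Suc i) b (table_comp i ?l ?y)"
        using reduced_whisker(2)[OF y_red[OF y'] l'(1) _ _ ly'(1)] \<open>i < n\<close> by simp
      have "can (Suc i) b (table_comp k x v) = comp i (comp i (F ?l) (can i b ?y)) (F ?r)"
        unfolding eq
        using whisker_top_right[OF W b \<open>i < n\<close> r1 l'(2)] whisker_top_left[OF W b \<open>i < n\<close> y_red[OF y'] l'(1) ly'(1)]
          can_of_reduced[OF b \<open>i < n\<close> y'] ly' by (simp add: table_tgt_comp)
      also have "\<dots> = comp i (comp i (comp k (F l) (F v)) (comp k (can i b y) (F v))) (comp k (F r) (F v))"
        using F_comp[OF c(3) vi(2) k(1) t(1)] F_comp[OF c(4) vi(2) k(1) t(3)]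
          whiskersD(1)[OF W b c(5) v that(1) t(2)] by simp
      also have "\<dots> = comp k (comp i (comp i (F l) (can i b y)) (F r)) (F v)"
        using X.whisker_comp_right[OF that(1) i(2) M(1,2,4) mm(1) lies_over_match[OF lo(3,2) k(1) t(1)] Flv]
          X.whisker_comp_right[OF that(1) i(2) M(5,3,4) mm(3)
            lies_over_match[OF lies_over_comp[OF lo(3,1) i(1) c(6)] lo(2) k(1) lyv] Flv] by simp
      finally show "can (Suc i) b (table_comp k x v) = comp k (can (Suc i) b x) (F v)"
        by (simp add: c(9))
    next
      assume "table_tgt k v = table_src k x"
      then have t: "table_tgt k v = table_src k l" "table_tgt k v = table_src k y" "table_tgt k v = table_src k r"
        using ends by auto
      let ?l = "table_comp k v l" and ?y = "table_comp k v y" and ?r = "table_comp k v r"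
      have lyv: "table_tgt k v = table_src k (table_comp i l y)"
        using A.low_comp(1)[OF that(1) i(2) N(1,2) c(6)] t by simp
      have y': "reduced (Suc n) i b ?y"
        using reduced_whisker(2)[OF c(5) v that(1) i(3) t(2)] .
      have l': "?l \<in> K (Suc i)" "?r \<in> K (Suc i)"
        using table_comp_cell[OF vi(1) c(1) t(1)] table_comp_cell[OF vi(1) c(2) t(3)] .
      have ly': "table_tgt i ?l = table_src i ?y" "table_tgt i ?y = table_src i ?r"
        using that(1) k i N vi c(6,7) t by (simp_all add: A.T_comp_ne A.S_comp_ne)
      have eq: "table_comp k v x = table_comp i (table_comp i ?l ?y) ?r"
        unfolding c(8) A.whisker_comp_left[OF that(1) i(2) lyN(1) N(3) vi(3) lyN(2) lyv vi(4,5)]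
          A.whisker_comp_left[OF that(1) i(2) N(1,2) vi(3) c(6) t(1) vi(4,5)] ..
      have r1: "reduced (Suc n) (Suc i) b (table_comp i ?l ?y)"
        using reduced_whisker(2)[OF y_red[OF y'] l'(1) _ _ ly'(1)] \<open>i < n\<close> by simp
      have "can (Suc i) b (table_comp k v x) = comp i (comp i (F ?l) (can i b ?y)) (F ?r)"
        unfolding eq
        using whisker_top_right[OF W b \<open>i < n\<close> r1 l'(2)] whisker_top_left[OF W b \<open>i < n\<close> y_red[OF y'] l'(1) ly'(1)]
          can_of_reduced[OF b \<open>i < n\<close> y'] ly' by (simp add: table_tgt_comp)
      also have "\<dots> = comp i (comp i (comp k (F v) (F l)) (comp k (F v) (can i b y))) (comp k (F v) (F r))"
        using F_comp[OF vi(2) c(3) k(1) t(1)] F_comp[OF vi(2) c(4) k(1) t(3)]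
          whiskersD(2)[OF W b c(5) v that(1) t(2)] by simp
      also have "\<dots> = comp k (F v) (comp i (comp i (F l) (can i b y)) (F r))"
        using X.whisker_comp_left[OF that(1) i(2) M(1,2,4) mm(1) lies_over_match[OF lo(2,3) k(1) t(1)] Flv]
          X.whisker_comp_left[OF that(1) i(2) M(5,3,4) mm(3)
            lies_over_match[OF lo(2) lies_over_comp[OF lo(3,1) i(1) c(6)] k(1) lyv] Flv] by simp
      finally show "can (Suc i) b (table_comp k v x) = comp k (F v) (can (Suc i) b x)"
        by (simp add: c(9))
    qed
  qed
  have vn: "v \<in> K n" "v \<in> K (Suc n)"
    using v \<open>i < n\<close> by (auto intro: table_cell_mono[of "Suc i"])
  show "(table_tgt k x = table_src k v \<longrightarrow> can (Suc i) b (table_comp k x v) = comp k (can (Suc i) b x) (F v)) \<and>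
     (table_tgt k v = table_src k x \<longrightarrow> can (Suc i) b (table_comp k v x) = comp k (F v) (can (Suc i) b x))"
  proof (cases "k = i")
    case True
    then show ?thesis
      using whisker_top_left[OF W b \<open>i < n\<close> x v] whisker_top_right[OF W b \<open>i < n\<close> x v] by blast
  next
    case False
    with \<open>k < Suc i\<close> have "k < i" by simp
    then have k: "k \<le> n" "k < Suc n" using \<open>i < n\<close> by auto
    have sv: "table_src i v \<in> K i" "table_tgt i v \<in> K i" "table_src i v \<in> K (Suc i)" "table_tgt i v \<in> K (Suc i)"
      using table_src_cell[OF v] table_tgt_cell[OF v] table_cell_mono[of i "Suc i"] by auto
    have sx: "table_src i x \<in> K n" "table_tgt i x \<in> K n" "table_src i x \<in> K (Suc i)" "table_tgt i x \<in> K (Suc i)"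
      using src_n[OF xN i(1)] tgt_n[OF xN i(1)] table_cell_mono[OF _ table_src_cell[OF xN], of i "Suc i"]
        table_cell_mono[OF _ table_tgt_cell[OF xN], of i "Suc i"] by auto
    have svN: "table_src i v \<in> K (Suc n)" "table_tgt i v \<in> K (Suc n)" "table_src i x \<in> K (Suc n)" "table_tgt i x \<in> K (Suc n)"
      using A.S_closed[OF i(2)] A.T_closed[OF i(2)] vn(2) xN by auto
    show ?thesis
    proof (intro conjI impI)
      assume t: "table_tgt k x = table_src k v"
      have t1: "table_tgt k x = table_src k (table_src i v)" "table_tgt k (table_tgt i x) = table_src k v"
        using t \<open>k < i\<close> k i xN vn by (simp_all add: A.S_S A.T_T)
      have r: "reduced (Suc n) (Suc i) b (table_comp k x (table_src i v))"
        using reduced_whisker(1)[OF x sv(3) _ _ t1(1)] \<open>k < i\<close> i by simp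
      have w: "table_comp k (table_tgt i x) v \<in> K (Suc i)"
        by (rule table_comp_cell[OF sx(4) v t1(2)])
      have m: "table_tgt i (table_comp k x (table_src i v)) = table_src i (table_comp k (table_tgt i x) v)"
        using \<open>k < i\<close> k i xN vn t1 svN by (simp add: A.T_comp_ne A.S_comp_ne A.T_S A.S_T)
      have "can (Suc i) b (table_comp k x v) =
          comp i (can (Suc i) b (table_comp k x (table_src i v))) (F (table_comp k (table_tgt i x) v))"
        using whisker_top_right[OF W b \<open>i < n\<close> r w m] A.exchange_right[OF \<open>k < i\<close> i(2) xN vn(2) t] by simp
      also have "\<dots> = comp i (comp k (can (Suc i) b x) (F (table_src i v))) (comp k (F (table_tgt i x)) (F v))"
        using low[OF \<open>k < i\<close> sv(1)] t1(1) F_comp[OF sx(2) vn(1) k(1) t1(2)] by simp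
      also have "\<dots> = comp k (can (Suc i) b x) (F v)"
        by (rule exchange_values(2)[OF lx lies_over_F[OF vn(1)] \<open>k < i\<close> i(1) t])
      finally show "can (Suc i) b (table_comp k x v) = comp k (can (Suc i) b x) (F v)" .
    next
      assume t: "table_tgt k v = table_src k x"
      have t1: "table_tgt k v = table_src k (table_src i x)" "table_tgt k (table_tgt i v) = table_src k x"
        using t \<open>k < i\<close> k i xN vn by (simp_all add: A.S_S A.T_T)
      have r: "reduced (Suc n) (Suc i) b (table_comp k (table_tgt i v) x)"
        using reduced_whisker(2)[OF x sv(4) _ _ t1(2)] \<open>k < i\<close> i by simp
      have w: "table_comp k v (table_src i x) \<in> K (Suc i)"
        by (rule table_comp_cell[OF v sx(3) t1(1)])
      have m: "table_tgt i (table_comp k v (table_src i x)) = table_src i (table_comp k (table_tgt i v) x)"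
        using \<open>k < i\<close> k i xN vn t1 svN by (simp add: A.T_comp_ne A.S_comp_ne A.T_S A.S_T)
      have "can (Suc i) b (table_comp k v x) =
          comp i (F (table_comp k v (table_src i x))) (can (Suc i) b (table_comp k (table_tgt i v) x))"
        using whisker_top_left[OF W b \<open>i < n\<close> r w m] A.exchange_right[OF \<open>k < i\<close> i(2) vn(2) xN t] by simp
      also have "\<dots> = comp i (comp k (F v) (F (table_src i x))) (comp k (F (table_tgt i v)) (can (Suc i) b x))"
        using low[OF \<open>k < i\<close> sv(2)] t1(2) F_comp[OF vn(1) sx(1) k(1) t1(1)] by simp
      also have "\<dots> = comp k (F v) (can (Suc i) b x)"
        by (rule exchange_values(2)[OF lies_over_F[OF vn(1)] lx \<open>k < i\<close> i(1) t])
      finally show "can (Suc i) b (table_comp k v x) = comp k (F v) (can (Suc i) b x)" .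
    qed
  qed
qed

text \<open>The base case is vacuous, as there is no \<open>k < 0\<close>.\<close>

lemma whiskers: "i \<le> n \<Longrightarrow> whiskers i"
  by (induction i) (simp_all add: whiskers_Suc, simp add: whiskers_def)

end


section \<open>Factoring off a top element\<close>

context parity_complex
begin

definition factor :: "nat \<Rightarrow> 'a table \<Rightarrow> 'a \<Rightarrow> 'a table \<Rightarrow> 'a table \<Rightarrow> bool" where
  "factor n x b y z \<longleftrightarrow> b \<in> elts C (Suc n) \<and> y \<in> table_cell C (Suc n) \<and> z \<in> table_cell C (Suc n) \<and>
     table_tgt n y = table_src n z \<and> x = table_comp n y z \<and> fst (y (Suc n)) = frag_of b"

lemma split_top:
  assumes x: "x \<in> table_cell C (Suc n)" and "e \<in> pos_cone C (Suc n)" "fst (x (Suc n)) - e \<in> pos_cone C (Suc n)"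
    and pos: "nonneg (fst (x n) + bd C (Suc n) e)"
  obtains y z where "y \<in> table_cell C (Suc n)" "z \<in> table_cell C (Suc n)" "table_tgt n y = table_src n z"
    "x = table_comp n y z" "fst (y (Suc n)) = e" "fst (z (Suc n)) = fst (x (Suc n)) - e"
proof (rule split_cell[OF x _ upper_column[OF assms(2)] upper_column[OF assms(3)]])
  fix m assume "n < m"
  then show "x m = column (Suc n) e m + column (Suc n) (fst (x (Suc n)) - e) m"
    using table_cell_top[OF x] table_cell_zero[OF x, of m] by (cases "m = Suc n") (auto simp: prod_eq_iff)
next
  fix y z
  assume *: "y \<in> table_cell C (Suc n)" "z \<in> table_cell C (Suc n)" "table_tgt n y = table_src n z"
    "x = table_comp n y z" "\<And>m. n < m \<Longrightarrow> y m = column (Suc n) e m"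
    "\<And>m. n < m \<Longrightarrow> z m = column (Suc n) (fst (x (Suc n)) - e) m"
  show thesis
    by (rule that[OF *(1-4)]) (simp_all add: *(5,6))
qed (use pos in simp_all)

lemma factor_top:
  assumes "factor n x b y z"
  shows "fst (x (Suc n)) = frag_of b + fst (z (Suc n))" "x \<in> table_cell C (Suc n)" "fst (x n) = fst (y n)"
    "nonneg (fst (x n) + bd C (Suc n) (frag_of b))"
    "fst (z n) = fst (x n) + bd C (Suc n) (frag_of b)"
proof -
  note f = assms[unfolded factor_def]
  have t: "table_tgt n y = table_src n z" and y: "y \<in> table_cell C (Suc n)" using f by auto
  show "fst (x (Suc n)) = frag_of b + fst (z (Suc n))"
    using f table_comp_columns(4)[OF t, of "Suc n"] by simp
  show "x \<in> table_cell C (Suc n)"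
    using f by (auto intro: table_comp_cell)
  show x: "fst (x n) = fst (y n)"
    using f table_comp_columns(3)[OF t] by simp
  show "nonneg (fst (x n) + bd C (Suc n) (frag_of b))"
    using table_cell_bd(1)[OF y, of n] table_cell_pos_cone[OF y, of n] f x by (simp add: in_pos_cone)
  show "fst (z n) = fst (x n) + bd C (Suc n) (frag_of b)"
    using table_cell_bd(1)[OF y, of n] table_tgt_eq_srcD(2)[OF t] f x by simp
qed

text \<open>The element \<open>b\<close> prescribes the columns of \<open>y\<close> above
  \<open>n\<close>, so \<open>table_factor_unique\<close> applies.\<close>

lemma factor_unique:
  assumes "factor n x b y z" "factor n x b y' z'"
  shows "y = y' \<and> z = z'"
proof -
  have cells: "y \<in> table_cell C (Suc n)" "y' \<in> table_cell C (Suc n)" "fst (y (Suc n)) = fst (y' (Suc n))"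
    using assms by (auto simp: factor_def)
  have "y m = y' m" if "n < m" for m
    by (simp only: cell_column[OF cells(1) that] cell_column[OF cells(2) that] cells(3))
  then show ?thesis
    using assms unfolding factor_def
    by (intro table_factor_unique[of y C "Suc n" z y' z' n]) auto
qed

text \<open>Not minimality for \<open>prec\<close> itself but the consequence that is used: nothing
  in \<open>c\<close> produces a minus face of \<open>b\<close>. It is provided by
  \<open>minimal_supp\<close>.\<close>

definition minimal_in :: "nat \<Rightarrow> 'a \<Rightarrow> ('a \<Rightarrow>\<^sub>0 int) \<Rightarrow> bool" where
  "minimal_in n b c \<longleftrightarrow> b \<in> supp c \<and>
     (\<forall>y\<in>supp c. minus_face C (Suc n) b \<inter> plus_face C (Suc n) y = {})"

lemma coeff_bd_frag_of:
  assumes "b \<in> elts C (Suc n)"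
  shows "coeff (bd C (Suc n) (frag_of b)) d =
    (if d \<in> plus_face C (Suc n) b then 1 else if d \<in> minus_face C (Suc n) b then - 1 else 0)"
  using disjoint_faces[OF assms] finite_plus[OF assms] finite_minus[OF assms]
  by (auto simp: bd_frag_of lookup_minus coeff_set_chain)

lemma pos_cone_diff_frag:
  assumes "c \<in> pos_cone C m" "b \<in> supp c"
  shows "c - frag_of b \<in> pos_cone C m"
proof -
  have c: "supp c \<subseteq> elts C m" "nonneg c"
    using assms(1) by (auto simp: in_pos_cone)
  have "1 \<le> coeff c b"
    using assms(2) nonneg_coeff[OF c(2), of b] by (simp add: in_keys_iff)
  then have "nonneg (c - frag_of b)"
    using nonneg_coeff[OF c(2)] by (simp add: nonneg_def lookup_minus)
  moreover have "supp (c - frag_of b) \<subseteq> elts C m"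
    using c(1) assms(2) by (intro supp_diff_subset) auto
  ultimately show ?thesis
    by (simp add: in_pos_cone)
qed

lemma minimal_negative:
  assumes "c \<in> pos_cone C (Suc n)" "minimal_in n b c" "d \<in> minus_face C (Suc n) b"
  shows "coeff (bd C (Suc n) c) d < 0"
  using assms by (intro minimal_bd[OF assms(1), of b]) (auto simp: minimal_in_def)

text \<open>Nothing in the top chain produces a minus face \<open>d\<close> of \<open>b\<close>, so
  its coefficient drops strictly from \<open>fst (x n)\<close> to \<open>snd (x n)\<close>. Hence
  \<open>d\<close> is present at the start and can be consumed by \<open>b\<close>.\<close>

lemma minimal_nonneg:
  assumes x: "x \<in> table_cell C (Suc n)" and m: "minimal_in n b (fst (x (Suc n)))"
  shows "nonneg (fst (x n) + bd C (Suc n) (frag_of b))"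
  unfolding nonneg_def
proof
  fix d
  note c = table_cell_pos_cone[OF x, of "Suc n"] table_cell_pos_cone[OF x, of n]
  have b: "b \<in> elts C (Suc n)"
    using m c by (auto simp: minimal_in_def in_pos_cone)
  have nn: "0 \<le> coeff (fst (x n)) d" "0 \<le> coeff (snd (x n)) d"
    using c(2) by (simp_all add: in_pos_cone nonneg_coeff)
  have "coeff (bd C (Suc n) (fst (x (Suc n)))) d = coeff (snd (x n)) d - coeff (fst (x n)) d"
    using table_cell_bd(1)[OF x, of n] by (simp add: lookup_minus)
  then show "0 \<le> coeff (fst (x n) + bd C (Suc n) (frag_of b)) d"
    using nn minimal_negative[OF conjunct1[OF c(1)] m, of d]
    by (cases "d \<in> minus_face C (Suc n) b") (auto simp: lookup_add coeff_bd_frag_of[OF b])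
qed

lemma minimal_exists:
  assumes x: "x \<in> table_cell C (Suc n)" and "fst (x (Suc n)) \<noteq> 0"
  obtains b y z where "minimal_in n b (fst (x (Suc n)))" "factor n x b y z"
proof -
  note c = table_cell_pos_cone[OF x, of "Suc n"]
  obtain b where b: "minimal_in n b (fst (x (Suc n)))"
    using minimal_supp[of "fst (x (Suc n))" n] c assms(2)
    unfolding in_pos_cone minimal_in_def by (metis disjoint_iff)
  then have bs: "b \<in> supp (fst (x (Suc n)))" "b \<in> elts C (Suc n)"
    using c by (auto simp: minimal_in_def in_pos_cone)
  show ?thesis
  proof (rule split_top[OF x pos_cone_frag_of[OF bs(2)] pos_cone_diff_frag[OF _ bs(1)] minimal_nonneg[OF x b]])
    fix y z
    assume "y \<in> table_cell C (Suc n)" "z \<in> table_cell C (Suc n)" "table_tgt n y = table_src n z"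
      "x = table_comp n y z" "fst (y (Suc n)) = frag_of b"
    then have "factor n x b y z" using bs by (simp add: factor_def)
    then show thesis using that b by blast
  qed (use c in simp)
qed

text \<open>Here minimality of \<open>b\<close> matters: a common negative face of \<open>b\<close> and \<open>b'\<close> occurs twice.\<close>

lemma factor_diamond:
  assumes f: "factor n x b y z" and m: "minimal_in n b (fst (x (Suc n)))"
    and f': "factor n x b' y' z'" and "b \<noteq> b'"
  obtains y1 y1' w where "factor n z b' y1' w" "factor n z' b y1 w" "table_tgt n y = table_src n y1'"
    "table_tgt n y' = table_src n y1" "table_comp n y y1' = table_comp n y' y1"
proof -
  let ?c = "fst (x (Suc n))" and ?e = "frag_of b + frag_of b'"
  have x: "x \<in> table_cell C (Suc n)" by (rule factor_top(2)[OF f])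
  note c = table_cell_pos_cone[OF x, of "Suc n"] table_cell_pos_cone[OF x, of n]
  have b: "b \<in> elts C (Suc n)" "b' \<in> elts C (Suc n)"
    using f f' by (auto simp: factor_def)
  have e: "?e \<in> pos_cone C (Suc n)"
    using b by (simp add: pos_cone_add pos_cone_frag_of)
  have z: "z \<in> table_cell C (Suc n)" "z' \<in> table_cell C (Suc n)"
    using f f' by (auto simp: factor_def)
  have "1 \<le> coeff ?c b'"
    using nonneg_coeff[of "fst (z' (Suc n))" b'] table_cell_pos_cone[OF z(2), of "Suc n"]
    by (simp add: factor_top(1)[OF f'] lookup_add in_pos_cone)
  then have "b' \<in> supp (fst (z (Suc n)))"
    using \<open>b \<noteq> b'\<close> by (auto simp: in_keys_iff factor_top(1)[OF f] lookup_add split: if_splits)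
  then have "fst (z (Suc n)) - frag_of b' \<in> pos_cone C (Suc n)"
    using table_cell_pos_cone[OF z(1)] by (intro pos_cone_diff_frag) auto
  moreover have "fst (z (Suc n)) - frag_of b' = ?c - ?e"
    by (simp add: factor_top(1)[OF f] algebra_simps)
  ultimately have rest: "?c - ?e \<in> pos_cone C (Suc n)" by simp
  \<comment> \<open>At a minus face \<open>d\<close> of \<open>b\<close>, the elements other than
    \<open>?e\<close> do not produce \<open>d\<close>, so the coefficient after \<open>?e\<close> is
    at least the final one. Elsewhere \<open>b\<close> does not consume, and the bound for
    \<open>b'\<close> suffices.\<close>
  have pos: "nonneg (fst (x n) + bd C (Suc n) ?e)"
    unfolding nonneg_def
  proof
    fix d
    have 1: "0 \<le> coeff (fst (x n)) d + coeff (bd C (Suc n) (frag_of b)) d"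
      "0 \<le> coeff (fst (x n)) d + coeff (bd C (Suc n) (frag_of b')) d"
      using nonneg_coeff[OF factor_top(4)[OF f], of d] nonneg_coeff[OF factor_top(4)[OF f'], of d]
      by (simp_all add: lookup_add)
    show "0 \<le> coeff (fst (x n) + bd C (Suc n) ?e) d"
    proof (cases "d \<in> minus_face C (Suc n) b")
      case True
      have "coeff (bd C (Suc n) (?c - ?e)) d \<le> 0"
      proof (rule ccontr)
        assume "\<not> coeff (bd C (Suc n) (?c - ?e)) d \<le> 0"
        then obtain y where y: "y \<in> supp (?c - ?e)" "d \<in> plus_face C (Suc n) y"
          using bd_positive[OF rest, of d] by (metis not_le)
        have "supp ((?c - ?e) + ?e) = supp (?c - ?e) \<union> supp ?e"
          using rest e by (intro supp_add_nonneg) (auto simp: in_pos_cone)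
        then have "supp ?c = supp (?c - ?e) \<union> supp ?e"
          by (simp only: diff_add_cancel)
        with y(1) have "y \<in> supp ?c" by blast
        with m True y(2) show False by (auto simp: minimal_in_def)
      qed
      moreover have "coeff (bd C (Suc n) (?c - ?e)) d =
          coeff (snd (x n)) d - coeff (fst (x n)) d - coeff (bd C (Suc n) ?e) d"
        using table_cell_bd(1)[OF x, of n] by (simp add: bd_diff lookup_minus)
      ultimately show ?thesis
        using nonneg_coeff[of "snd (x n)" d] c(2) by (simp add: lookup_add in_pos_cone)
    next
      case False
      then show ?thesis
        using 1 by (simp add: bd_add lookup_add coeff_bd_frag_of[OF b(1)] split: if_splits)
    qed
  qed
  \<comment> \<open>The factor \<open>u\<close> carries exactly \<open>b\<close> and
    \<open>b'\<close>; it is then factored in both orders, and \<open>factor_unique\<close>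
    identifies the results with the given factorisations.\<close>
  obtain u w where uw: "u \<in> table_cell C (Suc n)" "w \<in> table_cell C (Suc n)" "table_tgt n u = table_src n w"
    "x = table_comp n u w" "fst (u (Suc n)) = ?e"
    using split_top[OF x e rest pos] by metis
  have un: "fst (u n) = fst (x n)"
    using uw(3,4) by (simp add: table_comp_columns)
  have split: "\<exists>p q. p \<in> table_cell C (Suc n) \<and> q \<in> table_cell C (Suc n) \<and> table_tgt n p = table_src n q \<and>
      u = table_comp n p q \<and> fst (p (Suc n)) = frag_of a \<and> fst (q (Suc n)) = frag_of a'"
    if "a \<in> elts C (Suc n)" "a' \<in> elts C (Suc n)" "?e = frag_of a + frag_of a'"
      "nonneg (fst (x n) + bd C (Suc n) (frag_of a))" for a a'
  proof -
    have "fst (u (Suc n)) - frag_of a = frag_of a'"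
      by (simp add: uw(5) that(3))
    then show ?thesis
      using split_top[OF uw(1) pos_cone_frag_of[OF that(1)]] pos_cone_frag_of[OF that(2)] that(4) un by metis
  qed
  obtain p p1 where p: "p \<in> table_cell C (Suc n)" "p1 \<in> table_cell C (Suc n)" "table_tgt n p = table_src n p1"
      "u = table_comp n p p1" "fst (p (Suc n)) = frag_of b" "fst (p1 (Suc n)) = frag_of b'"
    using split[OF b _ factor_top(4)[OF f]] by auto
  obtain q q1 where q: "q \<in> table_cell C (Suc n)" "q1 \<in> table_cell C (Suc n)" "table_tgt n q = table_src n q1"
      "u = table_comp n q q1" "fst (q (Suc n)) = frag_of b'" "fst (q1 (Suc n)) = frag_of b"
    using split[OF b(2,1) _ factor_top(4)[OF f']] by (auto simp: add.commute)
  have p1w: "table_tgt n p1 = table_src n w" "table_tgt n q1 = table_src n w"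
    using uw(3) table_tgt_comp[OF p(3)] table_tgt_comp[OF q(3)] by (simp_all add: p(4)[symmetric] q(4)[symmetric])
  have "factor n x b p (table_comp n p1 w)"
    using p uw p1w b by (simp add: factor_def table_assoc table_comp_cell table_src_comp)
  then have py: "p = y" "table_comp n p1 w = z"
    using factor_unique[OF f] by auto
  have "factor n x b' q (table_comp n q1 w)"
    using q uw p1w b unfolding factor_def
    by (simp add: table_comp_cell table_src_comp) (metis table_assoc q(4) uw(4))
  then have qy: "q = y'" "table_comp n q1 w = z'"
    using factor_unique[OF f'] by auto
  show ?thesis
  proof (rule that)
    show "factor n z b' p1 w" "factor n z' b q1 w"
      using p q p1w uw b py(2) qy(2) by (simp_all add: factor_def)
    show "table_tgt n y = table_src n p1" "table_tgt n y' = table_src n q1"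
      "table_comp n y p1 = table_comp n y' q1"
      using p(3,4) q(3,4) py(1) qy(1) by auto
  qed
qed

section \<open>Induction on the number of top elements\<close>

definition mass :: "nat \<Rightarrow> 'a table \<Rightarrow> nat" where
  "mass n x = nat (aug (fst (x (Suc n))))"

lemma mass_factor:
  assumes "factor n x b y z"
  shows "mass n x = Suc (mass n z)"
proof -
  have "0 \<le> aug (fst (z (Suc n)))"
    using assms table_cell_pos_cone[of z C "Suc n" "Suc n"] by (intro aug_nonneg) (simp add: factor_def in_pos_cone)
  then show ?thesis
    by (simp add: mass_def factor_top(1)[OF assms] aug_add nat_add_distrib)
qed

lemma mass_0:
  assumes "x \<in> table_cell C (Suc n)"
  shows "mass n x = 0 \<longleftrightarrow> x \<in> table_cell C n"
proof
  assume "mass n x = 0"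
  then have "fst (x (Suc n)) = 0"
    using aug_pos[of "fst (x (Suc n))"] table_cell_pos_cone[OF assms, of "Suc n"]
    by (auto simp: mass_def in_pos_cone)
  then have "x m = 0" if "n < m" for m
    using cell_column[OF assms that] by (cases "m = Suc n") (simp_all add: prod_eq_iff)
  then show "x \<in> table_cell C n"
    using assms by (rule table_cell_lower[rotated])
next
  assume "x \<in> table_cell C n"
  then show "mass n x = 0"
    by (simp add: mass_def table_cell_zero)
qed

lemma minimal_factor_exists:
  assumes "x \<in> table_cell C (Suc n)" "mass n x = Suc m"
  obtains b y z where "minimal_in n b (fst (x (Suc n)))" "factor n x b y z"
proof -
  have "fst (x (Suc n)) \<noteq> 0" using assms(2) by (auto simp: mass_def)
  then show ?thesis using minimal_exists[OF assms(1)] that by blast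
qed

lemma factor_comp:
  assumes "factor n x b p z" "y \<in> table_cell C (Suc n)" "table_tgt n x = table_src n y"
  shows "table_tgt n z = table_src n y" "factor n (table_comp n x y) b p (table_comp n z y)"
proof -
  show t: "table_tgt n z = table_src n y"
    using assms by (auto simp: factor_def table_tgt_comp)
  show "factor n (table_comp n x y) b p (table_comp n z y)"
    using assms t by (simp add: factor_def table_assoc table_comp_cell table_src_comp)
qed

lemma factor_reduced: "factor n x b y z \<Longrightarrow> reduced (Suc n) n b y"
  by (intro reduced_top) (simp_all add: factor_def)

text \<open>This gives uniqueness of the extension. Splitting off top elements reduces to cells with
  a single one, and canonical splittings reduce these to atoms composed with
  \<open>n\<close>-cells.\<close>

lemma cell_induct:
  assumes x: "x \<in> table_cell C (Suc n)"
    and low: "\<And>v. v \<in> table_cell C n \<Longrightarrow> P v"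
    and atom: "\<And>b. b \<in> elts C (Suc n) \<Longrightarrow> P (atom C (Suc n) b)"
    and comp: "\<And>k x y. k \<le> n \<Longrightarrow> x \<in> table_cell C (Suc n) \<Longrightarrow> y \<in> table_cell C (Suc n) \<Longrightarrow>
      table_tgt k x = table_src k y \<Longrightarrow> P x \<Longrightarrow> P y \<Longrightarrow> P (table_comp k x y)"
  shows "P x"
proof -
  have red: "P y" if b: "b \<in> elts C (Suc n)" and "reduced (Suc n) i b y" "i \<le> n" for b y i
    using that(2,3)
  proof (induction i arbitrary: y)
    case 0
    then show ?case using reduced_0[OF b] atom[OF b] by simp
  next
    case (Suc i)
    then obtain l w r where "canonical (Suc n) i b y l w r"
      using canonical_exists[OF b Suc.prems(1)] by auto
    then have c: "l \<in> table_cell C (Suc i)" "r \<in> table_cell C (Suc i)" "reduced (Suc n) i b w"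
      "table_tgt i l = table_src i w" "table_tgt i w = table_src i r" "y = table_comp i (table_comp i l w) r"
      by (auto simp: canonical_def)
    have n: "l \<in> table_cell C n" "r \<in> table_cell C n" "l \<in> table_cell C (Suc n)" "r \<in> table_cell C (Suc n)"
      using c(1,2) Suc.prems(2) by (auto intro: table_cell_mono[of "Suc i"])
    have w: "w \<in> table_cell C (Suc n)" "P w"
      using Suc c(3) by (auto intro: reduced_cell)
    have "P (table_comp i l w)"
      using Suc.prems(2) n w c low by (intro comp) auto
    then show ?case
      unfolding c(6) using Suc.prems(2) n w c low
      by (intro comp) (auto simp: table_tgt_comp table_comp_cell)
  qed
  show ?thesis
    using x
  proof (induction "mass n x" arbitrary: x)
    case 0
    then show ?case using mass_0 low by metis
  next
    case (Suc m)
    obtain b y z where f: "factor n x b y z"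
      using minimal_factor_exists[OF Suc.prems] Suc.hyps(2) by metis
    then have "P z" using Suc mass_factor[OF f] by (simp add: factor_def)
    moreover have "P y" using red[OF _ factor_reduced[OF f]] f by (simp add: factor_def)
    ultimately show ?case
      using f comp[of n y z] by (simp add: factor_def)
  qed
qed

end


section \<open>The extension\<close>

context extension_problem
begin

text \<open>The lower set of \<open>b\<close> contains \<open>b\<close> but not \<open>b'\<close>,
  so \<open>separate_cell\<close> puts the two elements side by side along \<open>n - 1\<close>.
  Both orders along \<open>n\<close> are exchanges of this composite, evaluated by
  \<open>whiskers\<close>.\<close>

lemma top_swap_aux:
  assumes b: "b \<in> elts C (Suc n)" "b' \<in> elts C (Suc n)" and nb: "b' \<notin> below (Suc n) b (Suc n)"
    and y: "y \<in> K (Suc n)" "fst (y (Suc n)) = frag_of b" and y1: "y1 \<in> K (Suc n)" "fst (y1 (Suc n)) = frag_of b"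
    and y': "y' \<in> K (Suc n)" "fst (y' (Suc n)) = frag_of b'" and y1': "y1' \<in> K (Suc n)" "fst (y1' (Suc n)) = frag_of b'"
    and t: "table_tgt n y = table_src n y1'" "table_tgt n y' = table_src n y1"
    and eq: "table_comp n y y1' = table_comp n y' y1"
  shows "comp n (can n b y) (can n b' y1') = comp n (can n b' y') (can n b y1)"
proof -
  let ?z = "table_comp n y y1'"
  have z: "?z \<in> K (Suc n)"
    by (rule table_comp_cell[OF y(1) y1'(1) t(1)])
  have cones: "frag_of b \<in> pos_cone C (Suc n)" "frag_of b' \<in> pos_cone C (Suc n)"
    using b by (simp_all add: pos_cone_frag_of)
  have col: "y m = column (Suc n) (frag_of b) m" "y' m = column (Suc n) (frag_of b') m" if "n < m" for m
    using cell_column[OF y(1) that] cell_column[OF y'(1) that] y(2) y'(2) by simp_all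
  have zm: "?z m = column (Suc n) (frag_of b) m + column (Suc n) (frag_of b') m" if "n < m" for m
    using table_comp_columns(4)[OF t(1) that] cell_column[OF y(1) that] cell_column[OF y1'(1) that] y y1' by simp
  have nonneg': "nonneg (fst (?z n) + bd C (Suc n) (frag_of b'))"
    using nonneg_first_factor[OF y'(1), of n] table_comp_fst[OF t(2)] eq y'(2) by simp
  show ?thesis
  proof (cases n)
    \<comment> \<open>In a 1-cell two elements never commute: augmentation 1 would force one of the
      two generators to be zero.\<close>
    case 0
    have "frag_of b = 0 \<or> frag_of b' = 0"
    proof (rule no_swap_in_degree_0)
      show "frag_of b \<in> pos_cone C (Suc 0)" "frag_of b' \<in> pos_cone C (Suc 0)"
        using cones 0 by auto
      show "nonneg (fst (?z 0))" "aug (fst (?z 0)) = 1"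
        using table_cell_pos_cone[OF z, of 0] table_cell_aug[OF z] by (auto simp: in_pos_cone)
      show "nonneg (fst (?z 0) + bd C (Suc 0) (frag_of b'))"
        using nonneg' 0 by simp
      show "nonneg (fst (?z 0) + bd C (Suc 0) (frag_of b))"
        using nonneg_first_factor[OF y(1), of n] table_comp_fst[OF t(1)] y(2) 0 by simp
      show "nonneg (fst (?z 0) + (bd C (Suc 0) (frag_of b) + bd C (Suc 0) (frag_of b')))"
        using nonneg_first_factor[OF z, of n] zm[of "Suc n"] 0 by (simp add: bd_add)
    qed
    then show ?thesis by simp
  next
    case (Suc k)
    have k: "k < n" "Suc k < Suc n" "k \<le> n" using Suc by auto
    have supp_b: "supp (frag_of b) \<subseteq> below (Suc n) b (Suc n)" "supp (frag_of b') \<inter> below (Suc n) b (Suc n) = {}"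
      using b nb by (simp_all add: below_def prec_refl)
    obtain p q where pq: "p \<in> K (Suc n)" "q \<in> K (Suc n)" "table_tgt k p = table_src k q"
      "?z = table_comp k p q" "\<And>m. n < m \<Longrightarrow> p m = column (Suc n) (frag_of b) m"
      "\<And>m. n < m \<Longrightarrow> q m = column (Suc n) (frag_of b') m"
    proof (rule separate_cell[OF z k(2) _ _ _ lower_set_below[of "Suc n" b]])
      show "upper (Suc n) (Suc k) (column (Suc n) (frag_of b))" "upper (Suc n) (Suc k) (column (Suc n) (frag_of b'))"
        using upper_column[OF cones(1), of "Suc n"] upper_column[OF cones(2), of "Suc n"] Suc by simp_all
    next
      fix m assume "Suc k < m"
      then show "?z m = column (Suc n) (frag_of b) m + column (Suc n) (frag_of b') m"
        using zm Suc by simp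
    next
      fix d assume "coeff (bd C (Suc (Suc k)) (fst (column (Suc n) (frag_of b) (Suc (Suc k))))) d < 0"
      then show "d \<in> below (Suc n) b (Suc k)"
        using restrict_bd_negative[OF cones(1) supp_b(1)] Suc by simp
    next
      fix d assume "0 < coeff (bd C (Suc (Suc k)) (fst (column (Suc n) (frag_of b') (Suc (Suc k))))) d"
      then show "d \<notin> below (Suc n) b (Suc k)"
        using restrict_bd_positive[OF cones(2) supp_b(2)] Suc by simp
    next
      show "nonneg (fst (?z (Suc k)) + bd C (Suc (Suc k)) (fst (column (Suc n) (frag_of b') (Suc (Suc k)))))"
        using nonneg' Suc by simp
    next
      fix p q
      assume *: "p \<in> K (Suc n)" "q \<in> K (Suc n)" "table_tgt k p = table_src k q" "?z = table_comp k p q"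
        "\<And>m. Suc k < m \<Longrightarrow> p m = column (Suc n) (frag_of b) m"
        "\<And>m. Suc k < m \<Longrightarrow> q m = column (Suc n) (frag_of b') m"
      show thesis
        by (rule that[OF *(1-4)]) (simp_all add: *(5,6) Suc)
    qed
    have p: "reduced (Suc n) n b p" and q: "reduced (Suc n) n b' q"
      using reduced_top[OF pq(1), of b] reduced_top[OF pq(2), of b'] pq(5,6)[of "Suc n"] by auto
    have "y = table_comp k p (table_src n q) \<and> y1' = table_comp k (table_tgt n p) q"
      using pq(5) col(1)
      by (intro table_factor_side_by_side_left[OF k(1) _ pq(1-3) y(1) y1'(1) t(1) pq(4)]) auto
    then have yy: "y = table_comp k p (table_src n q)" "y1' = table_comp k (table_tgt n p) q" by auto
    have "y' = table_comp k (table_src n p) q \<and> y1 = table_comp k p (table_tgt n q)"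
      using pq(6) col(2)
      by (intro table_factor_side_by_side_right[OF k(1) _ pq(1-3) y'(1) y1(1) t(2) trans[OF eq[symmetric] pq(4)]]) auto
    then have yy': "y' = table_comp k (table_src n p) q" "y1 = table_comp k p (table_tgt n q)" by auto
    have tk: "table_tgt k (table_src n p) = table_src k q" "table_tgt k p = table_src k (table_tgt n q)"
      "table_tgt k p = table_src k (table_src n q)" "table_tgt k (table_tgt n p) = table_src k q"
      using pq(1-3) k by (simp_all add: A.T_S A.S_T A.S_S A.T_T)
    note W = whiskers[OF order_refl]
    have "can n b y = comp k (can n b p) (F (table_src n q))"
      "can n b y1 = comp k (can n b p) (F (table_tgt n q))"
      unfolding yy yy' by (rule whiskersD(1)[OF W b(1) p table_src_cell[OF pq(2)] k(1) tk(3)])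
        (rule whiskersD(1)[OF W b(1) p table_tgt_cell[OF pq(2)] k(1) tk(2)])
    moreover have "can n b' y1' = comp k (F (table_tgt n p)) (can n b' q)"
      "can n b' y' = comp k (F (table_src n p)) (can n b' q)"
      unfolding yy yy' by (rule whiskersD(2)[OF W b(2) q table_tgt_cell[OF pq(1)] k(1) tk(4)])
        (rule whiskersD(2)[OF W b(2) q table_src_cell[OF pq(1)] k(1) tk(1)])
    ultimately show ?thesis
      using exchange_values[OF lies_over_can[OF b(1) order_refl p] lies_over_can[OF b(2) order_refl q]
          k(1) order_refl pq(3)] by simp
  qed
qed

text \<open>By antisymmetry at least one of the two elements is not below the other, which supplies
  the asymmetric hypothesis of \<open>top_swap_aux\<close>.\<close>

lemma top_swap:
  assumes b: "b \<in> elts C (Suc n)" "b' \<in> elts C (Suc n)" and "b \<noteq> b'"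
    and y: "y \<in> K (Suc n)" "fst (y (Suc n)) = frag_of b" and y1: "y1 \<in> K (Suc n)" "fst (y1 (Suc n)) = frag_of b"
    and y': "y' \<in> K (Suc n)" "fst (y' (Suc n)) = frag_of b'" and y1': "y1' \<in> K (Suc n)" "fst (y1' (Suc n)) = frag_of b'"
    and t: "table_tgt n y = table_src n y1'" "table_tgt n y' = table_src n y1"
    and eq: "table_comp n y y1' = table_comp n y' y1"
  shows "comp n (can n b y) (can n b' y1') = comp n (can n b' y') (can n b y1)"
proof (cases "b' \<in> below (Suc n) b (Suc n)")
  case True
  then have "b \<notin> below (Suc n) b' (Suc n)"
    using prec_antisym \<open>b \<noteq> b'\<close> by (auto simp: below_def)
  from top_swap_aux[OF b(2,1) this y' y1' y y1 t(2,1) eq[symmetric]] show ?thesis by simp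
next
  case False
  from top_swap_aux[OF b this y y1 y' y1' t eq] show ?thesis .
qed

text \<open>The chosen factorisation is minimal because \<open>factor_diamond\<close> compares two
  factorisations only if one is; \<open>ext_mass_factor\<close> then gives the same value for every
  factorisation.\<close>

primrec ext_mass :: "nat \<Rightarrow> 'a table \<Rightarrow> 'c" where
  "ext_mass 0 x = F x"
| "ext_mass (Suc m) x = (case SOME (b, y, z). minimal_in n b (fst (x (Suc n))) \<and> factor n x b y z of
     (b, y, z) \<Rightarrow> comp n (can n b y) (ext_mass m z))"

declare ext_mass.simps(2) [simp del]

lemma ext_massE:
  assumes "x \<in> K (Suc n)" "mass n x = Suc m"
  obtains b y z where "minimal_in n b (fst (x (Suc n)))" "factor n x b y z"
    "ext_mass (Suc m) x = comp n (can n b y) (ext_mass m z)"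
proof -
  define t where "t = (SOME (b, y, z). minimal_in n b (fst (x (Suc n))) \<and> factor n x b y z)"
  obtain b y z where t: "t = (b, y, z)" by (cases t) auto
  obtain b' y' z' where f: "minimal_in n b' (fst (x (Suc n)))" "factor n x b' y' z'"
    using minimal_factor_exists[OF assms] by metis
  have "case t of (b, y, z) \<Rightarrow> minimal_in n b (fst (x (Suc n))) \<and> factor n x b y z"
    unfolding t_def by (rule someI[of _ "(b', y', z')"]) (simp add: f)
  then have "minimal_in n b (fst (x (Suc n)))" "factor n x b y z"
    unfolding t by simp_all
  moreover have "ext_mass (Suc m) x = (case t of (b, y, z) \<Rightarrow> comp n (can n b y) (ext_mass m z))"
    unfolding t_def by (rule ext_mass.simps(2))
  then have "ext_mass (Suc m) x = comp n (can n b y) (ext_mass m z)"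
    unfolding t by simp
  ultimately show ?thesis by (rule that)
qed

lemma lies_over_ext_mass:
  "x \<in> K (Suc n) \<Longrightarrow> mass n x = m \<Longrightarrow> lies_over (ext_mass m x) x"
proof (induction m arbitrary: x)
  case 0
  then show ?case using mass_0 lies_over_F by simp
next
  case (Suc m)
  obtain b y z where f: "factor n x b y z" "ext_mass (Suc m) x = comp n (can n b y) (ext_mass m z)"
    using ext_massE[OF Suc.prems] by metis
  have "lies_over (ext_mass m z) z"
    using Suc f mass_factor[OF f(1)] by (simp add: factor_def)
  moreover have "lies_over (can n b y) y"
    using f factor_reduced[OF f(1)] by (intro lies_over_can) (auto simp: factor_def)
  ultimately show ?case
    unfolding f(2) using f(1) lies_over_comp[of "can n b y" y "ext_mass m z" z n] by (simp add: factor_def)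
qed

text \<open>Compare with the chosen minimal factorisation. If the elements differ, the two close up
  to a diamond: the induction hypothesis evaluates both remainders by the common rest
  \<open>w\<close>, and \<open>top_swap\<close> equates what precedes it.\<close>

lemma ext_mass_factor:
  "mass n x = Suc m \<Longrightarrow> factor n x b' y' z' \<Longrightarrow> ext_mass (Suc m) x = comp n (can n b' y') (ext_mass m z')"
proof (induction m arbitrary: x b' y' z')
  case (0 x b' y' z')
  note x = factor_top(2)[OF 0(2)]
  obtain b y z where f: "factor n x b y z" "ext_mass (Suc 0) x = comp n (can n b y) (ext_mass 0 z)"
    using ext_massE[OF x 0(1)] by metis
  \<comment> \<open>With mass 1 nothing is left in degree \<open>n + 1\<close>, so the top chain is
    a single generator and \<open>b = b'\<close>.\<close>
  have "z \<in> K n" "z' \<in> K n"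
    using 0 f mass_factor[OF f(1)] mass_factor[OF 0(2)] mass_0 by (auto simp: factor_def)
  then have "frag_of b = frag_of b'"
    using factor_top(1)[OF f(1)] factor_top(1)[OF 0(2)] by (simp add: table_cell_zero)
  then have "b = b'" by (simp add: frag_of_eq)
  then show ?case using f factor_unique[OF f(1)] 0(2) by auto
next
  case (Suc m x b' y' z')
  note x = factor_top(2)[OF Suc.prems(2)]
  obtain b y z where f: "minimal_in n b (fst (x (Suc n)))" "factor n x b y z"
      "ext_mass (Suc (Suc m)) x = comp n (can n b y) (ext_mass (Suc m) z)"
    using ext_massE[OF x Suc.prems(1)] by metis
  note f' = Suc.prems(2)
  show ?case
  proof (cases "b = b'")
    case True
    then show ?thesis using f factor_unique[OF f(2)] f' by auto
  next
    case False
    obtain y1 y1' w where d: "factor n z b' y1' w" "factor n z' b y1 w" "table_tgt n y = table_src n y1'"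
      "table_tgt n y' = table_src n y1" "table_comp n y y1' = table_comp n y' y1"
      using factor_diamond[OF f(2,1) f' False] by metis
    have m: "mass n z = Suc m" "mass n z' = Suc m" "mass n w = m"
      using mass_factor[OF f(2)] mass_factor[OF f'] mass_factor[OF d(1)] Suc.prems(1) by auto
    note IH = Suc.IH[OF m(1) d(1)] Suc.IH[OF m(2) d(2)]
    have lo: "lies_over (can n b y) y" "lies_over (can n b' y1') y1'" "lies_over (can n b' y') y'"
      "lies_over (can n b y1) y1"
      using f f' d factor_reduced[OF f(2)] factor_reduced[OF f'] factor_reduced[OF d(1)] factor_reduced[OF d(2)]
      by (auto intro!: lies_over_can simp: factor_def)
    have w: "lies_over (ext_mass m w) w"
      using lies_over_ext_mass[of w m] d m by (simp add: factor_def)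
    have sw: "comp n (can n b y) (can n b' y1') = comp n (can n b' y') (can n b y1)"
      using f(2) f' d False by (intro top_swap) (auto simp: factor_def)
    have tw: "table_tgt n y1' = table_src n w" "table_tgt n y1 = table_src n w"
      using d by (auto simp: factor_def)
    show ?thesis
      unfolding f(3) IH lies_over_assoc[OF lo(1,2) w order_refl d(3) tw(1), symmetric]
        lies_over_assoc[OF lo(3,4) w order_refl d(4) tw(2), symmetric] sw ..
  qed
qed

section \<open>Functoriality of the extension on cells of dimension n + 1\<close>

definition ext :: "'a table \<Rightarrow> 'c" where
  "ext x = ext_mass (mass n x) x"

lemma lies_over_ext: "x \<in> K (Suc n) \<Longrightarrow> lies_over (ext x) x"
  by (simp add: ext_def lies_over_ext_mass)

lemma ext_factor: "factor n x b y z \<Longrightarrow> ext x = comp n (can n b y) (ext z)"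
  by (simp add: ext_def mass_factor ext_mass_factor)

lemma ext_low: "v \<in> K n \<Longrightarrow> ext v = F v"
  using mass_0[of v n] cell_up[of v n] by (simp add: ext_def)

lemma ext_induct [consumes 1, case_names low factor]:
  assumes "x \<in> K (Suc n)" "\<And>v. v \<in> K n \<Longrightarrow> P v"
    "\<And>x b y z. factor n x b y z \<Longrightarrow> P z \<Longrightarrow> P x"
  shows "P x"
  using assms(1)
proof (induction "mass n x" arbitrary: x)
  case 0
  then show ?case using mass_0 assms(2) by metis
next
  case (Suc m)
  obtain b y z where f: "factor n x b y z"
    using minimal_factor_exists[OF Suc.prems] Suc.hyps(2) by metis
  then have "P z" using Suc mass_factor[OF f] by (simp add: factor_def)
  with f show ?case by (rule assms(3))
qed

lemma factorD:
  assumes "factor n x b y z"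
  shows "b \<in> elts C (Suc n)" "y \<in> K (Suc n)" "z \<in> K (Suc n)" "table_tgt n y = table_src n z"
    "x = table_comp n y z" "fst (y (Suc n)) = frag_of b" "lies_over (can n b y) y" "lies_over (ext z) z"
  using assms factor_reduced[OF assms] by (auto simp: factor_def intro: lies_over_can lies_over_ext)

text \<open>A factorisation of \<open>x\<close> extends to one of the composite
  (\<open>factor_comp\<close>). The element split off need not be minimal in the composite, which is
  why \<open>ext_factor\<close> has to hold for all factorisations.\<close>

lemma ext_comp_top:
  assumes "x \<in> K (Suc n)" and y: "y \<in> K (Suc n)" and "table_tgt n x = table_src n y"
  shows "ext (table_comp n x y) = comp n (ext x) (ext y)"
  using assms(1,3)
proof (induction x rule: ext_induct)
  case (low v)
  then have v: "v = table_src n y" by (simp add: table_tgt_id)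
  then have "table_comp n v y = y" using A.unit_left[OF _ y] by simp
  moreover have "ext v = S n (ext y)"
    using ext_low[OF low(1)] lies_overD(3)[OF lies_over_ext[OF y], of n] v by simp
  ultimately show ?case
    using X.unit_left[of n "ext y"] lies_overD(2)[OF lies_over_ext[OF y]] by simp
next
  case (factor x b p z)
  note f = factorD[OF factor(1)] and g = factor_comp[OF factor(1) y factor(3)]
  have "ext (table_comp n x y) = comp n (can n b p) (comp n (ext z) (ext y))"
    using ext_factor[OF g(2)] factor(2)[OF g(1)] by simp
  also have "\<dots> = comp n (comp n (can n b p) (ext z)) (ext y)"
    using lies_over_assoc[OF f(7,8) lies_over_ext[OF y] order_refl f(4) g(1)] by simp
  finally show ?case by (simp add: ext_factor[OF factor(1)])
qed

text \<open>Whiskering by an \<open>n\<close>-cell leaves column \<open>n + 1\<close> unchanged, so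
  it turns a factorisation of \<open>x\<close> into one of the whiskered cell with the same
  \<open>b\<close>, where \<open>whiskers n\<close> evaluates the first factor.\<close>

lemma ext_whisker_right:
  assumes "x \<in> K (Suc n)" and v: "v \<in> K n" and "k < n" and "table_tgt k x = table_src k v"
  shows "ext (table_comp k x v) = comp k (ext x) (F v)"
  using assms(1,4)
proof (induction x rule: ext_induct)
  case (low x)
  then show ?case
    using table_comp_cell[OF low(1) v] F_comp[OF low(1) v] \<open>k < n\<close> by (simp add: ext_low)
next
  case (factor x b y z)
  note f = factorD[OF factor(1)]
  have vN: "v \<in> K (Suc n)" "table_src n v = v" "table_tgt n v = v"
    using v by (auto simp: cell_up table_src_id table_tgt_id)
  have lv: "lies_over (F v) v" "S n (F v) = F v" "T n (F v) = F v"
    using lies_over_F[OF v] F_src[OF v, of n] F_tgt[OF v, of n] vN by simp_all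
  have t: "table_tgt k y = table_src k v" "table_tgt k z = table_src k v"
    using A.low_comp(2)[OF \<open>k < n\<close> _ f(2-4)] A.T_low_comp[OF \<open>k < n\<close> _ f(2-4)] factor(3) by (simp_all add: f(5))
  have red: "reduced (Suc n) n b y" by (rule factor_reduced[OF factor(1)])
  have eq: "table_comp k x v = table_comp n (table_comp k y v) (table_comp k z v)"
    unfolding f(5) by (rule A.whisker_comp_right[OF \<open>k < n\<close> _ f(2,3) vN(1) f(4) t(1) vN(2,3)]) simp
  have "factor n (table_comp k x v) b (table_comp k y v) (table_comp k z v)"
    unfolding factor_def
  proof (intro conjI)
    show "table_comp k y v \<in> K (Suc n)" "table_comp k z v \<in> K (Suc n)"
      using table_comp_cell f(2,3) vN t by blast+
    show "table_tgt n (table_comp k y v) = table_src n (table_comp k z v)"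
      using \<open>k < n\<close> f vN t by (simp add: A.T_comp_ne A.S_comp_ne)
    show "fst (table_comp k y v (Suc n)) = frag_of b"
      using table_comp_columns(4)[OF t(1), of "Suc n"] \<open>k < n\<close> f(6) table_cell_zero[OF v, of "Suc n"] by simp
  qed (fact f(1) eq)+
  from ext_factor[OF this]
  have "ext (table_comp k x v) = comp n (comp k (can n b y) (F v)) (comp k (ext z) (F v))"
    using whiskersD(1)[OF whiskers[OF order_refl] f(1) red v \<open>k < n\<close> t(1)] factor(2)[OF t(2)] by simp
  also have "\<dots> = comp k (comp n (can n b y) (ext z)) (F v)"
    using X.whisker_comp_right[OF \<open>k < n\<close> _ lies_overD(2)[OF f(7)] lies_overD(2)[OF f(8)] lies_overD(2)[OF lv(1)]
        lies_over_match[OF f(7,8) _ f(4)] lies_over_match[OF f(7) lv(1) _ t(1)] lv(2,3)] \<open>k < n\<close> by simp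
  finally show ?case by (simp add: ext_factor[OF factor(1)])
qed

lemma ext_whisker_left:
  assumes "x \<in> K (Suc n)" and v: "v \<in> K n" and "k < n" and "table_tgt k v = table_src k x"
  shows "ext (table_comp k v x) = comp k (F v) (ext x)"
  using assms(1,4)
proof (induction x rule: ext_induct)
  case (low x)
  then show ?case
    using table_comp_cell[OF v low(1)] F_comp[OF v low(1)] \<open>k < n\<close> by (simp add: ext_low)
next
  case (factor x b y z)
  note f = factorD[OF factor(1)]
  have vN: "v \<in> K (Suc n)" "table_src n v = v" "table_tgt n v = v"
    using v by (auto simp: cell_up table_src_id table_tgt_id)
  have lv: "lies_over (F v) v" "S n (F v) = F v" "T n (F v) = F v"
    using lies_over_F[OF v] F_src[OF v, of n] F_tgt[OF v, of n] vN by simp_all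
  have t: "table_tgt k v = table_src k y" "table_tgt k v = table_src k z"
    using A.low_comp(1)[OF \<open>k < n\<close> _ f(2-4)] A.T_low_comp[OF \<open>k < n\<close> _ f(2-4)] factor(3) by (simp_all add: f(5))
  have red: "reduced (Suc n) n b y" by (rule factor_reduced[OF factor(1)])
  have eq: "table_comp k v x = table_comp n (table_comp k v y) (table_comp k v z)"
    unfolding f(5) by (rule A.whisker_comp_left[OF \<open>k < n\<close> _ f(2,3) vN(1) f(4) t(1) vN(2,3)]) simp
  have "factor n (table_comp k v x) b (table_comp k v y) (table_comp k v z)"
    unfolding factor_def
  proof (intro conjI)
    show "table_comp k v y \<in> K (Suc n)" "table_comp k v z \<in> K (Suc n)"
      using table_comp_cell f(2,3) vN t by blast+
    show "table_tgt n (table_comp k v y) = table_src n (table_comp k v z)"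
      using \<open>k < n\<close> f vN t by (simp add: A.T_comp_ne A.S_comp_ne)
    show "fst (table_comp k v y (Suc n)) = frag_of b"
      using table_comp_columns(4)[OF t(1), of "Suc n"] \<open>k < n\<close> f(6) table_cell_zero[OF v, of "Suc n"] by simp
  qed (fact f(1) eq)+
  from ext_factor[OF this]
  have "ext (table_comp k v x) = comp n (comp k (F v) (can n b y)) (comp k (F v) (ext z))"
    using whiskersD(2)[OF whiskers[OF order_refl] f(1) red v \<open>k < n\<close> t(1)] factor(2)[OF t(2)] by simp
  also have "\<dots> = comp k (F v) (comp n (can n b y) (ext z))"
    using X.whisker_comp_left[OF \<open>k < n\<close> _ lies_overD(2)[OF f(7)] lies_overD(2)[OF f(8)] lies_overD(2)[OF lv(1)]
        lies_over_match[OF f(7,8) _ f(4)] lies_over_match[OF lv(1) f(7) _ t(1)] lv(2,3)] \<open>k < n\<close> by simp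
  finally show ?case by (simp add: ext_factor[OF factor(1)])
qed

text \<open>For \<open>k < n\<close>, an exchange rewrites the composite along \<open>k\<close> as a
  composite along \<open>n\<close> of two cells whiskered by \<open>n\<close>-cells, in the source
  and in the target alike.\<close>

lemma ext_comp:
  assumes "x \<in> K (Suc n)" "y \<in> K (Suc n)" "k \<le> n" "table_tgt k x = table_src k y"
  shows "ext (table_comp k x y) = comp k (ext x) (ext y)"
proof (cases "k = n")
  case True
  then show ?thesis using ext_comp_top assms by simp
next
  case False
  with assms(3) have "k < n" by simp
  let ?p = "table_comp k x (table_src n y)" and ?q = "table_comp k (table_tgt n x) y"
  have s: "table_src n y \<in> K n" "table_tgt n x \<in> K n" "table_src n y \<in> K (Suc n)" "table_tgt n x \<in> K (Suc n)"
    using assms src_n tgt_n A.S_closed A.T_closed by auto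
  have t: "table_tgt k x = table_src k (table_src n y)" "table_tgt k (table_tgt n x) = table_src k y"
    using assms \<open>k < n\<close> by (simp_all add: A.S_S A.T_T)
  have "?p \<in> K (Suc n)" "?q \<in> K (Suc n)"
    using table_comp_cell[OF assms(1) s(3) t(1)] table_comp_cell[OF s(4) assms(2) t(2)] .
  moreover have "table_tgt n ?p = table_src n ?q"
    using assms \<open>k < n\<close> s t by (simp add: A.T_comp_ne A.S_comp_ne A.T_S A.S_T)
  ultimately have "ext (table_comp n ?p ?q) = comp n (ext ?p) (ext ?q)"
    by (rule ext_comp_top)
  also have "\<dots> = comp n (comp k (ext x) (F (table_src n y))) (comp k (F (table_tgt n x)) (ext y))"
    using ext_whisker_right[OF assms(1) s(1) \<open>k < n\<close> t(1)] ext_whisker_left[OF assms(2) s(2) \<open>k < n\<close> t(2)] by simp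
  also have "\<dots> = comp k (ext x) (ext y)"
    by (rule exchange_values(2)[OF lies_over_ext[OF assms(1)] lies_over_ext[OF assms(2)] \<open>k < n\<close> order_refl assms(4)])
  finally show ?thesis
    using A.exchange_right[OF \<open>k < n\<close> _ assms(1,2,4)] by simp
qed

text \<open>The atom factors as itself followed by the identity on its target.\<close>

lemma ext_atom:
  assumes "b \<in> elts C (Suc n)"
  shows "ext (atom C (Suc n) b) = G b"
proof -
  let ?a = "atom C (Suc n) b"
  note a = atom_cell[OF assms]
  have "factor n ?a b ?a (table_tgt n ?a)"
    using a assms A.unit_right[OF _ a] A.T_closed[OF _ a] A.S_T[OF _ _ a]
    by (simp add: factor_def) (simp add: atom_def)
  from ext_factor[OF this] have "ext ?a = comp n (G b) (ext (table_tgt n ?a))"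
    by (simp add: can_atom assms)
  also have "ext (table_tgt n ?a) = T n (G b)"
    using ext_low[OF tgt_n[OF a order_refl]] G_tgt[OF assms] by simp
  finally show ?thesis
    using X.unit_right[of n "G b"] G_closed[OF assms] by simp
qed

end

section \<open>Free generation\<close>

text \<open>Since \<open>ide\<close> leaves tables unchanged, the cells generated in a dimension
  \<open>m\<close> above \<open>n\<close> are the \<open>n\<close>-cells themselves, read as
  iterated identities; hence \<open>min m n\<close>.\<close>

lemma skeleton_omega_of [simp]:
  "cell (skeleton n (omega_of C)) m = table_cell C (min m n)"
  "src (skeleton n (omega_of C)) k m = table_src k"
  "tgt (skeleton n (omega_of C)) k m = table_tgt k"
  "ide (skeleton n (omega_of C)) m = (\<lambda>x. x)"
  "cmp (skeleton n (omega_of C)) k m = table_comp k"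
proof -
  let ?G = "generated (omega_of C) (\<lambda>j. if j \<le> n then cell (omega_of C) j else {})"
  have "x \<in> table_cell C (min m n)" if "?G m x" for m x
    using that
  proof induction
    case (base x m)
    then show ?case by (auto simp: min_def split: if_splits)
  next
    case (src m x k)
    then show ?case
      using table_src_id[of x C "min m n" k] by (auto simp: table_src_cell min_def split: if_splits)
  next
    case (tgt m x k)
    then show ?case
      using table_tgt_id[of x C "min m n" k] by (auto simp: table_tgt_cell min_def split: if_splits)
  next
    case (ide m x)
    then show ?case by (auto intro: table_cell_mono[rotated])
  next
    case (cmp m x y k)
    then show ?case by (auto intro: table_comp_cell)
  qed
  moreover have "?G m x" if "x \<in> table_cell C (min m n)" for m x
  proof (cases "m \<le> n")
    case True
    with that show ?thesis by (auto intro!: generated.base simp: min_def)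
  next
    case False
    then have "n \<le> m" by simp
    then show ?thesis
    proof (induction m rule: dec_induct)
      case base
      show ?case using that False by (auto intro!: generated.base simp: min_def)
    next
      case (step m)
      then show ?case using generated.ide[of "omega_of C" _ m x] by simp
    qed
  qed
  ultimately show "cell (skeleton n (omega_of C)) m = table_cell C (min m n)"
    by (auto simp: skeleton_def)
qed (simp_all add: skeleton_def)

section \<open>From cells of dimension n + 1 to functors on skeleta\<close>

lemma functor_ides:
  assumes "omega_functor (skeleton p (omega_of C)) X h" "x \<in> table_cell C (min k p)"
  shows "h (k + d) x = ides X k d (h k x)"
proof (induction d)
  case (Suc d)
  have "x \<in> table_cell C (min (k + d) p)"
    using assms(2) by (rule table_cell_mono[rotated]) simp
  then show ?case
    using omega_functor.map_ide[OF assms(1), of x "k + d"] Suc by simp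
qed simp

lemma functor_ides':
  assumes "omega_functor (skeleton p (omega_of C)) X h" "x \<in> table_cell C (min k p)" "k \<le> m"
  shows "h m x = ides X k (m - k) (h k x)"
  using functor_ides[OF assms(1,2), of "m - k"] assms(3) by simp

lemma (in parity_complex) extension_problem:
  assumes X: "omega_category X" and f: "omega_functor (skeleton n (omega_of C)) X f"
    and g: "\<And>a. a \<in> atoms C (Suc n) \<Longrightarrow> g a \<in> cell X (Suc n) \<and>
      src X n (Suc n) (g a) = f n (table_src n a) \<and> tgt X n (Suc n) (g a) = f n (table_tgt n a)"
  shows "extension_problem C n (cell X (Suc n)) (omega_category.usrc X (Suc n))
    (omega_category.utgt X (Suc n)) (\<lambda>k. cmp X k (Suc n)) (f (Suc n)) (\<lambda>b. g (atom C (Suc n) b))"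
proof -
  interpret X: omega_category X by (rule X)
  interpret f: omega_functor "skeleton n (omega_of C)" X f by (rule f)
  \<comment> \<open>A \<open>k\<close>-cell read as an \<open>(n + 1)\<close>-cell is sent to an
    iterated identity; this translates the conditions on sources and targets into those with
    \<open>usrc\<close> and \<open>utgt\<close>.\<close>
  have low: "f (Suc n) (table_src k x) = ides X k (Suc n - k) (f k (table_src k x))"
    "f (Suc n) (table_tgt k x) = ides X k (Suc n - k) (f k (table_tgt k x))"
    if "k \<le> n" "x \<in> table_cell C j" for k x j
    using functor_ides'[OF f, of "table_src k x" k "Suc n"] functor_ides'[OF f, of "table_tgt k x" k "Suc n"]
      that table_src_cell[OF that(2)] table_tgt_cell[OF that(2)] by (simp_all add: min_def)
  show ?thesis
  proof (intro extension_problem.intro extension_problem_axioms.intro)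
    show "parity_complex C" by unfold_locales
    show "one_sorted (Suc n) (cell X (Suc n)) (X.usrc (Suc n)) (X.utgt (Suc n)) (\<lambda>k. cmp X k (Suc n))"
      by (rule X.one_sorted)
  next
    fix x assume "x \<in> table_cell C n"
    then show "f (Suc n) x \<in> cell X (Suc n)"
      using f.map_cell[of x "Suc n"] by simp
  next
    fix x k assume x: "x \<in> table_cell C n" and k: "k \<le> n"
    show "f (Suc n) (table_src k x) = X.usrc (Suc n) k (f (Suc n) x)"
      using f.map_src[of k "Suc n" x] low(1)[OF k x] x k by (simp add: X.usrc_def)
    show "f (Suc n) (table_tgt k x) = X.utgt (Suc n) k (f (Suc n) x)"
      using f.map_tgt[of k "Suc n" x] low(2)[OF k x] x k by (simp add: X.utgt_def)
  next
    fix x y k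
    assume "x \<in> table_cell C n" "y \<in> table_cell C n" "k \<le> n" "table_tgt k x = table_src k y"
    then show "f (Suc n) (table_comp k x y) = cmp X k (Suc n) (f (Suc n) x) (f (Suc n) y)"
      using f.map_comp[of k "Suc n" x y] by (simp add: composable_def)
  next
    fix b assume b: "b \<in> elts C (Suc n)"
    then have a: "atom C (Suc n) b \<in> atoms C (Suc n)" by (simp add: atoms_def)
    show "g (atom C (Suc n) b) \<in> cell X (Suc n)"
      using g[OF a] by simp
    show "X.usrc (Suc n) n (g (atom C (Suc n) b)) = f (Suc n) (table_src n (atom C (Suc n) b))"
      using g[OF a] low(1)[OF order_refl atom_cell[OF b]] by (simp add: X.usrc_def)
    show "X.utgt (Suc n) n (g (atom C (Suc n) b)) = f (Suc n) (table_tgt n (atom C (Suc n) b))"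
      using g[OF a] low(2)[OF order_refl atom_cell[OF b]] by (simp add: X.utgt_def)
  qed
qed

lemma (in parity_complex) extension_exists:
  assumes X: "omega_category X" and f: "omega_functor (skeleton n (omega_of C)) X f"
    and g: "\<And>a. a \<in> atoms C (Suc n) \<Longrightarrow> g a \<in> cell X (Suc n) \<and>
      src X n (Suc n) (g a) = f n (table_src n a) \<and> tgt X n (Suc n) (g a) = f n (table_tgt n a)"
  obtains h where "omega_functor (skeleton (Suc n) (omega_of C)) X h"
    "\<And>m x. x \<in> table_cell C (min m n) \<Longrightarrow> h m x = f m x"
    "\<And>a. a \<in> atoms C (Suc n) \<Longrightarrow> h (Suc n) a = g a"
proof -
  interpret X: omega_category X by (rule X)
  interpret f: omega_functor "skeleton n (omega_of C)" X f by (rule f)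
  interpret E: extension_problem C n "cell X (Suc n)" "X.usrc (Suc n)" "X.utgt (Suc n)"
    "\<lambda>k. cmp X k (Suc n)" "f (Suc n)" "\<lambda>b. g (atom C (Suc n) b)"
    by (rule extension_problem[OF X f g])
  \<comment> \<open>Above dimension \<open>n + 1\<close> every cell of the skeleton is an iterated
    identity, so its image must be the iterated identity on the value in dimension
    \<open>n + 1\<close>.\<close>
  define h where "h m x = (if m \<le> n then f m x else ides X (Suc n) (m - Suc n) (E.ext x))" for m x
  have ext_cell: "E.ext x \<in> cell X (Suc n)" if "x \<in> table_cell C (Suc n)" for x
    using E.lies_overD(2)[OF E.lies_over_ext[OF that]] .
  have ext_src: "src X k (Suc n) (E.ext x) = f k (table_src k x)"
    if "x \<in> table_cell C (Suc n)" "k \<le> n" for k x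
  proof -
    have c: "table_src k x \<in> table_cell C (min k n)"
      using table_src_cell[OF that(1)] that(2) by (simp add: min_def)
    have "X.usrc (Suc n) k (E.ext x) = ides X k (Suc n - k) (f k (table_src k x))"
      using E.lies_overD(3)[OF E.lies_over_ext[OF that(1)] that(2)] functor_ides'[OF f c, of "Suc n"] that(2)
      by simp
    then have "src X k (Suc n) (E.ext x) = src X k (Suc n) (ides X k (Suc n - k) (f k (table_src k x)))"
      using X.src_usrc[OF _ ext_cell[OF that(1)], of k] that(2) by simp
    also have "\<dots> = f k (table_src k x)"
      using X.src_ides'[of "f k (table_src k x)" k "Suc n" k] f.map_cell[of "table_src k x" k] c that(2) by simp
    finally show ?thesis .
  qed
  have ext_tgt: "tgt X k (Suc n) (E.ext x) = f k (table_tgt k x)"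
    if "x \<in> table_cell C (Suc n)" "k \<le> n" for k x
  proof -
    have c: "table_tgt k x \<in> table_cell C (min k n)"
      using table_tgt_cell[OF that(1)] that(2) by (simp add: min_def)
    have "X.utgt (Suc n) k (E.ext x) = ides X k (Suc n - k) (f k (table_tgt k x))"
      using E.lies_overD(4)[OF E.lies_over_ext[OF that(1)] that(2)] functor_ides'[OF f c, of "Suc n"] that(2)
      by simp
    then have "tgt X k (Suc n) (E.ext x) = src X k (Suc n) (ides X k (Suc n - k) (f k (table_tgt k x)))"
      using X.src_utgt[OF _ ext_cell[OF that(1)], of k] that(2) by simp
    also have "\<dots> = f k (table_tgt k x)"
      using X.src_ides'[of "f k (table_tgt k x)" k "Suc n" k] f.map_cell[of "table_tgt k x" k] c that(2) by simp
    finally show ?thesis .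
  qed
  have h_cell: "h m x \<in> cell X m" if x: "x \<in> table_cell C (min m (Suc n))" for m x
  proof (cases "m \<le> n")
    case True
    then show ?thesis using f.map_cell[of x m] x by (simp add: h_def min_def)
  next
    case False
    then have "min m (Suc n) = Suc n" by simp
    with False show ?thesis
      using X.ides_cell[OF ext_cell[of x], of "m - Suc n"] x by (simp add: h_def)
  qed
  have h_ext: "h m x = f m x" if x: "x \<in> table_cell C (min m n)" for m x
  proof (cases "m \<le> n")
    case False
    then show ?thesis
      using functor_ides'[OF f, of x "Suc n" m] E.ext_low[of x] x by (simp add: h_def min_def)
  qed (simp add: h_def)
  have h_high: "h m x = ides X (Suc n) (m - Suc n) (E.ext x)" if "n < m" for m x
    using that by (simp add: h_def)
  have "omega_functor (skeleton (Suc n) (omega_of C)) X h"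
  proof (unfold_locales, unfold skeleton_omega_of)
    fix x m assume "x \<in> table_cell C (min m (Suc n))"
    then show "h m x \<in> cell X m" by (rule h_cell)
  next
    fix k m x
    assume "k < m" and x: "x \<in> table_cell C (min m (Suc n))"
    have "h k (table_src k x) = src X k m (h m x) \<and> h k (table_tgt k x) = tgt X k m (h m x)"
    proof (cases "m \<le> n")
      case True
      then show ?thesis
        using f.map_src[of k m x] f.map_tgt[of k m x] x \<open>k < m\<close> by (simp add: h_def min_def)
    next
      case False
      then have "min m (Suc n) = Suc n" "n < m" "Suc n \<le> m" by simp_all
      with x have x: "x \<in> table_cell C (Suc n)" by simp
      note s = X.src_ides'[OF ext_cell[OF x] \<open>Suc n \<le> m\<close> \<open>k < m\<close>]
        X.tgt_ides'[OF ext_cell[OF x] \<open>Suc n \<le> m\<close> \<open>k < m\<close>]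
      show ?thesis
      proof (cases "k \<le> n")
        case True
        then show ?thesis
          using s ext_src[OF x True] ext_tgt[OF x True] by (simp add: h_high[OF \<open>n < m\<close>]) (simp add: h_def)
      next
        case False
        then show ?thesis
          using s table_src_id[OF x, of k] table_tgt_id[OF x, of k] \<open>n < m\<close> by (simp add: h_high)
      qed
    qed
    then show "h k (table_src k x) = src X k m (h m x)" "h k (table_tgt k x) = tgt X k m (h m x)" by auto
  next
    fix x m assume x: "x \<in> table_cell C (min m (Suc n))"
    show "h (Suc m) x = ide X m (h m x)"
    proof (cases "m \<le> n")
      case True
      then have "x \<in> table_cell C (min m n)" "x \<in> table_cell C (min (Suc m) n)"
        using x table_cell_mono[of m "min (Suc m) n" x C] by (auto simp: min_def)
      then show ?thesis using h_ext f.map_ide[of x m] by simp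
    next
      case False
      then have "Suc m - Suc n = Suc (m - Suc n)" "Suc n + (m - Suc n) = m" by auto
      then show ?thesis using False by (simp add: h_high)
    qed
  next
    fix k m x y
    assume "composable (skeleton (Suc n) (omega_of C)) k m x y"
    then have c: "k < m" "x \<in> table_cell C (min m (Suc n))" "y \<in> table_cell C (min m (Suc n))"
      "table_tgt k x = table_src k y" by (auto simp: composable_def)
    show "h m (table_comp k x y) = cmp X k m (h m x) (h m y)"
    proof (cases "m \<le> n")
      case True
      then show ?thesis
        using f.map_comp[of k m x y] c by (simp add: h_def composable_def min_def)
    next
      case False
      then have m: "n < m" "Suc n \<le> m" "min m (Suc n) = Suc n" by simp_all
      with c have xy: "x \<in> table_cell C (Suc n)" "y \<in> table_cell C (Suc n)" by simp_all
      show ?thesis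
      proof (cases "k \<le> n")
        case True
        then have "composable X k (Suc n) (E.ext x) (E.ext y)"
          using ext_src[OF xy(2) True] ext_tgt[OF xy(1) True] c(4) ext_cell xy by (simp add: composable_def)
        from X.ides_comp[OF this, of "m - Suc n"] show ?thesis
          using E.ext_comp[OF xy True c(4)] m by (simp add: h_high)
      next
        case False
        \<comment> \<open>For \<open>k > n\<close> an \<open>(n + 1)\<close>-cell is its own
          \<open>k\<close>-source and \<open>k\<close>-target, so composable cells are equal and
          their composite is a unit law.\<close>
        then have eq: "y = x" "table_comp k x x = x"
          using c(4) xy table_tgt_id[OF xy(1), of k] table_src_id[OF xy(2), of k]
            one_sorted.unit_right[OF one_sorted_omega_of, of k "Suc k" x C]
            table_cell_mono[of "Suc n" "Suc k" x C] by auto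
        have z: "h m x \<in> cell X m" by (rule h_cell[OF c(2)])
        have "ides X k (m - k) (src X k m (h m x)) = h m x"
          using X.src_ides'[OF ext_cell[OF xy(1)] m(2) c(1)] X.ides_ides'[of "Suc n" k m "E.ext x"] False c(1)
          by (simp add: h_high[OF m(1)])
        then show ?thesis
          using X.unit_left[OF c(1) z] eq by simp
      qed
    qed
  qed
  moreover have "h (Suc n) a = g a" if a: "a \<in> atoms C (Suc n)" for a
    using a E.ext_atom by (auto simp: atoms_def h_def)
  ultimately show ?thesis
    using that[of h] h_ext by blast
qed

lemma (in parity_complex) extension_unique:
  assumes h: "omega_functor (skeleton (Suc n) (omega_of C)) X h"
      "omega_functor (skeleton (Suc n) (omega_of C)) X h'"
    and low: "\<And>m x. x \<in> table_cell C (min m n) \<Longrightarrow> h m x = h' m x"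
    and atoms: "\<And>a. a \<in> atoms C (Suc n) \<Longrightarrow> h (Suc n) a = h' (Suc n) a"
    and x: "x \<in> table_cell C (min m (Suc n))"
  shows "h m x = h' m x"
proof (cases "m \<le> n")
  case True
  then show ?thesis using low[of x m] x by (simp add: min_def)
next
  case False
  then have "min m (Suc n) = Suc n" "Suc n \<le> m" by simp_all
  with x have xN: "x \<in> table_cell C (Suc n)" by simp
  have "h (Suc n) x = h' (Suc n) x"
    using xN
  proof (rule cell_induct)
    fix v assume "v \<in> table_cell C n"
    then show "h (Suc n) v = h' (Suc n) v" using low[of v "Suc n"] by simp
  next
    fix b assume "b \<in> elts C (Suc n)"
    then show "h (Suc n) (atom C (Suc n) b) = h' (Suc n) (atom C (Suc n) b)"
      using atoms by (simp add: atoms_def)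
  next
    fix k x y
    assume "k \<le> n" "x \<in> table_cell C (Suc n)" "y \<in> table_cell C (Suc n)" "table_tgt k x = table_src k y"
      and eq: "h (Suc n) x = h' (Suc n) x" "h (Suc n) y = h' (Suc n) y"
    then have "composable (skeleton (Suc n) (omega_of C)) k (Suc n) x y"
      by (simp add: composable_def)
    then show "h (Suc n) (table_comp k x y) = h' (Suc n) (table_comp k x y)"
      using omega_functor.map_comp[OF h(1), of k "Suc n" x y] omega_functor.map_comp[OF h(2), of k "Suc n" x y] eq
      by simp
  qed
  then show ?thesis
    using functor_ides'[OF h(1), of x "Suc n" m] functor_ides'[OF h(2), of x "Suc n" m] xN \<open>Suc n \<le> m\<close> by simp
qed

theorem corollary5p3:
  fixes C :: "'a parity_data"
  assumes "parity_complex C"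
  shows "freely_generated TYPE('d) (omega_of C) (atoms C)"
proof -
  interpret parity_complex C by (rule assms)
  show ?thesis
    unfolding freely_generated_def Let_def
  proof (intro conjI allI impI, goal_cases)
    case 1
    show ?case by (rule omega_category_omega_of)
  next
    case (2 n)
    show ?case by (auto simp: atoms_def atom_cell)
  next
    case 3
    show ?case by (simp add: atoms_0)
  next
    case (4 n X f g)
    then obtain h where "omega_functor (skeleton (Suc n) (omega_of C)) X h"
      "\<And>m x. x \<in> table_cell C (min m n) \<Longrightarrow> h m x = f m x"
      "\<And>a. a \<in> atoms C (Suc n) \<Longrightarrow> h (Suc n) a = g a"
      using extension_exists[of X n f g] by auto
    then show ?case by (intro exI[of _ h]) simp
  next
    case (5 n X f g h h' m)
    then show ?case
      using extension_unique[of n X h h' _ m] by simp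
  qed
qed

end
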